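(* For any finite poset $\mathcal{P}=(\{1,\ldots,n\},\preceq)$ there are isomorphisms of $K$-algebras \[ A \cong\begin{pmatrix} R' & 0 \\ \mathbb{M}_{1 \times n}(K)&K \end{pmatrix} \hookrightarrow \begin{pmatrix} K\mathcal{P} & 0 \\ \mathbb{M}_{1 \times n}(K)&K \end{pmatrix} \cong \mathcal{R}, \] where $\mathcal{R}$ is the right Burt-Butler algebra of the bocs $(A,U)$ associated to $\mathcal{P}$, and the middle arrow is the inclusion of subalgebras of $\mathbb{M}_{n+1}(K)$.
   Context: $K$ is an arbitrary field. $\mathcal{P}=(\{1,\ldots,n\},\preceq)$, $n\geq 1$, is a finite poset such that $i\preceq j$ implies $i\leq j$. Matrix notation: $\mathbb{M}_{m\times n}(K)$ denotes $m\times n$ matrices over $K$; $R'$ is the algebra of diagonal $n\times n$ matrices; the incidence algebra is $K\mathcal{P}=\{M\in\mathbb{M}_n(K)\mid M_{ji}\neq 0 \text{ implies } i\preceq j\}$. The bocs $(A,U)$ associated to $\mathcal{P}$: let $T=KQ$ be the path algebra (arrows composed from right to left) of the quiver $Q$ with vertices $0,1,\ldots,n$, arrows $\alpha_i:i\to 0$ for $i\in\mathcal{P}$ and arrows $v_{ij}:j\to i$ for each $i\prec j$; $e_0,\ldots,e_n$ are the trivial paths. Grade $T$ by $|e_i|=|\alpha_i|=0$, $|v_{ij}|=1$. Let $A:=T_0$ (with basis $e_0,\ldots,e_n,\alpha_1,\ldots,\alpha_n$, $\alpha_i=e_0\alpha_ie_i$) and $V:=T_1$ (with basis $v_{ij},\alpha_iv_{ij}$,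 $i\prec j$); then $T\cong T_A(V)$, in particular $T_2\cong V\otimes_AV$. Let $\delta:T\to T$ be the degree one linear map with $\delta(ab)=\delta(a)b+(-1)^{|a|}a\delta(b)$ for homogeneous $a,b$, determined by $\delta(e_i)=0$, $\delta(\alpha_i)=-\sum_{h\prec i}\alpha_hv_{hi}$, $\delta(v_{ij})=\sum_{i\prec k\prec j}v_{ik}v_{kj}$ (one has $\delta^2=0$). Put $U:=\omega A\oplus V$ for a symbol $\omega$, an $A$-$A$-bimodule via $a(\omega b+v)=\omega ab+\delta(a)b+av$ and $(\omega b+v)a=\omega ba+va$, with counit $\epsilon:U\to A$, $\epsilon(\omega b+v)=b$, and comultiplication $\mu:U\to U\otimes_AU$, $\mu(\omega b+v)=\omega\otimes\omega b+\delta(v)+\omega\otimes v+v\otimes\omega$. The right Burt-Butler algebra $\mathcal{R}$ is the vector space $\mathrm{Hom}_A({}_AU,{}_AA)$ of left $A$-module maps with product $(fg)(u)=\sum_t g(u^1_tf(u^2_t))$ where $\mu(u)=\sum_t u^1_t\otimes u^2_t$; its identity is $\epsilon$. *)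

theory Defs
  imports
    "Jordan_Normal_Form.VS_Connect"
    "Graph_Theory.Arc_Walk"
    "HOL-Algebra.QuotRing"
    "HOL-Algebra.Free_Abelian_Groups"
begin


section \<open>Algebras over a field\<close>

text \<open>The locale of commutative algebras in HOL-Algebra is too narrow for path algebras and matrix
  algebras. An algebra is unital and associative; its ring and vector space structures are kept in
  one record, as in \<^const>\<open>module_mat\<close>.\<close>

definition K_algebra :: "('k::field, 'a, 'x) module_scheme \<Rightarrow> bool" where
  "K_algebra M \<longleftrightarrow>
     ring M \<and> Module.module (class_ring :: 'k ring) M \<and>
     (\<forall>c. \<forall>x\<in>carrier M. \<forall>y\<in>carrier M.
        (c \<odot>\<^bsub>M\<^esub> x) \<otimes>\<^bsub>M\<^esub> y = c \<odot>\<^bsub>M\<^esub> (x \<otimes>\<^bsub>M\<^esub> y) \<and>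
        x \<otimes>\<^bsub>M\<^esub> (c \<odot>\<^bsub>M\<^esub> y) = c \<odot>\<^bsub>M\<^esub> (x \<otimes>\<^bsub>M\<^esub> y))"

definition K_subalgebra :: "'a set \<Rightarrow> ('k::field, 'a, 'x) module_scheme \<Rightarrow> bool" where
  "K_subalgebra S M \<longleftrightarrow> K_algebra M \<and> S \<subseteq> carrier M \<and> K_algebra (M\<lparr>carrier := S\<rparr>)"

definition K_algebra_iso ::
    "('k::field, 'a, 'x) module_scheme \<Rightarrow> ('k, 'b, 'y) module_scheme \<Rightarrow> ('a \<Rightarrow> 'b) set" where
  "K_algebra_iso M N =
     {h \<in> ring_iso M N. \<forall>c. \<forall>x\<in>carrier M. h (c \<odot>\<^bsub>M\<^esub> x) = c \<odot>\<^bsub>N\<^esub> h x}"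

definition K_algebra_isomorphic ::
    "('k::field, 'a, 'x) module_scheme \<Rightarrow> ('k, 'b, 'y) module_scheme \<Rightarrow> bool" where
  "K_algebra_isomorphic M N \<longleftrightarrow> K_algebra M \<and> K_algebra N \<and> K_algebra_iso M N \<noteq> {}"

section \<open>Path algebras\<close>

text \<open>The triple \<open>(u, p, v)\<close> is the path from \<open>u\<close> to \<open>v\<close> that runs through the arrows of the list \<open>p\<close>
  in order of traversal. Since arrows are composed from right to left, the product \<open>pq\<close> traverses
  \<open>q\<close> first.\<close>

type_synonym ('v, 'e) qpath = "'v \<times> 'e list \<times> 'v"

definition qpaths :: "('v, 'e) pre_digraph \<Rightarrow> ('v, 'e) qpath set" where
  "qpaths Q = {(u, p, v). pre_digraph.awalk Q u p v}"

definition composable :: "('v, 'e) qpath \<Rightarrow> ('v, 'e) qpath \<Rightarrow> bool" where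
  "composable p q \<longleftrightarrow> fst p = snd (snd q)"

definition qcomp :: "('v, 'e) qpath \<Rightarrow> ('v, 'e) qpath \<Rightarrow> ('v, 'e) qpath" where
  "qcomp p q = (fst q, fst (snd q) @ fst (snd p), snd (snd p))"

definition path_elt :: "('v, 'e) qpath \<Rightarrow> ('v, 'e) qpath \<Rightarrow> 'k::field" where
  "path_elt p = (\<lambda>q. if q = p then 1 else 0)"

definition path_algebra :: "('v, 'e) pre_digraph \<Rightarrow> ('k::field, ('v, 'e) qpath \<Rightarrow> 'k) module" where
  "path_algebra Q =
     \<lparr>carrier = {f. finite {p. f p \<noteq> 0} \<and> {p. f p \<noteq> 0} \<subseteq> qpaths Q},
      monoid.mult = (\<lambda>f g r.
        \<Sum>(p, q) | p \<in> qpaths Q \<and> q \<in> qpaths Q \<and> composable p q \<and> qcomp p q = r. f p * g q),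
      monoid.one = (\<lambda>p. if p \<in> (\<lambda>v. (v, [], v)) ` verts Q then 1 else 0),
      ring.zero = (\<lambda>p. 0),
      ring.add = (\<lambda>f g p. f p + g p),
      Module.module.smult = (\<lambda>c f p. c * f p)\<rparr>"

section \<open>Tensor products of bimodules and Burt-Butler algebras\<close>

text \<open>In a \<open>bimodule\<close> record over \<open>A\<close> the field \<^const>\<open>Module.smult\<close> is the left action of \<open>A\<close>
  and \<open>rsmult\<close> the right action. The fields \<open>mult\<close> and \<open>one\<close> inherited from rings are not used.\<close>

record ('a, 'm) bimodule = "('a, 'm) module" +
  rsmult :: "'m \<Rightarrow> 'a \<Rightarrow> 'm" (infixl \<open>\<odot>\<^sub>r\<index>\<close> 70)

text \<open>\<open>M \<otimes>\<^sub>A N\<close> is the quotient of the free abelian group on \<open>M \<times> N\<close> by biadditivity and \<open>A\<close>-balancing.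
  As a quotient group of HOL-Algebra it is written multiplicatively: the group operation of
  \<open>tensor_product\<close> is the addition of tensors.\<close>

definition tensor_relations ::
    "('k, 'a, 'x) module_scheme \<Rightarrow> ('a, 'm, 'y) bimodule_scheme \<Rightarrow> ('a, 'n, 'z) bimodule_scheme
     \<Rightarrow> ('m \<times> 'n \<Rightarrow>\<^sub>0 int) set" where
  "tensor_relations A M N =
     {frag_of (x \<oplus>\<^bsub>M\<^esub> x', y) - frag_of (x, y) - frag_of (x', y) |x x' y.
        x \<in> carrier M \<and> x' \<in> carrier M \<and> y \<in> carrier N} \<union>
     {frag_of (x, y \<oplus>\<^bsub>N\<^esub> y') - frag_of (x, y) - frag_of (x, y') |x y y'.
        x \<in> carrier M \<and> y \<in> carrier N \<and> y' \<in> carrier N} \<union>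
     {frag_of (x \<odot>\<^sub>r\<^bsub>M\<^esub> a, y) - frag_of (x, a \<odot>\<^bsub>N\<^esub> y) |x a y.
        x \<in> carrier M \<and> a \<in> carrier A \<and> y \<in> carrier N}"

definition tensor_kernel ::
    "('k, 'a, 'x) module_scheme \<Rightarrow> ('a, 'm, 'y) bimodule_scheme \<Rightarrow> ('a, 'n, 'z) bimodule_scheme
     \<Rightarrow> ('m \<times> 'n \<Rightarrow>\<^sub>0 int) set" where
  "tensor_kernel A M N =
     generate (free_Abelian_group (carrier M \<times> carrier N)) (tensor_relations A M N)"

definition tensor_product ::
    "('k, 'a, 'x) module_scheme \<Rightarrow> ('a, 'm, 'y) bimodule_scheme \<Rightarrow> ('a, 'n, 'z) bimodule_scheme
     \<Rightarrow> ('m \<times> 'n \<Rightarrow>\<^sub>0 int) set monoid" where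
  "tensor_product A M N = free_Abelian_group (carrier M \<times> carrier N) Mod tensor_kernel A M N"

definition pure_tensor ::
    "('k, 'a, 'x) module_scheme \<Rightarrow> ('a, 'm, 'y) bimodule_scheme \<Rightarrow> ('a, 'n, 'z) bimodule_scheme
     \<Rightarrow> 'm \<Rightarrow> 'n \<Rightarrow> ('m \<times> 'n \<Rightarrow>\<^sub>0 int) set" where
  "pure_tensor A M N x y =
     tensor_kernel A M N #>\<^bsub>free_Abelian_group (carrier M \<times> carrier N)\<^esub> frag_of (x, y)"

text \<open>The right Burt-Butler algebra of a bocs \<open>(A, U)\<close> with counit \<open>\<epsilon>\<close> and comultiplication \<open>\<mu>\<close>. In the
  product, \<open>\<mu> u\<close> is written as a sum of pure tensors \<open>u1 t \<otimes> u2 t\<close>; the value does not depend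
  on the way this is done. Maps are \<^const>\<open>undefined\<close> outside \<open>U\<close>, so that equality of maps on
  \<open>U\<close> is equality in HOL.\<close>

definition burt_butler_mult ::
    "('k::field, 'a, 'x) module_scheme \<Rightarrow> ('a, 'u, 'y) bimodule_scheme
     \<Rightarrow> ('u \<Rightarrow> ('u \<times> 'u \<Rightarrow>\<^sub>0 int) set) \<Rightarrow> ('u \<Rightarrow> 'a) \<Rightarrow> ('u \<Rightarrow> 'a) \<Rightarrow> ('u \<Rightarrow> 'a)" where
  "burt_butler_mult A U \<mu> f g = (\<lambda>u\<in>carrier U. THE a.
     \<exists>(m::nat) u1 u2.
       u1 \<in> {..<m} \<rightarrow> carrier U \<and> u2 \<in> {..<m} \<rightarrow> carrier U \<and>
       \<mu> u = finprod (tensor_product A U U) (\<lambda>t. pure_tensor A U U (u1 t) (u2 t)) {..<m} \<and>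
       a = finsum A (\<lambda>t. g (u1 t \<odot>\<^sub>r\<^bsub>U\<^esub> f (u2 t))) {..<m})"

definition right_burt_butler ::
    "('k::field, 'a, 'x) module_scheme \<Rightarrow> ('a, 'u, 'y) bimodule_scheme
     \<Rightarrow> ('u \<Rightarrow> 'a) \<Rightarrow> ('u \<Rightarrow> ('u \<times> 'u \<Rightarrow>\<^sub>0 int) set) \<Rightarrow> ('k, 'u \<Rightarrow> 'a) module" where
  "right_burt_butler A U \<epsilon> \<mu> =
     \<lparr>carrier = {f \<in> carrier U \<rightarrow>\<^sub>E carrier A.
        (\<forall>u\<in>carrier U. \<forall>u'\<in>carrier U. f (u \<oplus>\<^bsub>U\<^esub> u') = f u \<oplus>\<^bsub>A\<^esub> f u') \<and>
        (\<forall>a\<in>carrier A. \<forall>u\<in>carrier U. f (a \<odot>\<^bsub>U\<^esub> u) = a \<otimes>\<^bsub>A\<^esub> f u)},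
      monoid.mult = burt_butler_mult A U \<mu>,
      monoid.one = restrict \<epsilon> (carrier U),
      ring.zero = (\<lambda>u\<in>carrier U. \<zero>\<^bsub>A\<^esub>),
      ring.add = (\<lambda>f g. \<lambda>u\<in>carrier U. f u \<oplus>\<^bsub>A\<^esub> g u),
      Module.module.smult = (\<lambda>c f. \<lambda>u\<in>carrier U. c \<odot>\<^bsub>A\<^esub> f u)\<rparr>"

section \<open>The bocs of a poset\<close>

text \<open>The poset is a relation \<open>P\<close> on \<open>{1..n}\<close>, with \<open>(i, j) \<in> P\<close> for \<open>i \<preceq> j\<close>. The arrow
  \<open>Alpha i\<close> is \<open>\<alpha>\<^sub>i: i \<rightarrow> 0\<close> and \<open>Vee i j\<close> is \<open>v\<^sub>i\<^sub>j: j \<rightarrow> i\<close>.\<close>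

abbreviation strict :: "nat rel \<Rightarrow> nat rel" where
  "strict P \<equiv> P - Id"

datatype arrow = Alpha nat | is_Vee: Vee nat nat

type_synonym 'k elt = "(nat, arrow) qpath \<Rightarrow> 'k"

definition poset_quiver :: "nat \<Rightarrow> nat rel \<Rightarrow> (nat, arrow) pre_digraph" where
  "poset_quiver n P =
     \<lparr>verts = {0..n},
      arcs = Alpha ` {1..n} \<union> {Vee i j |i j. (i, j) \<in> strict P},
      tail = (\<lambda>a. case a of Alpha i \<Rightarrow> i | Vee i j \<Rightarrow> j),
      head = (\<lambda>a. case a of Alpha i \<Rightarrow> 0 | Vee i j \<Rightarrow> i)\<rparr>"

definition poset_T :: "nat \<Rightarrow> nat rel \<Rightarrow> ('k::field, 'k elt) module" where
  "poset_T n P = path_algebra (poset_quiver n P)"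

definition idem :: "nat \<Rightarrow> 'k::field elt" where
  "idem i = path_elt (i, [], i)"

definition alpha :: "nat \<Rightarrow> 'k::field elt" where
  "alpha i = path_elt (i, [Alpha i], 0)"

definition vee :: "nat \<Rightarrow> nat \<Rightarrow> 'k::field elt" where
  "vee i j = path_elt (j, [Vee i j], i)"

definition path_degree :: "(nat, arrow) qpath \<Rightarrow> nat" where
  "path_degree p = length (filter is_Vee (fst (snd p)))"

definition poset_T_deg :: "nat \<Rightarrow> nat rel \<Rightarrow> nat \<Rightarrow> 'k::field elt set" where
  "poset_T_deg n P d =
     {f \<in> carrier (poset_T n P). \<forall>p. f p \<noteq> 0 \<longrightarrow> path_degree p = d}"

definition poset_A :: "nat \<Rightarrow> nat rel \<Rightarrow> ('k::field, 'k elt) module" where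
  "poset_A n P = (poset_T n P)\<lparr>carrier := poset_T_deg n P 0\<rparr>"

definition is_poset_delta :: "nat \<Rightarrow> nat rel \<Rightarrow> ('k::field elt \<Rightarrow> 'k elt) \<Rightarrow> bool" where
  "is_poset_delta n P d \<longleftrightarrow>
     (let T = poset_T n P :: ('k, 'k elt) module in
      d \<in> carrier T \<rightarrow>\<^sub>E carrier T \<and>
      (\<forall>x\<in>carrier T. \<forall>y\<in>carrier T. d (x \<oplus>\<^bsub>T\<^esub> y) = d x \<oplus>\<^bsub>T\<^esub> d y) \<and>
      (\<forall>c. \<forall>x\<in>carrier T. d (c \<odot>\<^bsub>T\<^esub> x) = c \<odot>\<^bsub>T\<^esub> d x) \<and>
      (\<forall>k. d ` poset_T_deg n P k \<subseteq> poset_T_deg n P (k + 1)) \<and>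
      (\<forall>k l. \<forall>a\<in>poset_T_deg n P k. \<forall>b\<in>poset_T_deg n P l.
         d (a \<otimes>\<^bsub>T\<^esub> b) = (d a \<otimes>\<^bsub>T\<^esub> b) \<oplus>\<^bsub>T\<^esub> ((- 1) ^ k \<odot>\<^bsub>T\<^esub> (a \<otimes>\<^bsub>T\<^esub> d b))) \<and>
      (\<forall>i\<in>{0..n}. d (idem i) = \<zero>\<^bsub>T\<^esub>) \<and>
      (\<forall>i\<in>{1..n}. d (alpha i) =
         \<ominus>\<^bsub>T\<^esub> finsum T (\<lambda>h. alpha h \<otimes>\<^bsub>T\<^esub> vee h i) {h. (h, i) \<in> strict P}) \<and>
      (\<forall>(i, j)\<in>strict P. d (vee i j) =
         finsum T (\<lambda>k. vee i k \<otimes>\<^bsub>T\<^esub> vee k j) {k. (i, k) \<in> strict P \<and> (k, j) \<in> strict P}))"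

definition poset_delta :: "nat \<Rightarrow> nat rel \<Rightarrow> 'k::field elt \<Rightarrow> 'k elt" where
  "poset_delta n P = (THE d. is_poset_delta n P d)"

text \<open>The pair \<open>(b, v)\<close> stands for \<open>\<omega>b + v\<close>.\<close>

definition poset_U :: "nat \<Rightarrow> nat rel \<Rightarrow> ('k::field elt, 'k elt \<times> 'k elt) bimodule" where
  "poset_U n P =
     (let T = poset_T n P :: ('k, 'k elt) module in
     \<lparr>carrier = poset_T_deg n P 0 \<times> poset_T_deg n P 1,
      monoid.mult = undefined, monoid.one = undefined,
      ring.zero = (\<zero>\<^bsub>T\<^esub>, \<zero>\<^bsub>T\<^esub>),
      ring.add = (\<lambda>(b, v) (b', v'). (b \<oplus>\<^bsub>T\<^esub> b', v \<oplus>\<^bsub>T\<^esub> v')),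
      Module.module.smult = (\<lambda>a (b, v). (a \<otimes>\<^bsub>T\<^esub> b, (poset_delta n P a \<otimes>\<^bsub>T\<^esub> b) \<oplus>\<^bsub>T\<^esub> (a \<otimes>\<^bsub>T\<^esub> v))),
      rsmult = (\<lambda>(b, v) a. (b \<otimes>\<^bsub>T\<^esub> a, v \<otimes>\<^bsub>T\<^esub> a))\<rparr>)"

definition poset_counit :: "'k::field elt \<times> 'k elt \<Rightarrow> 'k elt" where
  "poset_counit = fst"

abbreviation poset_UU ::
    "nat \<Rightarrow> nat rel \<Rightarrow> (('k::field elt \<times> 'k elt) \<times> ('k elt \<times> 'k elt) \<Rightarrow>\<^sub>0 int) set monoid" where
  "poset_UU n P \<equiv>
     tensor_product (poset_A n P :: ('k, 'k elt) module) (poset_U n P) (poset_U n P)"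

abbreviation poset_tensor ::
    "nat \<Rightarrow> nat rel \<Rightarrow> 'k::field elt \<times> 'k elt \<Rightarrow> 'k elt \<times> 'k elt
     \<Rightarrow> (('k elt \<times> 'k elt) \<times> ('k elt \<times> 'k elt) \<Rightarrow>\<^sub>0 int) set" where
  "poset_tensor n P \<equiv>
     pure_tensor (poset_A n P :: ('k, 'k elt) module) (poset_U n P) (poset_U n P)"

text \<open>The composite of \<open>T\<^sub>2 \<cong> V \<otimes>\<^sub>A V\<close> with the map \<open>V \<otimes>\<^sub>A V \<rightarrow> U \<otimes>\<^sub>A U\<close> induced by the inclusion of
  \<open>V\<close> in \<open>U\<close>: it sends a sum of products \<open>v t \<cdot> w t\<close> to the sum of the tensors
  \<open>v t \<otimes> w t\<close>.\<close>

definition T2_to_UU ::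
    "nat \<Rightarrow> nat rel \<Rightarrow> 'k::field elt
     \<Rightarrow> (('k elt \<times> 'k elt) \<times> ('k elt \<times> 'k elt) \<Rightarrow>\<^sub>0 int) set" where
  "T2_to_UU n P x =
     (let T = poset_T n P :: ('k, 'k elt) module in
      THE y. \<exists>(m::nat) v w.
        v \<in> {..<m} \<rightarrow> poset_T_deg n P 1 \<and> w \<in> {..<m} \<rightarrow> poset_T_deg n P 1 \<and>
        x = finsum T (\<lambda>t. v t \<otimes>\<^bsub>T\<^esub> w t) {..<m} \<and>
        y = finprod (poset_UU n P)
              (\<lambda>t. poset_tensor n P (\<zero>\<^bsub>T\<^esub>, v t) (\<zero>\<^bsub>T\<^esub>, w t)) {..<m})"

definition poset_comult ::
    "nat \<Rightarrow> nat rel \<Rightarrow> 'k::field elt \<times> 'k elt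
     \<Rightarrow> (('k elt \<times> 'k elt) \<times> ('k elt \<times> 'k elt) \<Rightarrow>\<^sub>0 int) set" where
  "poset_comult n P = (\<lambda>(b, v).
     let T = poset_T n P :: ('k, 'k elt) module; \<omega> = (\<one>\<^bsub>T\<^esub>, \<zero>\<^bsub>T\<^esub>) in
       poset_tensor n P \<omega> (b, \<zero>\<^bsub>T\<^esub>) \<otimes>\<^bsub>poset_UU n P\<^esub>
       T2_to_UU n P (poset_delta n P v) \<otimes>\<^bsub>poset_UU n P\<^esub>
       poset_tensor n P \<omega> (\<zero>\<^bsub>T\<^esub>, v) \<otimes>\<^bsub>poset_UU n P\<^esub>
       poset_tensor n P (\<zero>\<^bsub>T\<^esub>, v) \<omega>)"

definition poset_R :: "nat \<Rightarrow> nat rel \<Rightarrow> ('k::field, 'k elt \<times> 'k elt \<Rightarrow> 'k elt) module" where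
  "poset_R n P = right_burt_butler (poset_A n P) (poset_U n P) poset_counit (poset_comult n P)"

section \<open>Matrix algebras\<close>

definition diagonal_mats :: "nat \<Rightarrow> 'k::field mat set" where
  "diagonal_mats n = {M \<in> carrier_mat n n. diagonal_mat M}"

text \<open>Matrix entries are indexed from 0, so that \<open>M\<^sub>j\<^sub>i\<close> is \<open>M $$ (j - 1, i - 1)\<close>.\<close>

definition incidence_algebra :: "nat \<Rightarrow> nat rel \<Rightarrow> 'k::field mat set" where
  "incidence_algebra n P =
     {M \<in> carrier_mat n n. \<forall>i\<in>{1..n}. \<forall>j\<in>{1..n}. M $$ (j - 1, i - 1) \<noteq> 0 \<longrightarrow> (i, j) \<in> P}"

definition lower_block :: "nat \<Rightarrow> 'k::field mat set \<Rightarrow> 'k mat set" where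
  "lower_block n S =
     {four_block_mat X (0\<^sub>m n 1) Y Z |X Y Z. X \<in> S \<and> Y \<in> carrier_mat 1 n \<and> Z \<in> carrier_mat 1 1}"

definition full_mat_algebra :: "nat \<Rightarrow> ('k::field, 'k mat) module" where
  "full_mat_algebra m = module_mat TYPE('k) m m"

end

theory Submission
  imports Defs
begin

text \<open>Why the theorem holds. Sending \<open>e\<^sub>i\<close> to a diagonal matrix unit and \<open>\<alpha>\<^sub>i\<close> to a matrix unit of the
  bottom row identifies \<open>A\<close> with the block matrices whose upper left block is diagonal
  (\<open>A_isomorphic\<close>). The substance is the statement about the right Burt-Butler algebra \<open>R\<close>.

  As a left \<open>A\<close>-module, \<open>U\<close> is generated by \<open>\<omega>\<close> and the \<open>v\<^sub>i\<^sub>j\<close>, since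
  \<open>b\<omega> = \<omega>b + \<delta>(b)\<close> for \<open>b\<close> in \<open>A\<close>. It is even projective, so a left \<open>A\<close>-linear map \<open>f\<close> from \<open>U\<close> to
  \<open>A\<close> amounts to a free choice of \<open>f(\<omega>)\<close> in \<open>A\<close> and of \<open>f(v\<^sub>i\<^sub>j)\<close> in \<open>e\<^sub>iA = Ke\<^sub>i\<close>. Writing
  \<open>f(\<omega>) = \<Sum> m\<^sub>i\<^sub>i e\<^sub>i + \<Sum> m\<^sub>0\<^sub>i \<alpha>\<^sub>i\<close> and \<open>f(v\<^sub>i\<^sub>j) = m\<^sub>j\<^sub>i e\<^sub>i\<close>, these scalars are the entries of a matrix in
  the block algebra over \<open>KP\<close>, and every such matrix occurs (\<open>bb_map_bij\<close>). The product of \<open>R\<close>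
  becomes the matrix product: for \<open>i \<prec> j\<close> the comultiplication
  \<open>\<mu>(v\<^sub>i\<^sub>j) = \<Sum> v\<^sub>i\<^sub>k \<otimes> v\<^sub>k\<^sub>j + \<omega> \<otimes> v\<^sub>i\<^sub>j + v\<^sub>i\<^sub>j \<otimes> \<omega>\<close> yields
  \<open>(fg)(v\<^sub>i\<^sub>j) = \<Sum> m\<^sub>j\<^sub>k m'\<^sub>k\<^sub>i e\<^sub>i\<close> with \<open>k\<close> running over the whole interval from \<open>i\<close> to \<open>j\<close>
  (\<open>bb_map_mult\<close>). The reversed order of the factors in the definition of \<open>fg\<close> is what makes this an
  isomorphism and not an anti-isomorphism.

  Before this computation can be made, the objects of the statement have to be shown to be what they
  are meant to be. The differential exists and is unique (\<open>is_poset_delta_\<delta>\<close>,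
  \<open>poset_delta_unique\<close>). The map from \<open>T\<^sub>2\<close> to \<open>U \<otimes> U\<close> is well defined, because a tensor \<open>v \<otimes> w\<close> of
  elements of \<open>V\<close> can be recovered from the product \<open>vw\<close> (\<open>V_tensor_eq_VV\<close>, \<open>T2_to_UU_eq\<close>). The
  product of \<open>R\<close> does not depend on the presentation of \<open>\<mu>(u)\<close> by pure tensors, by the universal
  property of the tensor product (\<open>tensor_product_universal\<close>, \<open>burt_butler_mult_eq\<close>). That \<open>R\<close> is an
  algebra then follows by transport along the bijection with matrices
  (\<open>K_algebra_transport\<close>).\<close>

section \<open>Algebras over a field\<close>

lemma K_algebraI:
  fixes M :: "('k::field, 'a, 'x) module_scheme" (structure)
  assumes "abelian_group M" and "monoid M"
    and "\<And>x y z. x \<in> carrier M \<Longrightarrow> y \<in> carrier M \<Longrightarrow> z \<in> carrier M \<Longrightarrow> (x \<oplus> y) \<otimes> z = x \<otimes> z \<oplus> y \<otimes> z"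
    and "\<And>x y z. x \<in> carrier M \<Longrightarrow> y \<in> carrier M \<Longrightarrow> z \<in> carrier M \<Longrightarrow> z \<otimes> (x \<oplus> y) = z \<otimes> x \<oplus> z \<otimes> y"
    and "\<And>c x. x \<in> carrier M \<Longrightarrow> c \<odot>\<^bsub>M\<^esub> x \<in> carrier M"
    and "\<And>c d x. x \<in> carrier M \<Longrightarrow> (c + d) \<odot>\<^bsub>M\<^esub> x = c \<odot>\<^bsub>M\<^esub> x \<oplus> d \<odot>\<^bsub>M\<^esub> x"
    and "\<And>c x y. x \<in> carrier M \<Longrightarrow> y \<in> carrier M \<Longrightarrow> c \<odot>\<^bsub>M\<^esub> (x \<oplus> y) = c \<odot>\<^bsub>M\<^esub> x \<oplus> c \<odot>\<^bsub>M\<^esub> y"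
    and "\<And>c d x. x \<in> carrier M \<Longrightarrow> (c * d) \<odot>\<^bsub>M\<^esub> x = c \<odot>\<^bsub>M\<^esub> (d \<odot>\<^bsub>M\<^esub> x)"
    and "\<And>x. x \<in> carrier M \<Longrightarrow> 1 \<odot>\<^bsub>M\<^esub> x = x"
    and "\<And>c x y. x \<in> carrier M \<Longrightarrow> y \<in> carrier M \<Longrightarrow> (c \<odot>\<^bsub>M\<^esub> x) \<otimes> y = c \<odot>\<^bsub>M\<^esub> (x \<otimes> y)"
    and "\<And>c x y. x \<in> carrier M \<Longrightarrow> y \<in> carrier M \<Longrightarrow> x \<otimes> (c \<odot>\<^bsub>M\<^esub> y) = c \<odot>\<^bsub>M\<^esub> (x \<otimes> y)"
  shows "K_algebra M"
  unfolding K_algebra_def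
proof (intro conjI)
  show "ring M"
    using assms by (intro ringI) auto
  show "Module.module (class_ring :: 'k ring) M"
    using assms class_cring.is_cring by (intro moduleI) auto
qed (use assms in auto)

lemma K_algebraD:
  fixes M :: "('k::field, 'a, 'x) module_scheme" (structure)
  assumes "K_algebra M"
  shows "ring M"
    and "\<And>c x. x \<in> carrier M \<Longrightarrow> c \<odot>\<^bsub>M\<^esub> x \<in> carrier M"
    and "\<And>c d x. x \<in> carrier M \<Longrightarrow> (c + d) \<odot>\<^bsub>M\<^esub> x = c \<odot>\<^bsub>M\<^esub> x \<oplus> d \<odot>\<^bsub>M\<^esub> x"
    and "\<And>c x y. x \<in> carrier M \<Longrightarrow> y \<in> carrier M \<Longrightarrow> c \<odot>\<^bsub>M\<^esub> (x \<oplus> y) = c \<odot>\<^bsub>M\<^esub> x \<oplus> c \<odot>\<^bsub>M\<^esub> y"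
    and "\<And>c d x. x \<in> carrier M \<Longrightarrow> (c * d) \<odot>\<^bsub>M\<^esub> x = c \<odot>\<^bsub>M\<^esub> (d \<odot>\<^bsub>M\<^esub> x)"
    and "\<And>x. x \<in> carrier M \<Longrightarrow> 1 \<odot>\<^bsub>M\<^esub> x = x"
    and "\<And>c x y. x \<in> carrier M \<Longrightarrow> y \<in> carrier M \<Longrightarrow> (c \<odot>\<^bsub>M\<^esub> x) \<otimes> y = c \<odot>\<^bsub>M\<^esub> (x \<otimes> y)"
    and "\<And>c x y. x \<in> carrier M \<Longrightarrow> y \<in> carrier M \<Longrightarrow> x \<otimes> (c \<odot>\<^bsub>M\<^esub> y) = c \<odot>\<^bsub>M\<^esub> (x \<otimes> y)"
  using assms module.smult_closed[of "class_ring :: 'k ring" M] module.smult_l_distr[of "class_ring :: 'k ring" M]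
    module.smult_r_distr[of "class_ring :: 'k ring" M] module.smult_assoc1[of "class_ring :: 'k ring" M]
    module.smult_one[of "class_ring :: 'k ring" M]
  by (simp_all add: K_algebra_def)

lemma K_algebra_zero_smult:
  fixes M :: "('k::field, 'a, 'x) module_scheme" (structure)
  assumes "K_algebra M" and x: "x \<in> carrier M"
  shows "0 \<odot>\<^bsub>M\<^esub> x = \<zero>"
proof -
  interpret ring M
    using assms(1) by (rule K_algebraD)
  have "0 \<odot>\<^bsub>M\<^esub> x = 0 \<odot>\<^bsub>M\<^esub> x \<oplus> 0 \<odot>\<^bsub>M\<^esub> x"
    using K_algebraD(3)[OF assms, of 0 0] by simp
  then show ?thesis
    using K_algebraD(2)[OF assms] by (metis add.r_cancel_one')
qed

lemma K_algebra_neg: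
  fixes M :: "('k::field, 'a, 'x) module_scheme" (structure)
  assumes "K_algebra M" and x: "x \<in> carrier M"
  shows "\<ominus> x = (- 1) \<odot>\<^bsub>M\<^esub> x"
proof -
  interpret ring M
    using assms(1) by (rule K_algebraD)
  have "x \<oplus> (- 1) \<odot>\<^bsub>M\<^esub> x = \<zero>"
    using K_algebraD(3)[OF assms, of 1 "- 1"] K_algebraD(6)[OF assms]
      K_algebra_zero_smult[OF assms] by simp
  then show ?thesis
    using K_algebraD(2)[OF assms] x by (metis minus_equality a_comm)
qed

lemma K_subalgebraI:
  fixes M :: "('k::field, 'a, 'x) module_scheme" (structure)
  assumes M: "K_algebra M" and sub: "S \<subseteq> carrier M"
    and zero: "\<zero> \<in> S" and one: "\<one> \<in> S"
    and add: "\<And>x y. x \<in> S \<Longrightarrow> y \<in> S \<Longrightarrow> x \<oplus> y \<in> S"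
    and mult: "\<And>x y. x \<in> S \<Longrightarrow> y \<in> S \<Longrightarrow> x \<otimes> y \<in> S"
    and smult: "\<And>c x. x \<in> S \<Longrightarrow> c \<odot>\<^bsub>M\<^esub> x \<in> S"
  shows "K_subalgebra S M"
proof -
  interpret ring M
    using M by (rule K_algebraD)
  have inS: "x \<in> carrier M" if "x \<in> S" for x
    using that sub by auto
  have neg: "\<exists>y\<in>S. y \<oplus> x = \<zero>" if "x \<in> S" for x
    using smult[OF that, of "- 1"] K_algebra_neg[OF M inS[OF that]] inS[OF that]
    by (metis l_neg)
  have "K_algebra (M\<lparr>carrier := S\<rparr>)"
  proof (rule K_algebraI)
    show "abelian_group (M\<lparr>carrier := S\<rparr>)"
      using zero add neg by (intro abelian_groupI) (auto simp: inS a_ac)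
    show "monoid (M\<lparr>carrier := S\<rparr>)"
      using one mult by (intro monoidI) (auto simp: inS m_assoc)
  qed (use smult K_algebraD[OF M] in \<open>auto simp: inS l_distr r_distr\<close>)
  then show ?thesis
    using M sub by (simp add: K_subalgebra_def)
qed

text \<open>An algebra structure moves along any bijection that respects the operations. This gives the
  ring axioms of the Burt-Butler algebra, whose multiplication is awkward to handle directly.\<close>

lemma K_algebra_transport:
  fixes M :: "('k::field, 'a, 'x) module_scheme" and N :: "('k, 'b, 'y) module_scheme"
  assumes M: "K_algebra M" and h: "bij_betw h (carrier M) (carrier N)"
    and add: "\<And>x y. x \<in> carrier M \<Longrightarrow> y \<in> carrier M \<Longrightarrow> h (x \<oplus>\<^bsub>M\<^esub> y) = h x \<oplus>\<^bsub>N\<^esub> h y"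
    and mult: "\<And>x y. x \<in> carrier M \<Longrightarrow> y \<in> carrier M \<Longrightarrow> h (x \<otimes>\<^bsub>M\<^esub> y) = h x \<otimes>\<^bsub>N\<^esub> h y"
    and smult: "\<And>c x. x \<in> carrier M \<Longrightarrow> h (c \<odot>\<^bsub>M\<^esub> x) = c \<odot>\<^bsub>N\<^esub> h x"
    and zero: "h \<zero>\<^bsub>M\<^esub> = \<zero>\<^bsub>N\<^esub>" and one: "h \<one>\<^bsub>M\<^esub> = \<one>\<^bsub>N\<^esub>"
  shows "K_algebra_isomorphic M N"
proof -
  interpret M: ring M
    using M by (rule K_algebraD)
  have N: "carrier N = h ` carrier M"
    using h by (simp add: bij_betw_def)
  have neg: "\<exists>y\<in>carrier M. h y \<oplus>\<^bsub>N\<^esub> h x = \<zero>\<^bsub>N\<^esub>" if "x \<in> carrier M" for x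
    using that add[of "\<ominus>\<^bsub>M\<^esub> x" x] zero by (auto simp: M.l_neg intro!: bexI[of _ "\<ominus>\<^bsub>M\<^esub> x"])
  have "K_algebra N"
  proof (rule K_algebraI)
    show "abelian_group N"
    proof (rule abelian_groupI)
      fix x
      assume "x \<in> carrier N"
      then show "\<exists>y\<in>carrier N. y \<oplus>\<^bsub>N\<^esub> x = \<zero>\<^bsub>N\<^esub>"
        using neg by (auto simp: N)
    qed (auto simp: N M.a_ac simp flip: add zero)
    show "monoid N"
      by (rule monoidI) (auto simp: N M.m_assoc simp flip: mult one)
  qed (auto simp: N K_algebraD[OF M] M.l_distr M.r_distr simp flip: add mult smult)
  moreover have "h \<in> K_algebra_iso M N"
    using h add mult smult one
    by (auto simp: K_algebra_iso_def ring_iso_def Ring.ring_hom_def bij_betw_def)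
  ultimately show ?thesis
    using M by (auto simp: K_algebra_isomorphic_def)
qed

section \<open>Path algebras\<close>

lemma path_algebra_simps:
  "carrier (path_algebra Q) = {f. finite {p. f p \<noteq> 0} \<and> {p. f p \<noteq> 0} \<subseteq> qpaths Q}"
  "f \<oplus>\<^bsub>path_algebra Q\<^esub> g = (\<lambda>p. f p + g p)"
  "\<zero>\<^bsub>path_algebra Q\<^esub> = (\<lambda>p. 0)"
  "c \<odot>\<^bsub>path_algebra Q\<^esub> f = (\<lambda>p. c * f p)"
  "\<one>\<^bsub>path_algebra Q\<^esub> = (\<lambda>p. if p \<in> (\<lambda>v. (v, [], v)) ` verts Q then 1 else 0)"
  by (simp_all add: path_algebra_def)

text \<open>The ways to write a path as a product of two paths: the index set of the sum that defines products
  in the path algebra.\<close>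

definition path_splits :: "('v, 'e) pre_digraph \<Rightarrow> ('v, 'e) qpath \<Rightarrow> (('v, 'e) qpath \<times> ('v, 'e) qpath) set" where
  "path_splits Q r = {(p, q). p \<in> qpaths Q \<and> q \<in> qpaths Q \<and> composable p q \<and> qcomp p q = r}"

lemma path_algebra_mult:
  "(f \<otimes>\<^bsub>path_algebra Q\<^esub> g) r = (\<Sum>(p, q)\<in>path_splits Q r. f p * g q)"
  by (simp add: path_algebra_def path_splits_def)

text \<open>With infinitely many vertices the sum of the trivial paths would not be finitely supported, and
  the path algebra would have no unit.\<close>

locale finite_vertex_quiver = wf_digraph Q for Q :: "('v, 'e) pre_digraph" +
  assumes finite_vertices: "finite (verts Q)"
begin

text \<open>The subscript \<open>T\<close> marks the operations of the path algebra, in agreement with the name of the path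
  algebra of the quiver of a poset.\<close>

abbreviation T :: "('k::field, ('v, 'e) qpath \<Rightarrow> 'k) module" where
  "T \<equiv> path_algebra Q"
abbreviation mult_T (infixl \<open>\<otimes>\<^sub>T\<close> 70) where "f \<otimes>\<^sub>T g \<equiv> f \<otimes>\<^bsub>T\<^esub> g"
abbreviation add_T (infixl \<open>\<oplus>\<^sub>T\<close> 65) where "f \<oplus>\<^sub>T g \<equiv> f \<oplus>\<^bsub>T\<^esub> g"
abbreviation smult_T (infixl \<open>\<odot>\<^sub>T\<close> 75) where "c \<odot>\<^sub>T f \<equiv> c \<odot>\<^bsub>T\<^esub> f"
abbreviation zero_T (\<open>\<zero>\<^sub>T\<close>) where "\<zero>\<^sub>T \<equiv> \<zero>\<^bsub>T\<^esub>"
abbreviation one_T (\<open>\<one>\<^sub>T\<close>) where "\<one>\<^sub>T \<equiv> \<one>\<^bsub>T\<^esub>"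

lemma mem_qpaths: "(u, p, v) \<in> qpaths Q \<longleftrightarrow> awalk u p v"
  by (simp add: qpaths_def)

lemma qcomp_qpaths: "p \<in> qpaths Q \<Longrightarrow> q \<in> qpaths Q \<Longrightarrow> composable p q \<Longrightarrow> qcomp p q \<in> qpaths Q"
  by (cases p; cases q) (auto simp: mem_qpaths qcomp_def composable_def)

lemma finite_path_splits [simp]: "finite (path_splits Q r)"
proof -
  obtain u L v where r: "r = (u, L, v)"
    by (cases r)
  have "path_splits Q r \<subseteq> (\<lambda>(k, w). ((w, drop k L, v), (u, take k L, w))) ` ({..length L} \<times> verts Q)"
  proof
    fix x
    assume x: "x \<in> path_splits Q r"
    obtain w p v' u' q w' where x': "x = ((w, p, v'), (u', q, w'))"
      by (metis prod.collapse)
    have "w \<in> verts Q" "w' = w" "v' = v" "u' = u" "L = q @ p"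
      using x by (auto simp: x' r path_splits_def mem_qpaths composable_def qcomp_def)
    then show "x \<in> (\<lambda>(k, w). ((w, drop k L, v), (u, take k L, w))) ` ({..length L} \<times> verts Q)"
      by (auto simp: x' image_iff intro!: bexI[of _ "length q"])
  qed
  then show ?thesis
    using finite_vertices by (auto intro: finite_subset)
qed

lemma path_algebra_mult_closed:
  fixes f g :: "('v, 'e) qpath \<Rightarrow> 'k::field"
  assumes f: "f \<in> carrier T" and g: "g \<in> carrier T"
  shows "f \<otimes>\<^sub>T g \<in> carrier T"
proof -
  have *: "\<exists>p q. f p \<noteq> 0 \<and> g q \<noteq> 0 \<and> (p, q) \<in> path_splits Q r" if "(f \<otimes>\<^sub>T g) r \<noteq> 0" for r
  proof (rule ccontr)
    assume "\<not> ?thesis"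
    then have "(f \<otimes>\<^sub>T g) r = 0"
      unfolding path_algebra_mult by (intro sum.neutral) (auto simp: mult_eq_0_iff; metis)
    then show False
      using that by simp
  qed
  have "{r. (f \<otimes>\<^sub>T g) r \<noteq> 0} \<subseteq> (\<lambda>(p, q). qcomp p q) ` ({p. f p \<noteq> 0} \<times> {q. g q \<noteq> 0})"
    using * by (fastforce simp: path_splits_def image_iff)
  moreover have "{r. (f \<otimes>\<^sub>T g) r \<noteq> 0} \<subseteq> qpaths Q"
    using * by (auto simp: path_splits_def intro!: qcomp_qpaths) (metis qcomp_qpaths)
  moreover have "finite ((\<lambda>(p, q). qcomp p q) ` ({p. f p \<noteq> 0} \<times> {q. g q \<noteq> 0}))"
    using f g by (auto simp: path_algebra_simps)
  ultimately show ?thesis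
    by (auto simp: path_algebra_simps intro: finite_subset)
qed

text \<open>Both bracketings sum over the factorizations of a path into three.\<close>

lemma path_algebra_assoc:
  fixes f g h :: "('v, 'e) qpath \<Rightarrow> 'k::field"
  shows "(f \<otimes>\<^sub>T g) \<otimes>\<^sub>T h = f \<otimes>\<^sub>T (g \<otimes>\<^sub>T h)"
proof
  fix r
  have "((f \<otimes>\<^sub>T g) \<otimes>\<^sub>T h) r =
      (\<Sum>x\<in>path_splits Q r. \<Sum>y\<in>path_splits Q (fst x). f (fst y) * g (snd y) * h (snd x))"
    by (simp add: path_algebra_mult sum_distrib_right case_prod_unfold)
  also have "\<dots> = (\<Sum>(x, y)\<in>Sigma (path_splits Q r) (\<lambda>x. path_splits Q (fst x)). f (fst y) * g (snd y) * h (snd x))"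
    by (rule sum.Sigma) auto
  also have "\<dots> = (\<Sum>(x, y)\<in>Sigma (path_splits Q r) (\<lambda>x. path_splits Q (snd x)). f (fst x) * g (fst y) * h (snd y))"
    by (rule sum.reindex_bij_witness[where
          j = "\<lambda>(x, y). ((fst y, qcomp (snd y) (snd x)), (snd y, snd x))" and
          i = "\<lambda>(x, y). ((qcomp (fst x) (fst y), snd y), (fst x, fst y))"])
      (auto simp: path_splits_def composable_def qcomp_def mem_qpaths intro: awalk_appendI)
  also have "\<dots> = (\<Sum>x\<in>path_splits Q r. \<Sum>y\<in>path_splits Q (snd x). f (fst x) * g (fst y) * h (snd y))"
    by (rule sum.Sigma[symmetric]) auto
  also have "\<dots> = (f \<otimes>\<^sub>T (g \<otimes>\<^sub>T h)) r"
    by (simp add: path_algebra_mult sum_distrib_left case_prod_unfold mult.assoc)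
  finally show "((f \<otimes>\<^sub>T g) \<otimes>\<^sub>T h) r = (f \<otimes>\<^sub>T (g \<otimes>\<^sub>T h)) r" .
qed

lemma path_algebra_one_mult:
  fixes f :: "('v, 'e) qpath \<Rightarrow> 'k::field"
  assumes "f \<in> carrier T"
  shows "\<one>\<^sub>T \<otimes>\<^sub>T f = f" and "f \<otimes>\<^sub>T \<one>\<^sub>T = f"
proof -
  have 0: "f r = 0" "path_splits Q r = {}" if "r \<notin> qpaths Q" for r
    using that assms qcomp_qpaths by (fastforce simp: path_algebra_simps path_splits_def)+
  show "\<one>\<^sub>T \<otimes>\<^sub>T f = f"
  proof
    fix r :: "('v, 'e) qpath"
    obtain u L v where r: "r = (u, L, v)"
      by (cases r)
    show "(\<one>\<^sub>T \<otimes>\<^sub>T f) r = f r"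
    proof (cases "r \<in> qpaths Q")
      case True
      have "(\<one>\<^sub>T \<otimes>\<^sub>T f) r = (\<Sum>x\<in>{((v, [], v), r)}. \<one>\<^sub>T (fst x) * f (snd x))"
        unfolding path_algebra_mult case_prod_unfold
        by (rule sum.mono_neutral_right[OF finite_path_splits])
          (use True in \<open>auto simp: path_splits_def path_algebra_simps r composable_def qcomp_def
             mem_qpaths awalk_Nil_iff\<close>)
      then show ?thesis
        using True by (auto simp: path_algebra_simps r mem_qpaths)
    qed (simp add: 0 path_algebra_mult)
  qed
  show "f \<otimes>\<^sub>T \<one>\<^sub>T = f"
  proof
    fix r :: "('v, 'e) qpath"
    obtain u L v where r: "r = (u, L, v)"
      by (cases r)
    show "(f \<otimes>\<^sub>T \<one>\<^sub>T) r = f r"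
    proof (cases "r \<in> qpaths Q")
      case True
      have "(f \<otimes>\<^sub>T \<one>\<^sub>T) r = (\<Sum>x\<in>{(r, (u, [], u))}. f (fst x) * \<one>\<^sub>T (snd x))"
        unfolding path_algebra_mult case_prod_unfold
        by (rule sum.mono_neutral_right[OF finite_path_splits])
          (use True in \<open>auto simp: path_splits_def path_algebra_simps r composable_def qcomp_def
             mem_qpaths awalk_Nil_iff\<close>)
      then show ?thesis
        using True by (auto simp: path_algebra_simps r mem_qpaths)
    qed (simp add: 0 path_algebra_mult)
  qed
qed

lemma K_algebra_path_algebra: "K_algebra (T :: ('k::field, ('v, 'e) qpath \<Rightarrow> 'k) module)"
proof (rule K_algebraI)
  have supp_add: "{p. f p + g p \<noteq> 0} \<subseteq> {p. f p \<noteq> 0} \<union> {p. g p \<noteq> 0}"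
    for f g :: "('v, 'e) qpath \<Rightarrow> 'k"
    by auto
  have add: "f \<oplus>\<^sub>T g \<in> carrier T" if "f \<in> carrier T" "g \<in> carrier T"
    for f g :: "('v, 'e) qpath \<Rightarrow> 'k"
    using that finite_subset[OF supp_add] supp_add[of f g] by (auto simp: path_algebra_simps)
  show "abelian_group (T :: ('k::field, ('v, 'e) qpath \<Rightarrow> 'k) module)"
  proof (rule abelian_groupI)
    fix f :: "('v, 'e) qpath \<Rightarrow> 'k"
    assume "f \<in> carrier T"
    then show "\<exists>g\<in>carrier T. g \<oplus>\<^sub>T f = \<zero>\<^sub>T"
      by (auto simp: path_algebra_simps intro!: exI[of _ "\<lambda>p. - f p"])
  next
    fix f g :: "('v, 'e) qpath \<Rightarrow> 'k"
    assume "f \<in> carrier T" "g \<in> carrier T"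
    then show "f \<oplus>\<^sub>T g \<in> carrier T"
      by (rule add)
  qed (auto simp: path_algebra_simps algebra_simps)
  show "monoid (T :: ('k::field, ('v, 'e) qpath \<Rightarrow> 'k) module)"
  proof (rule monoidI)
    have "finite ((\<lambda>v. (v, [], v)) ` verts Q)" "(\<lambda>v. (v, [], v)) ` verts Q \<subseteq> qpaths Q"
      using finite_vertices by (auto simp: mem_qpaths awalk_Nil_iff)
    then show "\<one>\<^sub>T \<in> carrier (T :: ('k::field, ('v, 'e) qpath \<Rightarrow> 'k) module)"
      by (auto simp: path_algebra_simps intro: finite_subset)
  qed (auto simp: path_algebra_mult_closed path_algebra_assoc path_algebra_one_mult)
qed (auto simp: path_algebra_mult path_algebra_simps fun_eq_iff algebra_simps sum.distrib
    sum_distrib_left case_prod_unfold intro: finite_subset[rotated])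

text \<open>Products are evaluated by splitting off the arrows of a path one at a time, starting with the
  arrow traversed first.\<close>

lemma path_algebra_mult_Nil:
  assumes "(u, [], v) \<in> qpaths Q"
  shows "(f \<otimes>\<^sub>T g) (u, [], v) = f (u, [], v) * g (u, [], v)"
proof -
  have "path_splits Q (u, [], v) = {((u, [], v), (u, [], v))}"
    using assms by (auto simp: path_splits_def mem_qpaths awalk_Nil_iff composable_def qcomp_def)
  then show ?thesis
    by (simp add: path_algebra_mult)
qed

lemma path_algebra_mult_Cons:
  assumes r: "(u, a # L, v) \<in> qpaths Q"
  shows "(f \<otimes>\<^sub>T g) (u, a # L, v) = f (u, a # L, v) * g (u, [], u) +
    (f \<otimes>\<^sub>T (\<lambda>q. g (u, a # fst (snd q), snd (snd q)))) (head Q a, L, v)"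
proof -
  let ?c = "\<lambda>x. (fst x, (u, a # fst (snd (snd x)), snd (snd (snd x))))"
  have eq: "path_splits Q (u, a # L, v) =
      insert ((u, a # L, v), (u, [], u)) (?c ` path_splits Q (head Q a, L, v))" (is "?l = ?r")
  proof (rule equalityI; rule subsetI)
    fix x
    assume "x \<in> ?l"
    moreover obtain w p v' u' q w' where "x = ((w, p, v'), (u', q, w'))"
      by (metis prod.collapse)
    ultimately show "x \<in> ?r"
      by (cases q) (auto simp: path_splits_def mem_qpaths awalk_Nil_iff awalk_Cons_iff composable_def
          qcomp_def image_iff)
  next
    fix x
    assume "x \<in> ?r"
    then show "x \<in> ?l"
      using r by (auto simp: path_splits_def mem_qpaths awalk_Nil_iff awalk_Cons_iff composable_def
          qcomp_def)
  qed
  have inj: "inj_on ?c (path_splits Q (head Q a, L, v))"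
    by (rule inj_onI) (auto simp: path_splits_def qcomp_def)
  have notin: "((u, a # L, v), (u, [], u)) \<notin> ?c ` path_splits Q (head Q a, L, v)"
    by auto
  show ?thesis
    unfolding path_algebra_mult eq
    by (subst sum.insert) (use notin in \<open>auto simp: sum.reindex[OF inj] case_prod_unfold o_def\<close>)
qed

lemma path_elt_mult:
  assumes "p \<in> qpaths Q" and "q \<in> qpaths Q"
  shows "path_elt p \<otimes>\<^sub>T path_elt q =
    (if composable p q then path_elt (qcomp p q) else \<zero>\<^sub>T :: ('v, 'e) qpath \<Rightarrow> 'k::field)"
proof
  fix r
  have "(path_elt p \<otimes>\<^sub>T path_elt q) r =
      (\<Sum>x\<in>path_splits Q r. if x = (p, q) then 1 else 0 :: 'k)"
    unfolding path_algebra_mult by (rule sum.cong) (auto simp: path_elt_def split: if_splits)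
  also have "\<dots> = (if (p, q) \<in> path_splits Q r then 1 else 0)"
    by (simp add: sum.delta)
  finally show "(path_elt p \<otimes>\<^sub>T path_elt q) r =
      (if composable p q then path_elt (qcomp p q) else \<zero>\<^sub>T :: ('v, 'e) qpath \<Rightarrow> 'k) r"
    using assms by (auto simp: path_splits_def path_elt_def path_algebra_simps)
qed

text \<open>Linear extension: a property of all multiples of the paths in the support of \<open>f\<close> that is closed
  under sums holds for \<open>f\<close>. Restricting to the support keeps track of the degree of \<open>f\<close>.\<close>

lemma path_algebra_induct [consumes 1, case_names zero path add]:
  fixes f :: "('v, 'e) qpath \<Rightarrow> 'k::field"
  assumes f: "f \<in> carrier T"
    and zero: "Z \<zero>\<^sub>T"
    and path: "\<And>c p. p \<in> qpaths Q \<Longrightarrow> f p \<noteq> 0 \<Longrightarrow> Z (c \<odot>\<^sub>T path_elt p)"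
    and add: "\<And>g h. g \<in> carrier T \<Longrightarrow> h \<in> carrier T \<Longrightarrow> Z g \<Longrightarrow> Z h \<Longrightarrow> Z (g \<oplus>\<^sub>T h)"
  shows "Z f"
proof -
  have sub: "(\<lambda>p. if p \<in> S then f p else 0) \<in> carrier T \<and> Z (\<lambda>p. if p \<in> S then f p else 0)"
    if "finite S" "S \<subseteq> {p. f p \<noteq> 0}" for S
    using that
  proof (induction rule: finite_induct)
    case empty
    then show ?case
      using zero by (simp add: path_algebra_simps)
  next
    case (insert q S)
    let ?g = "\<lambda>p. if p \<in> S then f p else 0"
    have q: "q \<in> qpaths Q" "f q \<noteq> 0"
      using insert.prems f by (auto simp: path_algebra_simps)
    have eq: "(\<lambda>p. if p \<in> insert q S then f p else 0) = f q \<odot>\<^sub>T path_elt q \<oplus>\<^sub>T ?g"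
      using insert.hyps by (auto simp: path_algebra_simps path_elt_def)
    have c: "f q \<odot>\<^sub>T path_elt q \<in> carrier T"
      using q by (auto simp: path_algebra_simps path_elt_def intro: finite_subset[of _ "{q}"])
    interpret ring "T :: ('k, ('v, 'e) qpath \<Rightarrow> 'k) module"
      using K_algebra_path_algebra by (rule K_algebraD)
    show ?case
      using insert q c add[OF c _ path[OF q]] unfolding eq by auto
  qed
  then have "Z (\<lambda>p. if p \<in> {p. f p \<noteq> 0} then f p else 0)"
    using f[unfolded path_algebra_simps] by (elim CollectE conjE) (rule sub[THEN conjunct2], auto)
  moreover have "(\<lambda>p. if p \<in> {p. f p \<noteq> 0} then f p else 0) = f"
    by auto
  ultimately show ?thesis
    by simp
qed

end

section \<open>Tensor products over an algebra\<close>

locale tensor_factors =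
  fixes A :: "('k, 'a, 'x) module_scheme"
    and M :: "('a, 'm, 'y) bimodule_scheme" and N :: "('a, 'n, 'z) bimodule_scheme"
  assumes add_closed_left: "\<And>x x'. x \<in> carrier M \<Longrightarrow> x' \<in> carrier M \<Longrightarrow> x \<oplus>\<^bsub>M\<^esub> x' \<in> carrier M"
    and add_closed_right: "\<And>y y'. y \<in> carrier N \<Longrightarrow> y' \<in> carrier N \<Longrightarrow> y \<oplus>\<^bsub>N\<^esub> y' \<in> carrier N"
    and act_closed_left: "\<And>x a. x \<in> carrier M \<Longrightarrow> a \<in> carrier A \<Longrightarrow> x \<odot>\<^sub>r\<^bsub>M\<^esub> a \<in> carrier M"
    and act_closed_right: "\<And>a y. a \<in> carrier A \<Longrightarrow> y \<in> carrier N \<Longrightarrow> a \<odot>\<^bsub>N\<^esub> y \<in> carrier N"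
begin

abbreviation "F \<equiv> free_Abelian_group (carrier M \<times> carrier N)"
abbreviation "Ker \<equiv> tensor_kernel A M N"
abbreviation "TP \<equiv> tensor_product A M N"
abbreviation "pure \<equiv> pure_tensor A M N"

lemma relations_carrier: "tensor_relations A M N \<subseteq> carrier F"
  unfolding tensor_relations_def
  by (auto simp: add_closed_left add_closed_right act_closed_left act_closed_right
      dest!: keys_diff[THEN subsetD])

lemma kernel_subgroup: "subgroup Ker F"
  unfolding tensor_kernel_def
  by (rule group.generate_is_subgroup[OF group_free_Abelian_group relations_carrier])

lemma kernel_normal: "Ker \<lhd> F"
  using comm_group.normal_iff_subgroup[OF abelian_free_Abelian_group] kernel_subgroup by blast

lemma comm_group_tensor_product: "comm_group TP"
  unfolding tensor_product_def
  by (rule comm_group.abelian_FactGroup[OF abelian_free_Abelian_group kernel_subgroup])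

sublocale TP: comm_group TP
  by (rule comm_group_tensor_product)

lemma pure_closed [simp, intro]:
  assumes "x \<in> carrier M" and "y \<in> carrier N"
  shows "pure x y \<in> carrier TP"
  using assms by (auto simp: pure_tensor_def tensor_product_def carrier_FactGroup)

lemma coset_mult:
  assumes "a \<in> carrier F" and "b \<in> carrier F"
  shows "(Ker #>\<^bsub>F\<^esub> a) \<otimes>\<^bsub>TP\<^esub> (Ker #>\<^bsub>F\<^esub> b) = Ker #>\<^bsub>F\<^esub> (a + b)"
  using normal.rcos_sum[OF kernel_normal assms] by (simp add: tensor_product_def)

lemma coset_eqI:
  assumes "a - b \<in> tensor_relations A M N" and "a \<in> carrier F" and "b \<in> carrier F"
  shows "Ker #>\<^bsub>F\<^esub> a = Ker #>\<^bsub>F\<^esub> b"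
proof -
  have "a - b \<in> Ker"
    using assms(1) unfolding tensor_kernel_def by (rule generate.incl)
  then have "a \<in> Ker #>\<^bsub>F\<^esub> b"
    by (auto simp: r_coset_def intro!: bexI[of _ "a - b"])
  then show ?thesis
    using group.repr_independence[OF group_free_Abelian_group _ assms(3) kernel_subgroup] by blast
qed

lemma pure_add_left:
  assumes "x \<in> carrier M" and "x' \<in> carrier M" and "y \<in> carrier N"
  shows "pure (x \<oplus>\<^bsub>M\<^esub> x') y = pure x y \<otimes>\<^bsub>TP\<^esub> pure x' y"
proof -
  have c: "frag_of (x, y) \<in> carrier F" "frag_of (x', y) \<in> carrier F" "frag_of (x \<oplus>\<^bsub>M\<^esub> x', y) \<in> carrier F"
    using assms by (auto simp: add_closed_left)
  then have "frag_of (x, y) + frag_of (x', y) \<in> carrier F"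
    using group.is_monoid[OF group_free_Abelian_group] monoid.m_closed mult_free_Abelian_group by metis
  moreover have "frag_of (x \<oplus>\<^bsub>M\<^esub> x', y) - (frag_of (x, y) + frag_of (x', y)) \<in> tensor_relations A M N"
    using assms unfolding tensor_relations_def by (intro UnI1) (auto simp: diff_diff_add)
  ultimately show ?thesis
    unfolding pure_tensor_def coset_mult[OF c(1,2)] using c(3) by (intro coset_eqI)
qed

lemma pure_add_right:
  assumes "x \<in> carrier M" and "y \<in> carrier N" and "y' \<in> carrier N"
  shows "pure x (y \<oplus>\<^bsub>N\<^esub> y') = pure x y \<otimes>\<^bsub>TP\<^esub> pure x y'"
proof -
  have c: "frag_of (x, y) \<in> carrier F" "frag_of (x, y') \<in> carrier F" "frag_of (x, y \<oplus>\<^bsub>N\<^esub> y') \<in> carrier F"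
    using assms by (auto simp: add_closed_right)
  then have "frag_of (x, y) + frag_of (x, y') \<in> carrier F"
    using group.is_monoid[OF group_free_Abelian_group] monoid.m_closed mult_free_Abelian_group by metis
  moreover have "frag_of (x, y \<oplus>\<^bsub>N\<^esub> y') - (frag_of (x, y) + frag_of (x, y')) \<in> tensor_relations A M N"
    using assms unfolding tensor_relations_def by (intro UnI1 UnI2) (auto simp: diff_diff_add)
  ultimately show ?thesis
    unfolding pure_tensor_def coset_mult[OF c(1,2)] using c(3) by (intro coset_eqI)
qed

lemma pure_balanced:
  assumes "x \<in> carrier M" and "a \<in> carrier A" and "y \<in> carrier N"
  shows "pure (x \<odot>\<^sub>r\<^bsub>M\<^esub> a) y = pure x (a \<odot>\<^bsub>N\<^esub> y)"
proof -
  have "frag_of (x \<odot>\<^sub>r\<^bsub>M\<^esub> a, y) - frag_of (x, a \<odot>\<^bsub>N\<^esub> y) \<in> tensor_relations A M N"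
    using assms unfolding tensor_relations_def by (intro UnI2) auto
  then show ?thesis
    unfolding pure_tensor_def
    using assms by (intro coset_eqI) (auto simp: act_closed_left act_closed_right)
qed

text \<open>A zero vector is recognized by \<open>x + x = x\<close>, which makes its tensors idempotent in a group.\<close>

lemma pure_idem_left:
  assumes "x \<in> carrier M" and "y \<in> carrier N" and "x \<oplus>\<^bsub>M\<^esub> x = x"
  shows "pure x y = \<one>\<^bsub>TP\<^esub>"
  using pure_add_left[of x x y] assms by (metis TP.l_cancel_one' pure_closed)

lemma pure_idem_right:
  assumes "x \<in> carrier M" and "y \<in> carrier N" and "y \<oplus>\<^bsub>N\<^esub> y = y"
  shows "pure x y = \<one>\<^bsub>TP\<^esub>"
  using pure_add_right[of x y y] assms by (metis TP.l_cancel_one' pure_closed)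

text \<open>The map on pairs extends to the free abelian group; biadditivity and balancing say that this
  extension kills the generating relations, hence the subgroup that they generate.\<close>

theorem tensor_product_universal:
  assumes "comm_group G"
    and \<beta>: "\<And>x y. x \<in> carrier M \<Longrightarrow> y \<in> carrier N \<Longrightarrow> \<beta> x y \<in> carrier G"
    and left: "\<And>x x' y. x \<in> carrier M \<Longrightarrow> x' \<in> carrier M \<Longrightarrow> y \<in> carrier N \<Longrightarrow>
      \<beta> (x \<oplus>\<^bsub>M\<^esub> x') y = \<beta> x y \<otimes>\<^bsub>G\<^esub> \<beta> x' y"
    and right: "\<And>x y y'. x \<in> carrier M \<Longrightarrow> y \<in> carrier N \<Longrightarrow> y' \<in> carrier N \<Longrightarrow>
      \<beta> x (y \<oplus>\<^bsub>N\<^esub> y') = \<beta> x y \<otimes>\<^bsub>G\<^esub> \<beta> x y'"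
    and balanced: "\<And>x a y. x \<in> carrier M \<Longrightarrow> a \<in> carrier A \<Longrightarrow> y \<in> carrier N \<Longrightarrow>
      \<beta> (x \<odot>\<^sub>r\<^bsub>M\<^esub> a) y = \<beta> x (a \<odot>\<^bsub>N\<^esub> y)"
  obtains h where "h \<in> hom TP G" and "\<And>x y. x \<in> carrier M \<Longrightarrow> y \<in> carrier N \<Longrightarrow> h (pure x y) = \<beta> x y"
proof -
  interpret G: comm_group G by fact
  interpret F: comm_group F by (rule abelian_free_Abelian_group)
  have "(\<lambda>(x, y). \<beta> x y) ` (carrier M \<times> carrier N) \<subseteq> carrier G"
    using \<beta> by auto
  then obtain k where k: "k \<in> hom F G" and k_of: "\<And>x. x \<in> carrier M \<times> carrier N \<Longrightarrow> k (frag_of x) = (case x of (x, y) \<Rightarrow> \<beta> x y)"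
    using G.free_Abelian_group_universal by blast
  interpret k: group_hom F G k
    using k by unfold_locales
  have k_diff: "k (a - b) = k a \<otimes>\<^bsub>G\<^esub> inv\<^bsub>G\<^esub> k b" if "a \<in> carrier F" "b \<in> carrier F" for a b
  proof -
    have "k (a \<otimes>\<^bsub>F\<^esub> inv\<^bsub>F\<^esub> b) = k a \<otimes>\<^bsub>G\<^esub> inv\<^bsub>G\<^esub> k b"
      using that by (simp only: k.hom_mult k.hom_inv F.inv_closed)
    moreover have "a \<otimes>\<^bsub>F\<^esub> inv\<^bsub>F\<^esub> b = a - b"
      using that inv_free_Abelian_group[of b] by simp
    ultimately show ?thesis
      by simp
  qed
  \<comment> \<open>Each of the three kinds of relations is one of the assumptions on \<open>\<beta>\<close>.\<close>
  have "tensor_relations A M N \<subseteq> kernel F G k"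
  proof
    fix z
    assume "z \<in> tensor_relations A M N"
    then consider
        (1) x x' y where "z = frag_of (x \<oplus>\<^bsub>M\<^esub> x', y) - frag_of (x, y) - frag_of (x', y)"
          "x \<in> carrier M" "x' \<in> carrier M" "y \<in> carrier N"
      | (2) x y y' where "z = frag_of (x, y \<oplus>\<^bsub>N\<^esub> y') - frag_of (x, y) - frag_of (x, y')"
          "x \<in> carrier M" "y \<in> carrier N" "y' \<in> carrier N"
      | (3) x a y where "z = frag_of (x \<odot>\<^sub>r\<^bsub>M\<^esub> a, y) - frag_of (x, a \<odot>\<^bsub>N\<^esub> y)"
          "x \<in> carrier M" "a \<in> carrier A" "y \<in> carrier N"
      unfolding tensor_relations_def by auto
    then have "z \<in> carrier F \<and> k z = \<one>\<^bsub>G\<^esub>"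
    proof cases
      case 1
      have "z \<in> carrier F"
        using relations_carrier \<open>z \<in> tensor_relations A M N\<close> by blast
      moreover have "frag_of (x \<oplus>\<^bsub>M\<^esub> x', y) - frag_of (x, y) \<in> carrier F"
        using 1 by (auto simp: add_closed_left dest!: keys_diff[THEN subsetD])
      ultimately show ?thesis
        using 1 by (simp add: k_diff k_of add_closed_left left \<beta> G.inv_mult G.m_ac
            del: carrier_free_Abelian_group_iff)
    next
      case 2
      have "z \<in> carrier F"
        using relations_carrier \<open>z \<in> tensor_relations A M N\<close> by blast
      moreover have "frag_of (x, y \<oplus>\<^bsub>N\<^esub> y') - frag_of (x, y) \<in> carrier F"
        using 2 by (auto simp: add_closed_right dest!: keys_diff[THEN subsetD])
      ultimately show ?thesis
        using 2 by (simp add: k_diff k_of add_closed_right right \<beta> G.inv_mult G.m_ac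
            del: carrier_free_Abelian_group_iff)
    next
      case 3
      have "z \<in> carrier F"
        using relations_carrier \<open>z \<in> tensor_relations A M N\<close> by blast
      then show ?thesis
        using 3 by (simp add: k_diff k_of act_closed_left act_closed_right balanced \<beta>
            del: carrier_free_Abelian_group_iff)
    qed
    then show "z \<in> kernel F G k"
      by (simp add: kernel_def)
  qed
  then have Ker: "Ker \<subseteq> kernel F G k"
    unfolding tensor_kernel_def by (rule F.generate_subgroup_incl) (rule k.subgroup_kernel)
  have coset: "k a = k b" if "a \<in> carrier F" "b \<in> carrier F" "Ker #>\<^bsub>F\<^esub> a = Ker #>\<^bsub>F\<^esub> b" for a b
  proof -
    have "a \<in> Ker #>\<^bsub>F\<^esub> b"
      using that F.rcos_self[OF that(1) kernel_subgroup] by simp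
    then obtain c where "c \<in> Ker" "a = c \<otimes>\<^bsub>F\<^esub> b"
      by (auto simp: r_coset_def)
    then show ?thesis
      using Ker that(2) k.hom_mult[of c b] by (auto simp: kernel_def)
  qed
  obtain g where g: "g \<in> hom (F Mod Ker) G" and g_of: "\<And>x. x \<in> carrier F \<Longrightarrow> g (Ker #>\<^bsub>F\<^esub> x) = k x"
    using FactGroup_universal[OF k kernel_normal coset] by blast
  show thesis
  proof (rule that)
    show "g \<in> hom TP G"
      using g by (simp add: tensor_product_def)
    show "g (pure x y) = \<beta> x y" if "x \<in> carrier M" "y \<in> carrier N" for x y
      using that by (simp add: pure_tensor_def g_of k_of)
  qed
qed

text \<open>The product of the Burt-Butler algebra is described through presentations of a tensor as a
  finite sum of pure tensors, indexed by an initial segment of the natural numbers. The tensors with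
  such a presentation are closed under adding pure tensors, which covers all comultiplications below.\<close>

definition pure_sums :: "('m \<times> 'n \<Rightarrow>\<^sub>0 int) set set" where
  "pure_sums = {z. \<exists>(m::nat) u1 u2. u1 \<in> {..<m} \<rightarrow> carrier M \<and> u2 \<in> {..<m} \<rightarrow> carrier N \<and>
     z = finprod TP (\<lambda>t. pure (u1 t) (u2 t)) {..<m}}"

lemma pure_sums_carrier: "z \<in> pure_sums \<Longrightarrow> z \<in> carrier TP"
  by (auto simp: pure_sums_def intro!: TP.finprod_closed)

lemma pure_sums_one [simp, intro]: "\<one>\<^bsub>TP\<^esub> \<in> pure_sums"
  unfolding pure_sums_def by (auto intro!: exI[of _ 0])

lemma pure_sums_mult_pure:
  assumes "z \<in> pure_sums" and x: "x \<in> carrier M" and y: "y \<in> carrier N"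
  shows "z \<otimes>\<^bsub>TP\<^esub> pure x y \<in> pure_sums"
proof -
  obtain m :: nat and u1 u2 where u: "u1 \<in> {..<m} \<rightarrow> carrier M" "u2 \<in> {..<m} \<rightarrow> carrier N"
    and z: "z = finprod TP (\<lambda>t. pure (u1 t) (u2 t)) {..<m}"
    using assms(1) unfolding pure_sums_def by blast
  have "finprod TP (\<lambda>t. pure ((u1(m := x)) t) ((u2(m := y)) t)) {..<Suc m} =
      pure x y \<otimes>\<^bsub>TP\<^esub> finprod TP (\<lambda>t. pure ((u1(m := x)) t) ((u2(m := y)) t)) {..<m}"
    unfolding lessThan_Suc using u x y by (subst TP.finprod_insert) (auto simp: Pi_iff)
  also have "finprod TP (\<lambda>t. pure ((u1(m := x)) t) ((u2(m := y)) t)) {..<m} = z"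
    unfolding z using u by (intro TP.finprod_cong') (auto simp: Pi_iff)
  finally have "z \<otimes>\<^bsub>TP\<^esub> pure x y = finprod TP (\<lambda>t. pure ((u1(m := x)) t) ((u2(m := y)) t)) {..<Suc m}"
    using pure_sums_carrier[OF assms(1)] x y by (simp add: TP.m_comm)
  then show ?thesis
    unfolding pure_sums_def using u x y
    by (intro CollectI exI[of _ "Suc m"] exI[of _ "u1(m := x)"] exI[of _ "u2(m := y)"])
      (auto simp: Pi_iff less_Suc_eq)
qed

lemma pure_sums_mult_finprod:
  assumes "finite S" and "z \<in> pure_sums" and "\<And>s. s \<in> S \<Longrightarrow> u1 s \<in> carrier M" and "\<And>s. s \<in> S \<Longrightarrow> u2 s \<in> carrier N"
  shows "z \<otimes>\<^bsub>TP\<^esub> finprod TP (\<lambda>s. pure (u1 s) (u2 s)) S \<in> pure_sums"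
  using assms
proof (induction S rule: finite_induct)
  case empty
  then show ?case
    by (simp add: pure_sums_carrier)
next
  case (insert s S)
  then have "z \<otimes>\<^bsub>TP\<^esub> finprod TP (\<lambda>s. pure (u1 s) (u2 s)) (insert s S) =
      (z \<otimes>\<^bsub>TP\<^esub> finprod TP (\<lambda>s. pure (u1 s) (u2 s)) S) \<otimes>\<^bsub>TP\<^esub> pure (u1 s) (u2 s)"
    by (subst TP.finprod_insert) (auto simp: Pi_iff TP.m_ac pure_sums_carrier)
  then show ?case
    using insert by (simp add: pure_sums_mult_pure)
qed

end

lemma hom_finprod_finsum:
  fixes A (structure)
  assumes "comm_group G" and "abelian_group A" and h: "h \<in> hom G (add_monoid A)"
    and "finite S" and "f \<in> S \<rightarrow> carrier G"
  shows "h (finprod G f S) = (\<Oplus>s\<in>S. h (f s))"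
  using assms(4,5)
proof (induction S rule: finite_induct)
  case empty
  interpret G: comm_group G by fact
  interpret A: abelian_group A by fact
  have "h \<one>\<^bsub>G\<^esub> = \<zero>"
    using hom_one[OF h] A.a_group G.is_group by auto
  then show ?case
    by simp
next
  case (insert s S)
  interpret G: comm_group G by fact
  interpret A: abelian_group A by fact
  have "h y \<in> carrier A" if "y \<in> carrier G" for y
    using hom_in_carrier[OF h that] by simp
  moreover have "h (x \<otimes>\<^bsub>G\<^esub> y) = h x \<oplus> h y" if "x \<in> carrier G" "y \<in> carrier G" for x y
    using hom_mult[OF h that] by simp
  ultimately show ?case
    using insert by (simp add: Pi_iff)
qed

section \<open>The product of the Burt-Butler algebra\<close>

text \<open>A homomorphism \<open>h\<close> that sends \<open>x \<otimes> y\<close> to \<open>g (x f(y))\<close> takes the same value on every presentation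
  of \<open>\<mu> u\<close> by pure tensors, so this value is the one that the definition describes.\<close>

lemma burt_butler_mult_eq:
  fixes A (structure) and U :: "('a, 'u, 'y) bimodule_scheme"
  assumes "tensor_factors A U U" and "abelian_group A"
    and h: "h \<in> hom (tensor_product A U U) (add_monoid A)"
    and h_pure: "\<And>x y. x \<in> carrier U \<Longrightarrow> y \<in> carrier U \<Longrightarrow> h (pure_tensor A U U x y) = g (x \<odot>\<^sub>r\<^bsub>U\<^esub> f y)"
    and u: "u \<in> carrier U" and \<mu>: "\<mu> u \<in> tensor_factors.pure_sums A U U"
  shows "burt_butler_mult A U \<mu> f g u = h (\<mu> u)"
proof -
  interpret tensor_factors A U U by fact
  have val: "finsum A (\<lambda>t. g (u1 t \<odot>\<^sub>r\<^bsub>U\<^esub> f (u2 t))) {..<m} = h (finprod TP (\<lambda>t. pure (u1 t) (u2 t)) {..<m})"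
    if "u1 \<in> {..<m} \<rightarrow> carrier U" "u2 \<in> {..<m} \<rightarrow> carrier U" for m :: nat and u1 u2
  proof -
    interpret A: abelian_group A by fact
    have "h (finprod TP (\<lambda>t. pure (u1 t) (u2 t)) {..<m}) = (\<Oplus>t\<in>{..<m}. h (pure (u1 t) (u2 t)))"
      using that by (intro hom_finprod_finsum[OF TP.comm_group_axioms assms(2) h]) auto
    also have "\<dots> = (\<Oplus>t\<in>{..<m}. g (u1 t \<odot>\<^sub>r\<^bsub>U\<^esub> f (u2 t)))"
      using that hom_in_carrier[OF h] by (intro A.finsum_cong') (auto simp: Pi_iff h_pure[symmetric])
    finally show ?thesis ..
  qed
  obtain m :: nat and u1 u2 where r: "u1 \<in> {..<m} \<rightarrow> carrier U" "u2 \<in> {..<m} \<rightarrow> carrier U"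
      "\<mu> u = finprod TP (\<lambda>t. pure (u1 t) (u2 t)) {..<m}"
    using \<mu> unfolding pure_sums_def by blast
  have "(THE a. \<exists>(m::nat) u1 u2. u1 \<in> {..<m} \<rightarrow> carrier U \<and> u2 \<in> {..<m} \<rightarrow> carrier U \<and>
       \<mu> u = finprod TP (\<lambda>t. pure (u1 t) (u2 t)) {..<m} \<and>
       a = finsum A (\<lambda>t. g (u1 t \<odot>\<^sub>r\<^bsub>U\<^esub> f (u2 t))) {..<m}) = h (\<mu> u)"
  proof (rule the_equality, goal_cases)
    case 1
    show ?case
      using r val[OF r(1,2)] by (intro exI[of _ m] exI[of _ u1] exI[of _ u2]) simp
  next
    case (2 a)
    then show ?case
      using val by auto
  qed
  then show ?thesis
    using u by (simp add: burt_butler_mult_def)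
qed

section \<open>Block triangular matrix algebras\<close>

lemma K_algebra_full_mat: "K_algebra (full_mat_algebra m :: ('k::field, 'k mat) module)"
proof (rule K_algebraI)
  show "abelian_group (full_mat_algebra m :: ('k, 'k mat) module)"
    unfolding full_mat_algebra_def by (rule abelian_group_mat)
  show "monoid (full_mat_algebra m :: ('k, 'k mat) module)"
    by (rule monoidI) (auto simp: full_mat_algebra_def module_mat_simps)
qed (auto simp: full_mat_algebra_def module_mat_simps add_smult_distrib_right_mat add_smult_distrib_left_mat
    add_mult_distrib_mat mult_add_distrib_mat mult_smult_distrib mult_smult_assoc_mat)

text \<open>Row and column \<open>n\<close> of a matrix of size \<open>n + 1\<close> belong to the vertex \<open>0\<close>, all others to the
  vertex that exceeds them by one.\<close>

definition row_of_vertex :: "nat \<Rightarrow> nat \<Rightarrow> nat" where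
  "row_of_vertex n i = (if i = 0 then n else i - 1)"

definition entry :: "nat \<Rightarrow> 'k mat \<Rightarrow> nat \<Rightarrow> nat \<Rightarrow> 'k" where
  "entry n M j i = M $$ (row_of_vertex n j, row_of_vertex n i)"

text \<open>The inverse of \<^const>\<open>entry\<close>.\<close>

definition mat_of_entries :: "nat \<Rightarrow> (nat \<Rightarrow> nat \<Rightarrow> 'k) \<Rightarrow> 'k mat" where
  "mat_of_entries n e = mat (n + 1) (n + 1) (\<lambda>(r, c). e (if r = n then 0 else r + 1) (if c = n then 0 else c + 1))"

lemma bij_row_of_vertex: "bij_betw (row_of_vertex n) {0..n} {0..<n + 1}"
  by (rule bij_betw_byWitness[where f' = "\<lambda>r. if r = n then 0 else r + 1"])
    (auto simp: row_of_vertex_def)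

lemma row_of_vertex_less: "i \<in> {0..n} \<Longrightarrow> row_of_vertex n i < n + 1"
  using bij_row_of_vertex[of n] by (auto simp: bij_betw_def)

lemma mat_of_entries_carrier [simp]: "mat_of_entries n e \<in> carrier_mat (n + 1) (n + 1)"
  by (simp add: mat_of_entries_def)

lemma entry_mat_of_entries [simp]:
  assumes "i \<in> {0..n}" and "j \<in> {0..n}"
  shows "entry n (mat_of_entries n e) j i = e j i"
proof -
  have "(if row_of_vertex n i = n then 0 else row_of_vertex n i + 1) = i" if "i \<in> {0..n}" for i
    using that by (auto simp: row_of_vertex_def)
  then show ?thesis
    using assms row_of_vertex_less[of _ n] by (simp add: entry_def mat_of_entries_def del: One_nat_def)
qed

lemma mat_eqI_entry:
  assumes M: "M \<in> carrier_mat (n + 1) (n + 1)" "N \<in> carrier_mat (n + 1) (n + 1)"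
    and eq: "\<And>i j. i \<in> {0..n} \<Longrightarrow> j \<in> {0..n} \<Longrightarrow> entry n M j i = entry n N j i"
  shows "M = N"
proof (rule eq_matI)
  fix r c
  assume "r < dim_row N" "c < dim_col N"
  then have "r \<in> row_of_vertex n ` {0..n}" "c \<in> row_of_vertex n ` {0..n}"
    using M bij_row_of_vertex[of n] by (auto simp: bij_betw_def)
  then show "M $$ (r, c) = N $$ (r, c)"
    using eq by (auto simp: entry_def)
qed (use M in auto)

lemma entry_zero: "i \<in> {0..n} \<Longrightarrow> j \<in> {0..n} \<Longrightarrow> entry n (0\<^sub>m (n + 1) (n + 1)) j i = 0"
  using row_of_vertex_less[of i n] row_of_vertex_less[of j n] by (simp add: entry_def)

lemma entry_one:
  assumes "i \<in> {0..n}" and "j \<in> {0..n}"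
  shows "entry n (1\<^sub>m (n + 1)) j i = (if j = i then 1 else 0)"
proof -
  have "row_of_vertex n i = row_of_vertex n j \<longleftrightarrow> i = j"
    using bij_row_of_vertex[of n] assms by (auto simp: bij_betw_def dest: inj_onD)
  then show ?thesis
    using assms row_of_vertex_less[of i n] row_of_vertex_less[of j n] by (auto simp: entry_def)
qed

lemma entry_add:
  assumes "N \<in> carrier_mat (n + 1) (n + 1)" and "i \<in> {0..n}" and "j \<in> {0..n}"
  shows "entry n (M + N) j i = entry n M j i + entry n N j i"
  using assms row_of_vertex_less[of i n] row_of_vertex_less[of j n] by (auto simp: entry_def)

lemma entry_smult:
  assumes "M \<in> carrier_mat (n + 1) (n + 1)" and "i \<in> {0..n}" and "j \<in> {0..n}"
  shows "entry n (c \<cdot>\<^sub>m M) j i = c * entry n M j i"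
  using assms row_of_vertex_less[of i n] row_of_vertex_less[of j n] by (auto simp: entry_def)

lemma entry_mult:
  assumes "M \<in> carrier_mat (n + 1) (n + 1)" and "N \<in> carrier_mat (n + 1) (n + 1)"
    and "i \<in> {0..n}" and "j \<in> {0..n}"
  shows "entry n (M * N) j i = (\<Sum>k\<in>{0..n}. entry n M j k * entry n N k i)"
proof -
  have "entry n (M * N) j i = (\<Sum>r\<in>{0..<n + 1}. M $$ (row_of_vertex n j, r) * N $$ (r, row_of_vertex n i))"
    using assms row_of_vertex_less[of i n] row_of_vertex_less[of j n]
    by (auto simp: entry_def scalar_prod_def)
  also have "\<dots> = (\<Sum>k\<in>{0..n}. entry n M j k * entry n N k i)"
    unfolding entry_def by (rule sum.reindex_bij_betw[OF bij_row_of_vertex, symmetric])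
  finally show ?thesis .
qed

text \<open>In terms of vertices the block shape and the condition on the upper left block become a single
  one: \<open>0\<close> behaves like an additional greatest element. So the closure of the block algebra under
  products is nothing but transitivity.\<close>

lemma lower_block_incidence_iff:
  assumes P: "P \<subseteq> {1..n} \<times> {1..n}"
  shows "M \<in> lower_block n (incidence_algebra n P) \<longleftrightarrow>
    M \<in> carrier_mat (n + 1) (n + 1) \<and>
    (\<forall>i\<in>{0..n}. \<forall>j\<in>{0..n}. entry n M j i \<noteq> 0 \<longrightarrow> j = 0 \<or> (i, j) \<in> P)"
proof (intro iffI)
  assume "M \<in> lower_block n (incidence_algebra n P)"
  then obtain X Y Z where M: "M = four_block_mat X (0\<^sub>m n 1) Y Z"
    and X: "X \<in> carrier_mat n n" "\<And>i j. i \<in> {1..n} \<Longrightarrow> j \<in> {1..n} \<Longrightarrow> X $$ (j - 1, i - 1) \<noteq> 0 \<Longrightarrow> (i, j) \<in> P"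
    and YZ: "Y \<in> carrier_mat 1 n" "Z \<in> carrier_mat 1 1"
    unfolding lower_block_def incidence_algebra_def by blast
  have "j = 0 \<or> (i, j) \<in> P" if "i \<in> {0..n}" "j \<in> {0..n}" "entry n M j i \<noteq> 0" for i j
  proof (cases "j = 0")
    case False
    then have j: "j \<in> {1..n}" "j - 1 < n"
      using that by auto
    show ?thesis
    proof (cases "i = 0")
      case True
      then show ?thesis
        using that(3) False j X(1) YZ by (simp add: M entry_def row_of_vertex_def)
    next
      case i: False
      then have "i \<in> {1..n}" "i - 1 < n"
        using that by auto
      then show ?thesis
        using that(3) False i j X(1) YZ X(2)[of i j] by (simp add: M entry_def row_of_vertex_def)
    qed
  qed simp
  then show "M \<in> carrier_mat (n + 1) (n + 1) \<and>
    (\<forall>i\<in>{0..n}. \<forall>j\<in>{0..n}. entry n M j i \<noteq> 0 \<longrightarrow> j = 0 \<or> (i, j) \<in> P)"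
    using X(1) YZ by (auto simp: M)
next
  assume R: "M \<in> carrier_mat (n + 1) (n + 1) \<and>
    (\<forall>i\<in>{0..n}. \<forall>j\<in>{0..n}. entry n M j i \<noteq> 0 \<longrightarrow> j = 0 \<or> (i, j) \<in> P)"
  define X where "X = mat n n (($$) M)"
  define Y where "Y = mat 1 n (\<lambda>(r, c). M $$ (n, c))"
  define Z where "Z = mat 1 1 (\<lambda>(r, c). M $$ (n, n))"
  have zero: "M $$ (j - 1, n) = 0" if "j \<in> {1..n}" for j
  proof -
    have "(0, j) \<notin> P"
      using P by auto
    then show ?thesis
      using R[THEN conjunct2, rule_format, of 0 j] that by (auto simp: entry_def row_of_vertex_def)
  qed
  have "M = four_block_mat X (0\<^sub>m n 1) Y Z"
  proof (rule eq_matI)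
    fix r c
    assume "r < dim_row (four_block_mat X (0\<^sub>m n 1) Y Z)" "c < dim_col (four_block_mat X (0\<^sub>m n 1) Y Z)"
    then have "r < n + 1" "c < n + 1"
      by (auto simp: X_def Y_def Z_def)
    then show "M $$ (r, c) = four_block_mat X (0\<^sub>m n 1) Y Z $$ (r, c)"
      using zero[of "r + 1"] by (auto simp: X_def Y_def Z_def less_Suc_eq)
  qed (use R in \<open>auto simp: X_def Y_def Z_def\<close>)
  moreover have "(i, j) \<in> P" if "i \<in> {1..n}" "j \<in> {1..n}" "X $$ (j - 1, i - 1) \<noteq> 0" for i j
    using that R[THEN conjunct2, rule_format, of i j] by (auto simp: X_def entry_def row_of_vertex_def)
  then have "X \<in> incidence_algebra n P"
    by (auto simp: incidence_algebra_def X_def)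
  moreover have "Y \<in> carrier_mat 1 n" "Z \<in> carrier_mat 1 1"
    by (auto simp: Y_def Z_def)
  ultimately show "M \<in> lower_block n (incidence_algebra n P)"
    unfolding lower_block_def by blast
qed

text \<open>Diagonal matrices form the incidence algebra of the discrete order, so that one lemma covers both
  block algebras.\<close>

lemma diagonal_mats_eq_incidence: "diagonal_mats n = incidence_algebra n (Id_on {1..n})"
proof -
  have "diagonal_mat M \<longleftrightarrow> (\<forall>i\<in>{1..n}. \<forall>j\<in>{1..n}. M $$ (j - 1, i - 1) \<noteq> 0 \<longrightarrow> (i, j) \<in> Id_on {1..n})"
    if M: "M \<in> carrier_mat n n" for M :: "'k::field mat"
  proof
    assume R: "\<forall>i\<in>{1..n}. \<forall>j\<in>{1..n}. M $$ (j - 1, i - 1) \<noteq> 0 \<longrightarrow> (i, j) \<in> Id_on {1..n}"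
    show "diagonal_mat M"
      unfolding diagonal_mat_def
    proof (intro allI impI)
      fix r c
      assume "r < dim_row M" "c < dim_col M" "r \<noteq> c"
      then show "M $$ (r, c) = 0"
        using R[rule_format, of "c + 1" "r + 1"] M by auto
    qed
  next
    assume D: "diagonal_mat M"
    show "\<forall>i\<in>{1..n}. \<forall>j\<in>{1..n}. M $$ (j - 1, i - 1) \<noteq> 0 \<longrightarrow> (i, j) \<in> Id_on {1..n}"
    proof (intro ballI impI)
      fix i j
      assume ij: "i \<in> {1..n}" "j \<in> {1..n}" "M $$ (j - 1, i - 1) \<noteq> 0"
      have "j - 1 = i - 1"
        using D[unfolded diagonal_mat_def, rule_format, of "j - 1" "i - 1"] ij M by force
      then show "(i, j) \<in> Id_on {1..n}"
        using ij by (auto simp: Id_on_def)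
    qed
  qed
  then show ?thesis
    by (auto simp: diagonal_mats_def incidence_algebra_def)
qed

lemma K_subalgebra_lower_block:
  fixes P :: "nat rel"
  assumes P: "P \<subseteq> {1..n} \<times> {1..n}" and refl: "\<And>i. i \<in> {1..n} \<Longrightarrow> (i, i) \<in> P" and "trans P"
  shows "K_subalgebra (lower_block n (incidence_algebra n P)) (full_mat_algebra (n + 1) :: ('k::field, 'k mat) module)"
proof (rule K_subalgebraI[OF K_algebra_full_mat])
  note iff = lower_block_incidence_iff[OF P] full_mat_algebra_def module_mat_simps
  fix M N :: "'k mat"
  assume M: "M \<in> lower_block n (incidence_algebra n P)"
    and N: "N \<in> lower_block n (incidence_algebra n P)"
  show "M \<oplus>\<^bsub>full_mat_algebra (n + 1)\<^esub> N \<in> lower_block n (incidence_algebra n P)"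
    unfolding iff
  proof (intro conjI ballI impI)
    fix i j
    assume ij: "i \<in> {0..n}" "j \<in> {0..n}" "entry n (M + N) j i \<noteq> 0"
    then have "entry n M j i \<noteq> 0 \<or> entry n N j i \<noteq> 0"
      using N by (subst (asm) entry_add) (auto simp: iff)
    then show "j = 0 \<or> (i, j) \<in> P"
      using M N ij(1,2) unfolding iff by blast
  qed (use M N in \<open>auto simp: iff\<close>)
  have "j = 0 \<or> (i, j) \<in> P" if ij: "i \<in> {0..n}" "j \<in> {0..n}" and "entry n (M * N) j i \<noteq> 0" for i j
  proof -
    have "(\<Sum>k\<in>{0..n}. entry n M j k * entry n N k i) \<noteq> 0"
      using that M N by (subst (asm) entry_mult) (auto simp: iff)
    then obtain k where "k \<in> {0..n}" "entry n M j k \<noteq> 0" "entry n N k i \<noteq> 0"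
      by (metis (mono_tags, lifting) mult_zero_left mult_zero_right sum.neutral)
    then have "j = 0 \<or> (k, j) \<in> P" "k = 0 \<or> (i, k) \<in> P"
      using M N ij by (auto simp: iff)
    then show ?thesis
      using P \<open>trans P\<close> by (auto dest: transD)
  qed
  moreover have "M * N \<in> carrier_mat (n + 1) (n + 1)"
    using M N unfolding iff by (auto intro: mult_carrier_mat)
  ultimately show "M \<otimes>\<^bsub>full_mat_algebra (n + 1)\<^esub> N \<in> lower_block n (incidence_algebra n P)"
    by (simp add: iff)
next
  note iff = lower_block_incidence_iff[OF P] full_mat_algebra_def module_mat_simps
  show "\<one>\<^bsub>full_mat_algebra (n + 1) :: ('k, 'k mat) module\<^esub> \<in> lower_block n (incidence_algebra n P)"
    unfolding iff
  proof (intro conjI ballI impI)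
    fix i j
    assume "i \<in> {0..n}" "j \<in> {0..n}" "entry n (1\<^sub>m (n + 1) :: 'k mat) j i \<noteq> 0"
    then show "j = 0 \<or> (i, j) \<in> P"
      using refl[of i] by (cases "i = 0") (auto simp: entry_one simp del: One_nat_def split: if_splits)
  qed simp
qed (auto simp: lower_block_incidence_iff[OF P] full_mat_algebra_def module_mat_simps entry_zero entry_smult
    simp del: One_nat_def)

section \<open>Paths of the quiver of a poset\<close>

locale quiver_poset =
  fixes n :: nat and P :: "nat rel"
  assumes partial_order: "partial_order_on {1..n} P"
begin

abbreviation strictly_below (infix \<open>\<prec>\<^sub>P\<close> 50) where "i \<prec>\<^sub>P j \<equiv> (i, j) \<in> strict P"

abbreviation "Q \<equiv> poset_quiver n P"

text \<open>The names read as products from right to left, while the arrow lists are in order of traversal: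
  \<open>\<alpha>v_path i j\<close> is the path \<open>\<alpha>\<^sub>i v\<^sub>i\<^sub>j\<close> from \<open>j\<close> to \<open>0\<close>.\<close>

abbreviation e_path :: "nat \<Rightarrow> (nat, arrow) qpath" where
  "e_path i \<equiv> (i, [], i)"
abbreviation \<alpha>_path :: "nat \<Rightarrow> (nat, arrow) qpath" where
  "\<alpha>_path i \<equiv> (i, [Alpha i], 0)"
abbreviation v_path :: "nat \<Rightarrow> nat \<Rightarrow> (nat, arrow) qpath" where
  "v_path i j \<equiv> (j, [Vee i j], i)"
abbreviation \<alpha>v_path :: "nat \<Rightarrow> nat \<Rightarrow> (nat, arrow) qpath" where
  "\<alpha>v_path i j \<equiv> (j, [Vee i j, Alpha i], 0)"
abbreviation vv_path :: "nat \<Rightarrow> nat \<Rightarrow> nat \<Rightarrow> (nat, arrow) qpath" where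
  "vv_path i k j \<equiv> (j, [Vee k j, Vee i k], i)"
abbreviation \<alpha>vv_path :: "nat \<Rightarrow> nat \<Rightarrow> nat \<Rightarrow> (nat, arrow) qpath" where
  "\<alpha>vv_path i k j \<equiv> (j, [Vee k j, Vee i k, Alpha i], 0)"

lemma poset_subset: "P \<subseteq> {1..n} \<times> {1..n}"
  using partial_order by (rule partial_order_onD(4))

lemma strictD: "i \<prec>\<^sub>P j \<Longrightarrow> i \<in> {1..n} \<and> j \<in> {1..n} \<and> i \<noteq> j"
  using poset_subset by auto

lemma finite_strict: "finite (strict P)"
  using poset_subset by (auto intro: finite_subset)

lemma quiver_simps [simp]:
  "verts Q = {0..n}"
  "arcs Q = Alpha ` {1..n} \<union> {Vee i j |i j. i \<prec>\<^sub>P j}"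
  "tail Q (Alpha i) = i" "tail Q (Vee i j) = j" "head Q (Alpha i) = 0" "head Q (Vee i j) = i"
  by (simp_all add: poset_quiver_def)

sublocale finite_vertex_quiver Q
  by unfold_locales (use poset_subset in \<open>auto simp: poset_quiver_def split: arrow.splits\<close>)

sublocale T: ring "T :: ('k::field, 'k elt) module"
  using K_algebra_path_algebra by (rule K_algebraD)

notation mult_T (infixl \<open>\<otimes>\<^sub>T\<close> 70) and add_T (infixl \<open>\<oplus>\<^sub>T\<close> 65) and smult_T (infixl \<open>\<odot>\<^sub>T\<close> 75)
  and zero_T (\<open>\<zero>\<^sub>T\<close>) and one_T (\<open>\<one>\<^sub>T\<close>)

lemmas T_simps = path_algebra_simps[of Q]

lemma poset_T_eq: "poset_T n P = T"
  by (simp add: poset_T_def)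

lemma arrow_Alpha: "Alpha i \<in> arcs Q \<longleftrightarrow> i \<in> {1..n}"
  and arrow_Vee: "Vee i j \<in> arcs Q \<longleftrightarrow> i \<prec>\<^sub>P j"
  by auto

lemma awalk_Cons:
  "awalk u (a # L) v \<longleftrightarrow> a \<in> arcs Q \<and> u = tail Q a \<and> awalk (head Q a) L v"
  by (rule awalk_Cons_iff)

lemma awalk_Nil: "awalk u [] v \<longleftrightarrow> u = v \<and> u \<in> {0..n}"
  by (simp add: awalk_Nil_iff)

lemma awalk_from_zero: "awalk 0 L v \<longleftrightarrow> L = [] \<and> v = 0"
proof (cases L)
  case (Cons a L')
  then show ?thesis
    using poset_subset by (cases a) (auto simp: awalk_Cons)
qed (auto simp: awalk_Nil)

lemma path_mem:
  "e_path i \<in> qpaths Q \<longleftrightarrow> i \<in> {0..n}"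
  "\<alpha>_path i \<in> qpaths Q \<longleftrightarrow> i \<in> {1..n}"
  "v_path i j \<in> qpaths Q \<longleftrightarrow> i \<prec>\<^sub>P j"
  "\<alpha>v_path i j \<in> qpaths Q \<longleftrightarrow> i \<prec>\<^sub>P j"
  "vv_path i k j \<in> qpaths Q \<longleftrightarrow> i \<prec>\<^sub>P k \<and> k \<prec>\<^sub>P j"
  "\<alpha>vv_path i k j \<in> qpaths Q \<longleftrightarrow> i \<prec>\<^sub>P k \<and> k \<prec>\<^sub>P j"
  using strictD by (auto simp: mem_qpaths awalk_Nil awalk_Cons arrow_Alpha arrow_Vee simp del: quiver_simps(2))

text \<open>Every arrow into \<open>0\<close> is some \<open>\<alpha>\<^sub>i\<close> and no arrow leaves \<open>0\<close>; hence a path of degree \<open>d\<close> has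
  \<open>d\<close> arrows \<open>v\<^sub>i\<^sub>j\<close>, possibly followed by a single \<open>\<alpha>\<^sub>i\<close>.\<close>

lemma path_cases:
  assumes "(u, L, v) \<in> qpaths Q"
  obtains (Nil) "L = []" "u = v" "u \<in> {0..n}"
    | (Alpha) "L = [Alpha u]" "v = 0" "u \<in> {1..n}"
    | (Vee) i L' where "L = Vee i u # L'" "i \<prec>\<^sub>P u" "(i, L', v) \<in> qpaths Q"
proof (cases L)
  case Nil
  then show ?thesis
    using assms that(1) by (simp add: mem_qpaths awalk_Nil)
next
  case (Cons a L')
  show ?thesis
  proof (cases a)
    case (Alpha i)
    then show ?thesis
      using assms that(2) Cons
      by (auto simp: mem_qpaths awalk_Cons awalk_from_zero arrow_Alpha simp del: quiver_simps(2))
  next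
    case (Vee i j)
    then show ?thesis
      using assms that(3) Cons
      by (auto simp: mem_qpaths awalk_Cons arrow_Vee simp del: quiver_simps(2))
  qed
qed

lemma degree_simps [simp]:
  "path_degree (u, [], v) = 0"
  "path_degree (u, Alpha i # L, v) = path_degree (0, L, v)"
  "path_degree (u, Vee i j # L, v) = Suc (path_degree (i, L, v))"
  by (simp_all add: path_degree_def)

lemma degree_0_cases:
  assumes "r \<in> qpaths Q" and "path_degree r = 0"
  obtains i where "i \<in> {0..n}" "r = e_path i" | i where "i \<in> {1..n}" "r = \<alpha>_path i"
proof -
  obtain u L v where r: "r = (u, L, v)"
    by (cases r)
  show ?thesis
    using assms(1) unfolding r
    by (cases rule: path_cases) (use assms(2) that in \<open>auto simp: r\<close>)
qed

lemma degree_1_cases: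
  assumes "r \<in> qpaths Q" and "path_degree r = 1"
  obtains i j where "i \<prec>\<^sub>P j" "r = v_path i j"
    | i j where "i \<prec>\<^sub>P j" "r = \<alpha>v_path i j"
proof -
  obtain u L v where r: "r = (u, L, v)"
    by (cases r)
  show ?thesis
    using assms(1) unfolding r
  proof (cases rule: path_cases)
    case (Vee i L')
    then have "path_degree (i, L', v) = 0"
      using assms(2) by (simp add: r)
    with Vee(3) show ?thesis
      by (cases rule: degree_0_cases) (use Vee that in \<open>auto simp: r\<close>)
  qed (use assms(2) in \<open>auto simp: r\<close>)
qed

lemma degree_2_cases:
  assumes "r \<in> qpaths Q" and "path_degree r = 2"
  obtains i k j where "i \<prec>\<^sub>P k" "k \<prec>\<^sub>P j" "r = vv_path i k j"
    | i k j where "i \<prec>\<^sub>P k" "k \<prec>\<^sub>P j" "r = \<alpha>vv_path i k j"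
proof -
  obtain u L v where r: "r = (u, L, v)"
    by (cases r)
  show ?thesis
    using assms(1) unfolding r
  proof (cases rule: path_cases)
    case (Vee i L')
    then have "path_degree (i, L', v) = 1"
      using assms(2) by (simp add: r)
    with Vee(3) show ?thesis
      by (cases rule: degree_1_cases) (use Vee that in \<open>auto simp: r\<close>)
  qed (use assms(2) in \<open>auto simp: r\<close>)
qed

abbreviation deg :: "nat \<Rightarrow> 'k::field elt set" where
  "deg \<equiv> poset_T_deg n P"

lemma degD: "f \<in> deg d \<Longrightarrow> f \<in> carrier T" "f \<in> deg d \<Longrightarrow> f r \<noteq> 0 \<Longrightarrow> path_degree r = d"
  unfolding poset_T_deg_def poset_T_eq by blast+

lemma degI: "f \<in> carrier T \<Longrightarrow> (\<And>r. f r \<noteq> 0 \<Longrightarrow> path_degree r = d) \<Longrightarrow> f \<in> deg d"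
  by (auto simp: poset_T_deg_def poset_T_eq)

lemma support: "f \<in> carrier T \<Longrightarrow> f r \<noteq> 0 \<Longrightarrow> r \<in> qpaths Q"
  by (auto simp: T_simps)

lemma off_support: "f \<in> carrier T \<Longrightarrow> r \<notin> qpaths Q \<Longrightarrow> f r = 0"
  by (auto simp: T_simps)

lemma off_degree: "f \<in> deg d \<Longrightarrow> path_degree r \<noteq> d \<Longrightarrow> f r = 0"
  using degD(2) by blast

lemma deg_zero [simp, intro]: "(\<lambda>r. 0) \<in> deg d"
  by (rule degI) (auto simp: T_simps)

lemma deg_add: "f \<in> deg d \<Longrightarrow> g \<in> deg d \<Longrightarrow> f \<oplus>\<^sub>T g \<in> deg d"
proof (rule degI)
  assume fg: "f \<in> deg d" "g \<in> deg d"
  then show "f \<oplus>\<^sub>T g \<in> carrier T"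
    by (intro T.a_closed degD(1))
  fix r
  assume "(f \<oplus>\<^sub>T g) r \<noteq> 0"
  then have "f r \<noteq> 0 \<or> g r \<noteq> 0"
    by (auto simp: T_simps(2))
  then show "path_degree r = d"
    using degD(2)[OF fg(1)] degD(2)[OF fg(2)] by blast
qed

lemma deg_smult: "f \<in> deg d \<Longrightarrow> c \<odot>\<^sub>T f \<in> deg d"
proof (rule degI)
  assume f: "f \<in> deg d"
  then show "c \<odot>\<^sub>T f \<in> carrier T"
    by (intro K_algebraD(2)[OF K_algebra_path_algebra] degD(1))
  fix r
  assume "(c \<odot>\<^sub>T f) r \<noteq> 0"
  then show "path_degree r = d"
    using degD(2)[OF f] by (simp add: T_simps(4))
qed

lemma mult_support:
  assumes "(f \<otimes>\<^sub>T g) r \<noteq> 0"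
  obtains p q where "(p, q) \<in> path_splits Q r" "f p \<noteq> 0" "g q \<noteq> 0"
proof -
  have "(\<Sum>(p, q)\<in>path_splits Q r. f p * g q) \<noteq> 0"
    using assms by (simp add: path_algebra_mult)
  then obtain x where "x \<in> path_splits Q r" "(case x of (p, q) \<Rightarrow> f p * g q) \<noteq> 0"
    by (meson sum.neutral)
  then show thesis
    using that[of "fst x" "snd x"] by (auto simp: case_prod_unfold)
qed

lemma deg_mult:
  assumes "f \<in> deg k" and "g \<in> deg l"
  shows "f \<otimes>\<^sub>T g \<in> deg (k + l)"
proof (rule degI)
  show "f \<otimes>\<^sub>T g \<in> carrier T"
    using assms by (auto dest: degD)
  fix r
  assume "(f \<otimes>\<^sub>T g) r \<noteq> 0"
  then obtain p q where "(p, q) \<in> path_splits Q r" and nz: "f p \<noteq> 0" "g q \<noteq> 0"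
    by (rule mult_support)
  moreover have "path_degree p = k" "path_degree q = l"
    using degD(2)[OF assms(1) nz(1)] degD(2)[OF assms(2) nz(2)] .
  ultimately show "path_degree r = k + l"
    by (auto simp: path_splits_def qcomp_def path_degree_def)
qed

lemma path_elt_carrier: "p \<in> qpaths Q \<Longrightarrow> path_elt p \<in> carrier T"
  by (auto simp: T_simps path_elt_def intro: finite_subset[of _ "{p}"])

lemma path_elt_deg: "p \<in> qpaths Q \<Longrightarrow> path_elt p \<in> deg (path_degree p)"
  by (rule degI) (rule path_elt_carrier, auto simp: path_elt_def split: if_splits)

lemma one_deg: "\<one>\<^sub>T \<in> deg 0"
  by (rule degI) (rule T.one_closed, auto simp: T_simps(5) split: if_splits)

subsection \<open>Coordinates of products\<close>

lemma mult_zero_right: "f \<otimes>\<^sub>T (\<lambda>q. 0) = (\<lambda>q. 0)"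
  by (auto simp: path_algebra_mult)

text \<open>The coefficient of a product at a path sums over all places where the path can be cut. In degrees
  at most two this gives the following formulas, in which most terms vanish for reasons of degree when
  the factors are homogeneous.\<close>

lemma mult_e: "i \<in> {0..n} \<Longrightarrow> (f \<otimes>\<^sub>T g) (e_path i) = f (e_path i) * g (e_path i)"
  by (subst path_algebra_mult_Nil) (auto simp: path_mem)

lemma mult_Cons:
  "(u, a # L, v) \<in> qpaths Q \<Longrightarrow> (f \<otimes>\<^sub>T g) (u, a # L, v) =
    f (u, a # L, v) * g (u, [], u) + (f \<otimes>\<^sub>T (\<lambda>q. g (u, a # fst (snd q), snd (snd q)))) (head Q a, L, v)"
  by (rule path_algebra_mult_Cons)

lemma mult_\<alpha>:
  assumes "i \<in> {1..n}"
  shows "(f \<otimes>\<^sub>T g) (\<alpha>_path i) = f (\<alpha>_path i) * g (e_path i) + f (e_path 0) * g (\<alpha>_path i)"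
  using assms by (subst mult_Cons) (simp_all add: path_mem mult_e)

lemma mult_v:
  assumes "i \<prec>\<^sub>P j"
  shows "(f \<otimes>\<^sub>T g) (v_path i j) = f (v_path i j) * g (e_path j) + f (e_path i) * g (v_path i j)"
  using assms strictD[OF assms] by (subst mult_Cons) (simp_all add: path_mem mult_e)

lemma mult_\<alpha>v:
  assumes "i \<prec>\<^sub>P j"
  shows "(f \<otimes>\<^sub>T g) (\<alpha>v_path i j) = f (\<alpha>v_path i j) * g (e_path j) + f (\<alpha>_path i) * g (v_path i j)
    + f (e_path 0) * g (\<alpha>v_path i j)"
  using assms strictD[OF assms] by (subst mult_Cons) (simp_all add: path_mem mult_\<alpha>)

lemma mult_vv:
  assumes "i \<prec>\<^sub>P k" and "k \<prec>\<^sub>P j"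
  shows "(f \<otimes>\<^sub>T g) (vv_path i k j) = f (vv_path i k j) * g (e_path j) + f (v_path i k) * g (v_path k j)
    + f (e_path i) * g (vv_path i k j)"
  using assms by (subst mult_Cons) (simp_all add: path_mem mult_v)

lemma mult_\<alpha>vv:
  assumes "i \<prec>\<^sub>P k" and "k \<prec>\<^sub>P j"
  shows "(f \<otimes>\<^sub>T g) (\<alpha>vv_path i k j) = f (\<alpha>vv_path i k j) * g (e_path j) + f (\<alpha>v_path i k) * g (v_path k j)
    + f (\<alpha>_path i) * g (vv_path i k j) + f (e_path 0) * g (\<alpha>vv_path i k j)"
  using assms by (subst mult_Cons) (simp_all add: path_mem mult_\<alpha>v)

text \<open>A homogeneous element is determined by its coefficients at the paths of its degree. This
  reduces identities in \<open>A\<close>, \<open>V\<close> and \<open>T\<^sub>2\<close> to identities of scalars.\<close>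

lemma deg_0_eqI:
  assumes "f \<in> deg 0" and "g \<in> deg 0"
    and "\<And>i. i \<in> {0..n} \<Longrightarrow> f (e_path i) = g (e_path i)"
    and "\<And>i. i \<in> {1..n} \<Longrightarrow> f (\<alpha>_path i) = g (\<alpha>_path i)"
  shows "f = g"
proof
  fix r
  show "f r = g r"
  proof (cases "r \<in> qpaths Q \<and> path_degree r = 0")
    case True
    then have "r \<in> qpaths Q" "path_degree r = 0"
      by auto
    then show ?thesis
      by (cases rule: degree_0_cases) (use assms in auto)
  qed (use assms(1,2) in \<open>metis degD(1) off_degree off_support\<close>)
qed

lemma deg_1_eqI:
  assumes "f \<in> deg 1" and "g \<in> deg 1"
    and "\<And>i j. i \<prec>\<^sub>P j \<Longrightarrow> f (v_path i j) = g (v_path i j)"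
    and "\<And>i j. i \<prec>\<^sub>P j \<Longrightarrow> f (\<alpha>v_path i j) = g (\<alpha>v_path i j)"
  shows "f = g"
proof
  fix r
  show "f r = g r"
  proof (cases "r \<in> qpaths Q \<and> path_degree r = 1")
    case True
    then have "r \<in> qpaths Q" "path_degree r = 1"
      by auto
    then show ?thesis
      by (cases rule: degree_1_cases) (use assms in auto)
  qed (use assms(1,2) in \<open>metis degD(1) off_degree off_support\<close>)
qed

lemma finsum_T_apply:
  fixes F :: "'s \<Rightarrow> 'k::field elt"
  assumes "finite S" and "F \<in> S \<rightarrow> carrier T"
  shows "finsum T F S r = (\<Sum>s\<in>S. F s r)"
  using assms
proof (induction S rule: finite_induct)
  case empty
  then show ?case
    by (simp add: T_simps(3))
next
  case (insert s S)
  then have "finsum T F (insert s S) = F s \<oplus>\<^sub>T finsum T F S"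
    by (intro T.finsum_insert) (auto simp: Pi_iff)
  then show ?case
    using insert by (simp add: T_simps(2) Pi_iff)
qed

lemma a_inv_T_apply: "(f :: 'k::field elt) \<in> carrier T \<Longrightarrow> (\<ominus>\<^bsub>T\<^esub> f) r = - f r"
  using K_algebra_neg[OF K_algebra_path_algebra, of f] by (simp add: T_simps(4))

section \<open>The differential\<close>

declare split_paired_All [simp del] split_paired_Ex [simp del]

lemmas T_smult = K_algebraD(2-8)[OF K_algebra_path_algebra]

abbreviation arrow_elt :: "arrow \<Rightarrow> 'k::field elt" where
  "arrow_elt a \<equiv> path_elt (tail Q a, [a], head Q a)"

text \<open>The coefficients of the prescribed values of the differential on the arrows; \<open>\<delta>_alpha\<close> and
  \<open>\<delta>_vee\<close> below match them with the sums in the definition of the bocs.\<close>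

definition \<delta>_arrow :: "arrow \<Rightarrow> 'k::field elt" where
  "\<delta>_arrow a = (case a of
     Alpha i \<Rightarrow> (\<lambda>r. if \<exists>h. h \<prec>\<^sub>P i \<and> r = \<alpha>v_path h i then - 1 else 0)
   | Vee i j \<Rightarrow> (\<lambda>r. if \<exists>k. i \<prec>\<^sub>P k \<and> k \<prec>\<^sub>P j \<and> r = vv_path i k j then 1 else 0))"

text \<open>The product rule \<open>\<delta>(pa) = \<delta>(p)a + (-1)\<^bsup>|p|\<^esup> p\<delta>(a)\<close>, used to split off the arrow \<open>a\<close> that is
  traversed first. The number \<open>v\<close> is the end of the path; its start can be read off the first arrow,
  and on trivial paths the value is \<open>0\<close>.\<close>

primrec \<delta>_list :: "arrow list \<Rightarrow> nat \<Rightarrow> 'k::field elt" where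
  "\<delta>_list [] v = (\<lambda>r. 0)"
| "\<delta>_list (a # L) v = \<delta>_list L v \<otimes>\<^sub>T arrow_elt a \<oplus>\<^sub>T
     (- 1) ^ path_degree (head Q a, L, v) \<odot>\<^sub>T (path_elt (head Q a, L, v) \<otimes>\<^sub>T \<delta>_arrow a)"

abbreviation \<delta>_path :: "(nat, arrow) qpath \<Rightarrow> 'k::field elt" where
  "\<delta>_path p \<equiv> \<delta>_list (fst (snd p)) (snd (snd p))"

text \<open>The linear extension from paths to \<open>T\<close>.\<close>

definition \<delta> :: "'k::field elt \<Rightarrow> 'k elt" where
  "\<delta> f = (\<lambda>r. \<Sum>p | f p \<noteq> 0. f p * \<delta>_path p r)"

text \<open>The space \<open>e\<^sub>v T e\<^sub>u\<close> of linear combinations of paths from \<open>u\<close> to \<open>v\<close>. The differential preserves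
  it, so that products of non-composable paths raise no obstruction to the product rule.\<close>

definition between :: "nat \<Rightarrow> nat \<Rightarrow> 'k::field elt set" where
  "between u v = {f \<in> carrier T. \<forall>r. f r \<noteq> 0 \<longrightarrow> fst r = u \<and> snd (snd r) = v}"

lemma between_mult:
  assumes "f \<in> between w v" and "g \<in> between u w"
  shows "f \<otimes>\<^sub>T g \<in> between u v"
proof -
  have "fst r = u \<and> snd (snd r) = v" if "(f \<otimes>\<^sub>T g) r \<noteq> 0" for r
    using that
  proof (rule mult_support)
    fix p q
    assume "(p, q) \<in> path_splits Q r" "f p \<noteq> 0" "g q \<noteq> 0"
    then show ?thesis
      using assms by (auto simp: between_def path_splits_def qcomp_def)
  qed
  then show ?thesis
    using assms by (simp add: between_def)
qed

lemma between_add: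
  assumes "f \<in> between u v" and "g \<in> between u v"
  shows "f \<oplus>\<^sub>T g \<in> between u v"
proof -
  have "fst r = u \<and> snd (snd r) = v" if "(f \<oplus>\<^sub>T g) r \<noteq> 0" for r
  proof -
    have "f r \<noteq> 0 \<or> g r \<noteq> 0"
      using that by (auto simp: T_simps(2))
    then show ?thesis
      using assms by (auto simp: between_def)
  qed
  then show ?thesis
    using assms by (simp add: between_def)
qed

lemma between_smult: "f \<in> between u v \<Longrightarrow> c \<odot>\<^sub>T f \<in> between u v"
  using T_smult(1)[of f c] by (simp add: between_def T_simps(4))

lemma between_path_elt: "(u, L, v) \<in> qpaths Q \<Longrightarrow> path_elt (u, L, v) \<in> between u v"
  by (simp add: between_def path_elt_carrier) (simp add: path_elt_def)

lemma between_mult_zero: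
  assumes "f \<in> between u v" and "g \<in> between u' v'" and "u \<noteq> v'"
  shows "f \<otimes>\<^sub>T g = \<zero>\<^sub>T"
proof
  fix r
  show "(f \<otimes>\<^sub>T g) r = \<zero>\<^sub>T r"
  proof (rule ccontr)
    assume "(f \<otimes>\<^sub>T g) r \<noteq> \<zero>\<^sub>T r"
    then have "(f \<otimes>\<^sub>T g) r \<noteq> 0"
      by (simp add: T_simps(3))
    then show False
      by (rule mult_support) (use assms in \<open>auto simp: between_def path_splits_def composable_def\<close>)
  qed
qed

lemma between_mult_idem:
  fixes f :: "'k::field elt"
  assumes f: "f \<in> between u v"
  shows "f \<otimes>\<^sub>T path_elt (u, [], u) = f" and "path_elt (v, [], v) \<otimes>\<^sub>T f = f"
proof -
  have f': "fst p = u \<and> snd (snd p) = v" if "f p \<noteq> 0" for p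
    using f that by (simp add: between_def)
  have "f \<otimes>\<^sub>T path_elt (u, [], u) = f \<otimes>\<^sub>T \<one>\<^sub>T"
    unfolding fun_eq_iff path_algebra_mult
  proof (intro allI sum.cong refl)
    fix r x
    assume "x \<in> path_splits Q r"
    then show "(case x of (p, q) \<Rightarrow> f p * path_elt (u, [], u) q) = (case x of (p, q) \<Rightarrow> f p * \<one>\<^sub>T q)"
      using f'[of "fst x"] by (cases "f (fst x) = 0")
        (auto simp: path_splits_def composable_def between_def path_elt_def T_simps(5) path_mem)
  qed
  then show "f \<otimes>\<^sub>T path_elt (u, [], u) = f"
    using f by (simp add: between_def)
  have "path_elt (v, [], v) \<otimes>\<^sub>T f = \<one>\<^sub>T \<otimes>\<^sub>T f"
    unfolding fun_eq_iff path_algebra_mult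
  proof (intro allI sum.cong refl)
    fix r x
    assume "x \<in> path_splits Q r"
    then show "(case x of (p, q) \<Rightarrow> path_elt (v, [], v) p * f q) = (case x of (p, q) \<Rightarrow> \<one>\<^sub>T p * f q)"
      using f'[of "snd x"] by (cases "f (snd x) = 0")
        (auto simp: path_splits_def composable_def between_def path_elt_def T_simps(5) path_mem)
  qed
  then show "path_elt (v, [], v) \<otimes>\<^sub>T f = f"
    using f by (simp add: between_def)
qed

lemma arrow_elt_path: "a \<in> arcs Q \<Longrightarrow> (tail Q a, [a], head Q a) \<in> qpaths Q"
  unfolding mem_qpaths by (rule arc_implies_awalk)

lemma arrow_elt_props:
  assumes "a \<in> arcs Q"
  shows "arrow_elt a \<in> carrier T" and "arrow_elt a \<in> between (tail Q a) (head Q a)"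
    and "arrow_elt a \<in> deg (if is_Vee a then 1 else 0)"
  using path_elt_carrier[OF arrow_elt_path[OF assms]] between_path_elt[OF arrow_elt_path[OF assms]]
    path_elt_deg[OF arrow_elt_path[OF assms]] by (auto simp: path_degree_def split: if_splits)

lemma \<delta>_arrow_props:
  assumes "a \<in> arcs Q"
  shows "\<delta>_arrow a \<in> between (tail Q a) (head Q a)"
    and "\<delta>_arrow a \<in> deg (Suc (if is_Vee a then 1 else 0))"
proof -
  have S: "finite {k. k \<prec>\<^sub>P i}" for i
    using finite_strict by (rule finite_surj[of _ _ fst]) force
  have "\<delta>_arrow a \<in> carrier T \<and> (\<forall>r. \<delta>_arrow a r \<noteq> 0 \<longrightarrow>
      fst r = tail Q a \<and> snd (snd r) = head Q a \<and> path_degree r = Suc (if is_Vee a then 1 else 0))"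
  proof (cases a)
    case (Alpha i)
    have "{r. \<exists>h. h \<prec>\<^sub>P i \<and> r = \<alpha>v_path h i} = (\<lambda>h. \<alpha>v_path h i) ` {h. h \<prec>\<^sub>P i}"
      by auto
    then have "finite {r. \<exists>h. h \<prec>\<^sub>P i \<and> r = \<alpha>v_path h i}"
      using S by simp
    then show ?thesis
      by (auto simp: Alpha T_simps \<delta>_arrow_def path_mem split: if_splits elim!: rev_finite_subset)
  next
    case (Vee i j)
    have "{r. \<exists>k. i \<prec>\<^sub>P k \<and> k \<prec>\<^sub>P j \<and> r = vv_path i k j} \<subseteq> (\<lambda>k. vv_path i k j) ` {k. k \<prec>\<^sub>P j}"
      by auto
    then have "finite {r. \<exists>k. i \<prec>\<^sub>P k \<and> k \<prec>\<^sub>P j \<and> r = vv_path i k j}"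
      by (rule finite_subset) (rule finite_imageI[OF S])
    then show ?thesis
      by (auto simp: Vee T_simps \<delta>_arrow_def path_mem split: if_splits elim!: rev_finite_subset)
  qed
  then show "\<delta>_arrow a \<in> between (tail Q a) (head Q a)" "\<delta>_arrow a \<in> deg (Suc (if is_Vee a then 1 else 0))"
    unfolding between_def by (blast, blast intro: degI)
qed

lemma degree_Cons: "path_degree (u, a # L, v) = path_degree (w, L, v) + (if is_Vee a then 1 else 0)"
  by (simp add: path_degree_def)

lemma \<delta>_list_props:
  assumes "(u, L, v) \<in> qpaths Q"
  shows "(\<delta>_list L v :: 'k::field elt) \<in> between u v" and "(\<delta>_list L v :: 'k elt) \<in> deg (Suc (path_degree (u, L, v)))"
proof -
  have "(\<delta>_list L v :: 'k elt) \<in> between u v \<and> (\<delta>_list L v :: 'k elt) \<in> deg (Suc (path_degree (u, L, v)))"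
    using assms
  proof (induction L arbitrary: u)
    case Nil
    then show ?case
      by (auto simp: between_def T_simps)
  next
    case (Cons a L)
    then have a: "a \<in> arcs Q" "u = tail Q a" and L: "(head Q a, L, v) \<in> qpaths Q"
      by (auto simp: mem_qpaths awalk_Cons)
    note IH = Cons.IH[OF L]
    have "(\<delta>_list (a # L) v :: 'k elt) \<in> between u v"
      unfolding a(2) \<delta>_list.simps
      by (intro between_add between_smult between_mult[OF conjunct1[OF IH] arrow_elt_props(2)[OF a(1)]]
          between_mult[OF between_path_elt[OF L] \<delta>_arrow_props(1)[OF a(1)]])
    moreover have "(\<delta>_list L v \<otimes>\<^sub>T arrow_elt a :: 'k elt) \<in> deg (Suc (path_degree (u, a # L, v)))"
      using deg_mult[OF conjunct2[OF IH] arrow_elt_props(3)[OF a(1)]]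
      by (simp add: degree_Cons[of u a L v "head Q a"])
    moreover have "(path_elt (head Q a, L, v) \<otimes>\<^sub>T \<delta>_arrow a :: 'k elt) \<in> deg (Suc (path_degree (u, a # L, v)))"
      using deg_mult[OF path_elt_deg[OF L] \<delta>_arrow_props(2)[OF a(1)]]
      by (simp add: degree_Cons[of u a L v "head Q a"])
    ultimately show ?case
      by (auto intro: deg_add deg_smult)
  qed
  then show "(\<delta>_list L v :: 'k elt) \<in> between u v" "(\<delta>_list L v :: 'k elt) \<in> deg (Suc (path_degree (u, L, v)))"
    by auto
qed

lemma \<delta>_path_carrier: "p \<in> qpaths Q \<Longrightarrow> (\<delta>_path p :: 'k::field elt) \<in> carrier T"
  using \<delta>_list_props(1)[of "fst p" "fst (snd p)" "snd (snd p)", where 'k = 'k] by (simp add: between_def)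

lemma path_elt_comp:
  assumes "(u, K, w) \<in> qpaths Q" and "(w, L, v) \<in> qpaths Q"
  shows "path_elt (w, L, v) \<otimes>\<^sub>T path_elt (u, K, w) = path_elt (u, K @ L, v)"
  using assms by (subst path_elt_mult) (auto simp: composable_def qcomp_def)

text \<open>The graded product rule for two composable paths, by induction on the one traversed first.\<close>

lemma \<delta>_list_append:
  assumes "(u, K, w) \<in> qpaths Q" and "(w, L, v) \<in> qpaths Q"
  shows "\<delta>_list (K @ L) v = (\<delta>_list L v \<otimes>\<^sub>T path_elt (u, K, w) :: 'k::field elt) \<oplus>\<^sub>T
    (- 1) ^ path_degree (w, L, v) \<odot>\<^sub>T (path_elt (w, L, v) \<otimes>\<^sub>T \<delta>_list K w)"
  using assms(1)
proof (induction K arbitrary: u)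
  case Nil
  then have "u = w"
    by (simp add: mem_qpaths awalk_Nil)
  moreover have "(\<delta>_list L v \<otimes>\<^sub>T path_elt (w, [], w) :: 'k elt) = \<delta>_list L v"
    by (rule between_mult_idem(1)[OF \<delta>_list_props(1)[OF assms(2)]])
  ultimately show ?case
    by (simp add: mult_zero_right) (simp add: T_simps)
next
  case (Cons a K)
  then have a: "a \<in> arcs Q" "u = tail Q a" and K: "(head Q a, K, w) \<in> qpaths Q"
    by (auto simp: mem_qpaths awalk_Cons)
  let ?x = "head Q a" and ?p = "path_elt (w, L, v) :: 'k elt" and ?s = "(- 1) ^ path_degree (w, L, v) :: 'k"
  let ?q = "path_elt (?x, K, w) :: 'k elt" and ?t = "(- 1) ^ path_degree (?x, K, w) :: 'k"
  have c: "?p \<in> carrier T" "?q \<in> carrier T" "(arrow_elt a :: 'k elt) \<in> carrier T" "(\<delta>_arrow a :: 'k elt) \<in> carrier T"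
      "(\<delta>_list L v :: 'k elt) \<in> carrier T" "(\<delta>_list K w :: 'k elt) \<in> carrier T"
    using path_elt_carrier[OF K] path_elt_carrier[OF assms(2)] arrow_elt_props(1)[OF a(1)]
      \<delta>_arrow_props(1)[OF a(1)] \<delta>_list_props(1)[OF K] \<delta>_list_props(1)[OF assms(2)]
    by (auto simp: between_def)
  have KL: "path_elt (?x, K @ L, v) = ?p \<otimes>\<^sub>T ?q"
    by (rule path_elt_comp[OF K assms(2), symmetric])
  have aK: "path_elt (u, a # K, w) = ?q \<otimes>\<^sub>T arrow_elt a"
    unfolding a(2) path_elt_comp[OF arrow_elt_path[OF a(1)] K] by simp
  have sign: "(- 1) ^ path_degree (?x, K @ L, v) = ?s * ?t"
    by (simp add: path_degree_def flip: power_add) (simp add: add.commute)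
  have "\<delta>_list ((a # K) @ L) v =
      (\<delta>_list L v \<otimes>\<^sub>T ?q \<oplus>\<^sub>T ?s \<odot>\<^sub>T (?p \<otimes>\<^sub>T \<delta>_list K w)) \<otimes>\<^sub>T arrow_elt a \<oplus>\<^sub>T
      (?s * ?t) \<odot>\<^sub>T ((?p \<otimes>\<^sub>T ?q) \<otimes>\<^sub>T \<delta>_arrow a)"
    using Cons.IH[OF K] by (simp add: KL sign)
  also have "\<dots> = (\<delta>_list L v \<otimes>\<^sub>T ?q) \<otimes>\<^sub>T arrow_elt a \<oplus>\<^sub>T
      (?s \<odot>\<^sub>T ((?p \<otimes>\<^sub>T \<delta>_list K w) \<otimes>\<^sub>T arrow_elt a) \<oplus>\<^sub>T
       ?s \<odot>\<^sub>T (?t \<odot>\<^sub>T ((?p \<otimes>\<^sub>T ?q) \<otimes>\<^sub>T \<delta>_arrow a)))"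
    using c by (simp add: T.l_distr T_smult T.a_assoc)
  also have "\<dots> = \<delta>_list L v \<otimes>\<^sub>T (?q \<otimes>\<^sub>T arrow_elt a) \<oplus>\<^sub>T
      ?s \<odot>\<^sub>T (?p \<otimes>\<^sub>T (\<delta>_list K w \<otimes>\<^sub>T arrow_elt a \<oplus>\<^sub>T ?t \<odot>\<^sub>T (?q \<otimes>\<^sub>T \<delta>_arrow a)))"
    using c by (simp add: T.r_distr T_smult T.m_assoc)
  finally show ?case
    by (simp only: aK \<delta>_list.simps)
qed

text \<open>For paths that do not compose, both sides vanish because the differential preserves start and end.\<close>

lemma \<delta>_path_mult:
  assumes p: "p \<in> qpaths Q" and q: "q \<in> qpaths Q"
  shows "(if composable p q then \<delta>_path (qcomp p q) else \<zero>\<^sub>T) =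
    (\<delta>_path p \<otimes>\<^sub>T path_elt q :: 'k::field elt) \<oplus>\<^sub>T (- 1) ^ path_degree p \<odot>\<^sub>T (path_elt p \<otimes>\<^sub>T \<delta>_path q)"
proof -
  obtain w L v u K w' where pq: "p = (w, L, v)" "q = (u, K, w')"
    by (metis prod.collapse)
  show ?thesis
  proof (cases "w = w'")
    case True
    then show ?thesis
      using \<delta>_list_append[of u K w L v, where 'k = 'k] p q by (simp add: pq composable_def qcomp_def)
  next
    case False
    have "(\<delta>_path p \<otimes>\<^sub>T path_elt q :: 'k elt) = \<zero>\<^sub>T"
      using p q \<delta>_list_props(1)[of w L v] between_path_elt[of u K w'] False
      unfolding pq by (intro between_mult_zero) auto
    moreover have "(path_elt p \<otimes>\<^sub>T \<delta>_path q :: 'k elt) = \<zero>\<^sub>T"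
      using p q \<delta>_list_props(1)[of u K w'] between_path_elt[of w L v] False
      unfolding pq by (intro between_mult_zero) auto
    ultimately show ?thesis
      using False by (simp add: pq composable_def) (simp add: T_simps)
  qed
qed

lemma \<delta>_superset:
  assumes "finite S" and "{p. f p \<noteq> 0} \<subseteq> S"
  shows "\<delta> f r = (\<Sum>p\<in>S. f p * \<delta>_path p r)"
  unfolding \<delta>_def using assms by (intro sum.mono_neutral_left) auto

lemma \<delta>_add:
  assumes "f \<in> carrier T" and "g \<in> carrier T"
  shows "\<delta> (f \<oplus>\<^sub>T g) = \<delta> f \<oplus>\<^sub>T \<delta> g"
proof
  fix r
  have "finite ({p. f p \<noteq> 0} \<union> {p. g p \<noteq> 0})"
    using assms by (auto simp: T_simps)
  note * = \<delta>_superset[OF this]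
  have "{p. f p + g p \<noteq> 0} \<subseteq> {p. f p \<noteq> 0} \<union> {p. g p \<noteq> 0}"
    by auto
  then show "\<delta> (f \<oplus>\<^sub>T g) r = (\<delta> f \<oplus>\<^sub>T \<delta> g) r"
    using *[of f r] *[of g r] *[of "\<lambda>p. f p + g p" r]
    by (simp add: T_simps(2) distrib_right sum.distrib)
qed

lemma \<delta>_smult:
  assumes "f \<in> carrier T"
  shows "\<delta> (c \<odot>\<^sub>T f) = c \<odot>\<^sub>T \<delta> f"
proof
  fix r
  have "finite {p. f p \<noteq> 0}"
    using assms by (auto simp: T_simps)
  then show "\<delta> (c \<odot>\<^sub>T f) r = (c \<odot>\<^sub>T \<delta> f) r"
    using \<delta>_superset[of "{p. f p \<noteq> 0}" "c \<odot>\<^sub>T f" r] \<delta>_superset[of "{p. f p \<noteq> 0}" f r]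
    by (auto simp: T_simps(4) sum_distrib_left mult.assoc)
qed

lemma \<delta>_path_elt: "\<delta> (path_elt p) = \<delta>_path p"
proof
  fix r
  have "\<delta> (path_elt p) r = (\<Sum>q\<in>{p}. path_elt p q * \<delta>_path q r)"
    by (rule \<delta>_superset) (auto simp: path_elt_def)
  then show "\<delta> (path_elt p) r = \<delta>_path p r"
    by (simp add: path_elt_def)
qed

lemma \<delta>_zero: "\<delta> \<zero>\<^sub>T = \<zero>\<^sub>T"
  by (simp add: \<delta>_def T_simps(3))

lemma \<delta>_deg:
  fixes f :: "'k::field elt"
  assumes "f \<in> deg d"
  shows "\<delta> f \<in> deg (Suc d)"
  using degD(1)[OF assms]
proof (induction rule: path_algebra_induct)
  case zero
  then show ?case
    unfolding \<delta>_zero by (simp add: T_simps(3))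
next
  case (path c p)
  have "path_degree p = d"
    using degD(2)[OF assms path(2)] .
  then have "(\<delta>_path p :: 'k elt) \<in> deg (Suc d)"
    using \<delta>_list_props(2)[of "fst p" "fst (snd p)" "snd (snd p)"] path(1) by simp
  then show ?case
    by (simp add: \<delta>_smult path_elt_carrier[OF path(1)] \<delta>_path_elt deg_smult)
next
  case (add g h)
  then show ?case
    by (simp add: \<delta>_add deg_add)
qed

lemma \<delta>_carrier: 
  fixes f :: "'k::field elt"
  assumes "f \<in> carrier T"
  shows "\<delta> f \<in> carrier T"
  using assms
proof (induction rule: path_algebra_induct)
  case zero
  then show ?case
    unfolding \<delta>_zero by simp
next
  case (path c p)
  then show ?case
    by (simp add: \<delta>_smult path_elt_carrier \<delta>_path_elt T_smult(1) \<delta>_path_carrier)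
next
  case (add g h)
  then show ?case
    by (simp add: \<delta>_add)
qed

text \<open>Both sides are bilinear, so the product rule passes from paths to all elements. Only the degree of
  the left factor enters the sign.\<close>

lemma \<delta>_mult:
  fixes f g :: "'k::field elt"
  assumes f: "f \<in> deg d" and g: "g \<in> carrier T"
  shows "\<delta> (f \<otimes>\<^sub>T g) = \<delta> f \<otimes>\<^sub>T g \<oplus>\<^sub>T (- 1) ^ d \<odot>\<^sub>T (f \<otimes>\<^sub>T \<delta> g)"
  using degD(1)[OF f]
proof (induction rule: path_algebra_induct)
  case zero
  then show ?case
    using g \<delta>_carrier[OF g] by (simp add: \<delta>_zero) (simp add: T_simps)
next
  case (path c p)
  have d: "path_degree p = d"
    using degD(2)[OF f path(2)] .
  have p: "(path_elt p :: 'k elt) \<in> carrier T" "(\<delta>_path p :: 'k elt) \<in> carrier T"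
    using path(1) by (simp_all add: path_elt_carrier \<delta>_path_carrier)
  show ?case
    using g
  proof (induction rule: path_algebra_induct)
    case zero
    then show ?case
      using p by (simp add: \<delta>_zero \<delta>_carrier T_smult) (simp add: T_simps)
  next
    case (path c' q)
    have q: "(path_elt q :: 'k elt) \<in> carrier T" "(\<delta>_path q :: 'k elt) \<in> carrier T"
      using path(1) by (simp_all add: path_elt_carrier \<delta>_path_carrier)
    have "\<delta> (path_elt p \<otimes>\<^sub>T path_elt q) = (if composable p q then \<delta>_path (qcomp p q) else \<zero>\<^sub>T :: 'k elt)"
      unfolding path_elt_mult[OF \<open>p \<in> qpaths Q\<close> path(1)] by (simp add: \<delta>_path_elt \<delta>_zero)
    also have "\<dots> = \<delta>_path p \<otimes>\<^sub>T path_elt q \<oplus>\<^sub>T (- 1) ^ d \<odot>\<^sub>T (path_elt p \<otimes>\<^sub>T \<delta>_path q)"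
      unfolding \<delta>_path_mult[OF \<open>p \<in> qpaths Q\<close> path(1)] d ..
    finally have eq: "\<delta> (path_elt p \<otimes>\<^sub>T path_elt q) =
      (\<delta>_path p \<otimes>\<^sub>T path_elt q \<oplus>\<^sub>T (- 1) ^ d \<odot>\<^sub>T (path_elt p \<otimes>\<^sub>T \<delta>_path q) :: 'k elt)" .
    show ?case
      using p q by (simp add: T_smult \<delta>_smult eq \<delta>_path_elt flip: T_smult(4)) (simp add: ac_simps)
  next
    case (add g h)
    let ?p = "c \<odot>\<^sub>T path_elt p :: 'k elt"
    have c: "?p \<in> carrier T" "\<delta> ?p \<in> carrier T" "\<delta> g \<in> carrier T" "\<delta> h \<in> carrier T"
      using p add by (auto intro: \<delta>_carrier T_smult(1))
    show ?case
      using add c by (simp add: \<delta>_add T.r_distr T_smult) (simp add: T.a_ac T_smult)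
  qed
next
  case (add f h)
  then show ?case
    using g \<delta>_carrier[OF g] by (simp add: \<delta>_add T.l_distr T_smult \<delta>_carrier) (simp add: T.a_ac T_smult \<delta>_carrier)
qed

lemma \<delta>_arrow_elt:
  assumes "a \<in> arcs Q"
  shows "\<delta> (arrow_elt a) = \<delta>_arrow a"
proof -
  have h: "(head Q a, [], head Q a) \<in> qpaths Q"
    using assms by (simp add: mem_qpaths awalk_Nil_iff del: quiver_simps)
  have c: "(\<delta>_arrow a :: 'a elt) \<in> carrier T"
    using \<delta>_arrow_props(1)[OF assms] by (auto simp: between_def)
  have "\<delta> (arrow_elt a) = (\<lambda>r. 0) \<otimes>\<^sub>T arrow_elt a \<oplus>\<^sub>T 1 \<odot>\<^sub>T (path_elt (head Q a, [], head Q a) \<otimes>\<^sub>T \<delta>_arrow a :: 'a elt)"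
    by (simp add: \<delta>_path_elt)
  also have "(\<lambda>r. 0) \<otimes>\<^sub>T arrow_elt a = (\<zero>\<^sub>T :: 'a elt)"
    by (auto simp: path_algebra_mult T_simps(3))
  also have "path_elt (head Q a, [], head Q a) \<otimes>\<^sub>T \<delta>_arrow a = (\<delta>_arrow a :: 'a elt)"
    by (rule between_mult_idem(2)[OF \<delta>_arrow_props(1)[OF assms]])
  finally show ?thesis
    using c by (simp add: T_smult)
qed

lemma finite_strict_left: "finite {h. h \<prec>\<^sub>P i}"
  using finite_strict by (rule finite_surj[of _ _ fst]) force

lemma sum_path_elt:
  assumes "finite S" and "inj_on \<phi> S"
  shows "(\<Sum>s\<in>S. path_elt (\<phi> s) r) = (if r \<in> \<phi> ` S then 1 else 0 :: 'k::field)"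
proof (cases "r \<in> \<phi> ` S")
  case True
  then obtain s where s: "s \<in> S" "r = \<phi> s"
    by auto
  have "(\<Sum>t\<in>S. path_elt (\<phi> t) r :: 'k) = (\<Sum>t\<in>S. if t = s then 1 else 0)"
    using assms(2) s by (intro sum.cong) (auto simp: path_elt_def dest: inj_onD)
  then show ?thesis
    using True s assms(1) by simp
next
  case False
  then show ?thesis
    by (auto simp: path_elt_def intro!: sum.neutral)
qed

lemma \<delta>_alpha:
  assumes i: "i \<in> {1..n}"
  shows "\<delta> (alpha i :: 'k::field elt) = \<ominus>\<^bsub>T\<^esub> finsum T (\<lambda>h. alpha h \<otimes>\<^sub>T vee h i) {h. h \<prec>\<^sub>P i}"
proof -
  let ?S = "{h. h \<prec>\<^sub>P i}"
  have prod: "alpha h \<otimes>\<^sub>T vee h i = (path_elt (\<alpha>v_path h i) :: 'k elt)" if "h \<in> ?S" for h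
    unfolding alpha_def vee_def using that strictD
    by (subst path_elt_mult) (auto simp: path_mem composable_def qcomp_def)
  have c: "(\<lambda>h. alpha h \<otimes>\<^sub>T vee h i :: 'k elt) \<in> ?S \<rightarrow> carrier T"
  proof (rule Pi_I)
    fix h
    assume "h \<in> ?S"
    then show "(alpha h \<otimes>\<^sub>T vee h i :: 'k elt) \<in> carrier T"
      unfolding prod[OF \<open>h \<in> ?S\<close>] by (intro path_elt_carrier) (simp add: path_mem del: Diff_iff)
  qed
  have "finsum T (\<lambda>h. alpha h \<otimes>\<^sub>T vee h i :: 'k elt) ?S r = (if r \<in> (\<lambda>h. \<alpha>v_path h i) ` ?S then 1 else 0)" for r
  proof -
    have "finsum T (\<lambda>h. alpha h \<otimes>\<^sub>T vee h i :: 'k elt) ?S r = (\<Sum>h\<in>?S. path_elt (\<alpha>v_path h i) r)"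
      unfolding finsum_T_apply[OF finite_strict_left c] using prod by (intro sum.cong) auto
    then show ?thesis
      by (subst (asm) sum_path_elt) (auto simp: finite_strict_left inj_on_def simp del: Diff_iff)
  qed
  moreover have "\<delta> (alpha i :: 'k elt) = \<delta>_arrow (Alpha i)"
    using \<delta>_arrow_elt[of "Alpha i"] i by (simp add: alpha_def)
  moreover have "finsum T (\<lambda>h. alpha h \<otimes>\<^sub>T vee h i :: 'k elt) ?S \<in> carrier T"
    using c by (rule T.finsum_closed)
  ultimately show ?thesis
    by (auto simp: fun_eq_iff a_inv_T_apply \<delta>_arrow_def image_iff simp del: Diff_iff)
qed

lemma \<delta>_vee:
  assumes ij: "i \<prec>\<^sub>P j"
  shows "\<delta> (vee i j :: 'k::field elt) =
    finsum T (\<lambda>k. vee i k \<otimes>\<^sub>T vee k j) {k. i \<prec>\<^sub>P k \<and> k \<prec>\<^sub>P j}"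
proof
  fix r
  let ?S = "{k. i \<prec>\<^sub>P k \<and> k \<prec>\<^sub>P j}"
  have fin: "finite ?S"
    using finite_strict_left[of j] by (rule rev_finite_subset) auto
  have prod: "vee i k \<otimes>\<^sub>T vee k j = (path_elt (vv_path i k j) :: 'k elt)" if "k \<in> ?S" for k
    unfolding vee_def using that
    by (subst path_elt_mult) (auto simp: path_mem composable_def qcomp_def simp del: Diff_iff)
  have c: "(\<lambda>k. vee i k \<otimes>\<^sub>T vee k j :: 'k elt) \<in> ?S \<rightarrow> carrier T"
  proof (rule Pi_I)
    fix k
    assume "k \<in> ?S"
    then show "(vee i k \<otimes>\<^sub>T vee k j :: 'k elt) \<in> carrier T"
      unfolding prod[OF \<open>k \<in> ?S\<close>] by (intro path_elt_carrier) (simp add: path_mem del: Diff_iff)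
  qed
  have "finsum T (\<lambda>k. vee i k \<otimes>\<^sub>T vee k j :: 'k elt) ?S r = (\<Sum>k\<in>?S. path_elt (vv_path i k j) r)"
    unfolding finsum_T_apply[OF fin c] using prod by (intro sum.cong) auto
  also have "\<dots> = (if r \<in> (\<lambda>k. vv_path i k j) ` ?S then 1 else 0)"
    using fin by (rule sum_path_elt) (auto simp: inj_on_def)
  also have "\<dots> = \<delta>_arrow (Vee i j) r"
    by (auto simp: \<delta>_arrow_def image_iff simp del: Diff_iff)
  also have "\<dots> = \<delta> (vee i j :: 'k elt) r"
    using \<delta>_arrow_elt[of "Vee i j", where 'a = 'k] ij by (simp add: vee_def del: Diff_iff)
  finally show "\<delta> (vee i j :: 'k elt) r = finsum T (\<lambda>k. vee i k \<otimes>\<^sub>T vee k j) ?S r"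
    by simp
qed

lemma \<delta>_idem: "\<delta> (idem i) = \<zero>\<^sub>T"
  by (simp add: idem_def \<delta>_path_elt T_simps(3))

lemma is_poset_delta_\<delta>: "is_poset_delta n P (restrict (\<delta> :: 'k::field elt \<Rightarrow> 'k elt) (carrier T))"
  unfolding is_poset_delta_def Let_def poset_T_eq
proof (intro conjI ballI allI)
  show "restrict \<delta> (carrier T) \<in> carrier T \<rightarrow>\<^sub>E (carrier T :: 'k elt set)"
    by (auto intro: \<delta>_carrier)
  show "restrict \<delta> (carrier T) ` deg k \<subseteq> (deg (k + 1) :: 'k elt set)" for k
    using \<delta>_deg degD(1) by fastforce
  show "restrict \<delta> (carrier T) (a \<otimes>\<^sub>T b) = (restrict \<delta> (carrier T) a \<otimes>\<^sub>T b) \<oplus>\<^sub>T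
      ((- 1) ^ k \<odot>\<^sub>T (a \<otimes>\<^sub>T restrict \<delta> (carrier T) b))" if "a \<in> deg k" "b \<in> deg l" for k l and a b :: "'k elt"
    using that \<delta>_mult[OF that(1) degD(1)[OF that(2)]] by (simp add: degD)
  show "restrict \<delta> (carrier T) (idem i) = (\<zero>\<^sub>T :: 'k elt)" if "i \<in> {0..n}" for i
  proof -
    have "(idem i :: 'k elt) \<in> carrier T"
      unfolding idem_def using that by (intro path_elt_carrier) (simp add: path_mem)
    then show ?thesis
      by (simp add: \<delta>_idem)
  qed
  show "restrict \<delta> (carrier T) (alpha i :: 'k elt) =
      \<ominus>\<^bsub>T\<^esub> finsum T (\<lambda>h. alpha h \<otimes>\<^sub>T vee h i) {h. h \<prec>\<^sub>P i}" if "i \<in> {1..n}" for i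
  proof -
    have "(alpha i :: 'k elt) \<in> carrier T"
      unfolding alpha_def using that by (intro path_elt_carrier) (simp add: path_mem)
    then show ?thesis
      by (simp add: \<delta>_alpha[OF that])
  qed
  show "case x of (i, j) \<Rightarrow> restrict \<delta> (carrier T) (vee i j :: 'k elt) =
      finsum T (\<lambda>k. vee i k \<otimes>\<^sub>T vee k j) {k. i \<prec>\<^sub>P k \<and> k \<prec>\<^sub>P j}" if "x \<in> strict P" for x
  proof (cases x)
    case (Pair i j)
    then have ij: "i \<prec>\<^sub>P j"
      using that by simp
    then have "(vee i j :: 'k elt) \<in> carrier T"
      unfolding vee_def by (intro path_elt_carrier) (simp add: path_mem del: Diff_iff)
    then show ?thesis
      using \<delta>_vee[OF ij] by (simp add: Pair)
  qed
qed (auto simp: \<delta>_add \<delta>_smult T_smult)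

text \<open>A path is the product of its arrows, so the product rule determines \<open>d\<close> on paths from its values on
  arrows; linearity does the rest.\<close>

lemma poset_delta_unique:
  fixes d :: "'k::field elt \<Rightarrow> 'k elt"
  assumes "is_poset_delta n P d"
  shows "d = restrict \<delta> (carrier T)"
proof -
  have d: "d \<in> carrier T \<rightarrow>\<^sub>E carrier T"
      "\<And>x y. x \<in> carrier T \<Longrightarrow> y \<in> carrier T \<Longrightarrow> d (x \<oplus>\<^sub>T y) = d x \<oplus>\<^sub>T d y"
      "\<And>c x. x \<in> carrier T \<Longrightarrow> d (c \<odot>\<^sub>T x) = c \<odot>\<^sub>T d x"
      "\<And>k l a b. a \<in> deg k \<Longrightarrow> b \<in> deg l \<Longrightarrow>
         d (a \<otimes>\<^sub>T b) = (d a \<otimes>\<^sub>T b) \<oplus>\<^sub>T ((- 1) ^ k \<odot>\<^sub>T (a \<otimes>\<^sub>T d b))"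
      "\<And>i. i \<in> {0..n} \<Longrightarrow> d (idem i) = \<zero>\<^sub>T"
      "\<And>i. i \<in> {1..n} \<Longrightarrow> d (alpha i) = \<ominus>\<^bsub>T\<^esub> finsum T (\<lambda>h. alpha h \<otimes>\<^sub>T vee h i) {h. h \<prec>\<^sub>P i}"
      "\<And>i j. i \<prec>\<^sub>P j \<Longrightarrow> d (vee i j) =
         finsum T (\<lambda>k. vee i k \<otimes>\<^sub>T vee k j) {k. i \<prec>\<^sub>P k \<and> k \<prec>\<^sub>P j}"
    using assms unfolding is_poset_delta_def Let_def poset_T_eq by blast+
  have arrow: "d (arrow_elt a) = \<delta> (arrow_elt a)" if "a \<in> arcs Q" for a
  proof (cases a)
    case (Alpha i)
    then show ?thesis
      using that d(6)[of i] \<delta>_alpha[of i, where 'k = 'k] by (simp add: alpha_def arrow_Alpha del: quiver_simps(2))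
  next
    case (Vee i j)
    then show ?thesis
      using that d(7)[of i j] \<delta>_vee[of i j, where 'k = 'k] by (simp add: vee_def arrow_Vee del: quiver_simps(2) Diff_iff)
  qed
  have elt: "d (path_elt (u, L, v)) = \<delta> (path_elt (u, L, v))" if "(u, L, v) \<in> qpaths Q" for u L v
    using that
  proof (induction L arbitrary: u)
    case Nil
    then show ?case
      using d(5)[of u] \<delta>_idem[of u, where 'a = 'k] by (simp add: mem_qpaths awalk_Nil idem_def)
  next
    case (Cons a L)
    then have a: "a \<in> arcs Q" "u = tail Q a" and L: "(head Q a, L, v) \<in> qpaths Q"
      by (auto simp: mem_qpaths awalk_Cons)
    have eq: "path_elt (u, a # L, v) = (path_elt (head Q a, L, v) \<otimes>\<^sub>T arrow_elt a :: 'k elt)"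
      unfolding a(2) path_elt_comp[OF arrow_elt_path[OF a(1)] L] by simp
    show ?case
      unfolding eq \<delta>_mult[OF path_elt_deg[OF L] arrow_elt_props(1)[OF a(1)]]
        d(4)[OF path_elt_deg[OF L] arrow_elt_props(3)[OF a(1)]]
      using Cons.IH[OF L] arrow[OF a(1)] by simp
  qed
  have "d f = \<delta> f" if "f \<in> carrier T" for f
    using that
  proof (induction rule: path_algebra_induct)
    case zero
    have "\<zero>\<^sub>T = 0 \<odot>\<^sub>T (\<zero>\<^sub>T :: 'k elt)"
      by (simp add: T_simps)
    then have "d \<zero>\<^sub>T = \<zero>\<^sub>T"
      using d(3)[OF T.zero_closed, of 0] by (simp add: T_simps(3,4))
    then show ?case
      by (simp add: \<delta>_zero)
  next
    case (path c p)
    then show ?case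
      using elt[of "fst p" "fst (snd p)" "snd (snd p)"] d(3)[OF path_elt_carrier[OF path(1)]]
      by (simp add: \<delta>_smult path_elt_carrier)
  next
    case (add g h)
    then show ?case
      by (simp add: d(2) \<delta>_add)
  qed
  then show ?thesis
    using d(1) by (auto simp: fun_eq_iff PiE_def extensional_def restrict_def)
qed

lemma poset_delta_eq: "poset_delta n P = restrict \<delta> (carrier T)"
  unfolding poset_delta_def by (rule the_equality) (rule is_poset_delta_\<delta>, rule poset_delta_unique)

lemma \<delta>_path_values:
  "i \<in> {1..n} \<Longrightarrow> \<delta>_path (\<alpha>_path i) = \<delta>_arrow (Alpha i)"
  "i \<prec>\<^sub>P j \<Longrightarrow> \<delta>_path (v_path i j) = \<delta>_arrow (Vee i j)"
  using \<delta>_arrow_elt[of "Alpha i"] \<delta>_arrow_elt[of "Vee i j"]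
  by (simp_all add: \<delta>_path_elt del: \<delta>_list.simps Diff_iff)

lemma \<delta>_path_\<alpha>v:
  assumes "i \<prec>\<^sub>P j"
  shows "\<delta>_path (\<alpha>v_path i j) = (\<delta>_arrow (Alpha i) \<otimes>\<^sub>T path_elt (v_path i j) :: 'k::field elt) \<oplus>\<^sub>T
    path_elt (\<alpha>_path i) \<otimes>\<^sub>T \<delta>_arrow (Vee i j)"
proof -
  have q: "v_path i j \<in> qpaths Q" "\<alpha>_path i \<in> qpaths Q" and i: "i \<in> {1..n}"
    using assms strictD[OF assms] by (auto simp: path_mem simp del: Diff_iff)
  have "\<delta>_list ([Vee i j] @ [Alpha i]) 0 = (\<delta>_path (\<alpha>_path i) \<otimes>\<^sub>T path_elt (v_path i j) :: 'k elt) \<oplus>\<^sub>T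
      1 \<odot>\<^sub>T (path_elt (\<alpha>_path i) \<otimes>\<^sub>T \<delta>_path (v_path i j))"
    using \<delta>_list_append[OF q] by (simp del: \<delta>_list.simps)
  then show ?thesis
    unfolding \<delta>_path_values(1)[OF i] \<delta>_path_values(2)[OF assms] by (simp add: T_simps(4) del: \<delta>_list.simps)
qed

lemma \<delta>_at_v:
  assumes a: "a \<in> deg 0"
  shows "\<delta> a (v_path i j) = 0"
proof -
  have "\<delta>_path p (v_path i j) = 0" if "a p \<noteq> 0" for p
    using support[OF degD(1)[OF a] that] degD(2)[OF a that]
  proof (cases rule: degree_0_cases)
    case (2 k)
    then show ?thesis
      unfolding 2(2) \<delta>_path_values(1)[OF 2(1)] by (simp add: \<delta>_arrow_def)
  qed simp
  then show ?thesis
    unfolding \<delta>_def by (intro sum.neutral) auto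
qed

text \<open>The only path of degree \<open>0\<close> whose differential involves \<open>\<alpha>\<^sub>h v\<^sub>h\<^sub>i\<close> is \<open>\<alpha>\<^sub>i\<close>.\<close>

lemma \<delta>_at_\<alpha>v:
  assumes a: "a \<in> deg 0" and hi: "h \<prec>\<^sub>P i"
  shows "\<delta> a (\<alpha>v_path h i) = - a (\<alpha>_path i)"
proof -
  have "a p * \<delta>_path p (\<alpha>v_path h i) = (if p = \<alpha>_path i then - a p else 0)" if "a p \<noteq> 0" for p
    using support[OF degD(1)[OF a] that] degD(2)[OF a that]
  proof (cases rule: degree_0_cases)
    case (2 k)
    then show ?thesis
      unfolding 2(2) \<delta>_path_values(1)[OF 2(1)] using hi by (auto simp: \<delta>_arrow_def)
  qed simp
  then have "\<delta> a (\<alpha>v_path h i) = (\<Sum>p | a p \<noteq> 0. if p = \<alpha>_path i then - a p else 0)"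
    unfolding \<delta>_def by (intro sum.cong) auto
  also have "\<dots> = - a (\<alpha>_path i)"
    using degD(1)[OF a] by (auto simp: T_simps sum.delta')
  finally show ?thesis .
qed

lemma \<delta>_at_vv:
  assumes v: "v \<in> deg 1" and ik: "i \<prec>\<^sub>P k" and kj: "k \<prec>\<^sub>P j"
  shows "\<delta> v (vv_path i k j) = v (v_path i j)"
proof -
  have "v p * \<delta>_path p (vv_path i k j) = (if p = v_path i j then v p else 0)" if "v p \<noteq> 0" for p
    using support[OF degD(1)[OF v] that] degD(2)[OF v that]
  proof (cases rule: degree_1_cases)
    case (1 i' j')
    then show ?thesis
      unfolding 1(2) \<delta>_path_values(2)[OF 1(1)] using ik kj by (auto simp: \<delta>_arrow_def)
  next
    case (2 i' j')
    then show ?thesis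
      unfolding 2(2) \<delta>_path_\<alpha>v[OF 2(1)] T_simps(2) mult_vv[OF ik kj]
      by (simp add: \<delta>_arrow_def path_elt_def)
  qed
  then have "\<delta> v (vv_path i k j) = (\<Sum>p | v p \<noteq> 0. if p = v_path i j then v p else 0)"
    unfolding \<delta>_def by (intro sum.cong) auto
  also have "\<dots> = v (v_path i j)"
    using degD(1)[OF v] by (auto simp: T_simps sum.delta')
  finally show ?thesis .
qed

text \<open>Two paths contribute to \<open>\<alpha>\<^sub>h v\<^sub>h\<^sub>i v\<^sub>i\<^sub>j\<close>: the product rule gives
  \<open>\<delta>(\<alpha>\<^sub>h v\<^sub>h\<^sub>j) = \<delta>(\<alpha>\<^sub>h) v\<^sub>h\<^sub>j + \<alpha>\<^sub>h \<delta>(v\<^sub>h\<^sub>j)\<close>, whose second summand contains it, and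
  \<open>\<delta>(\<alpha>\<^sub>i v\<^sub>i\<^sub>j) = \<delta>(\<alpha>\<^sub>i) v\<^sub>i\<^sub>j + \<alpha>\<^sub>i \<delta>(v\<^sub>i\<^sub>j)\<close>, whose first summand contains its negative.\<close>

lemma \<delta>_at_\<alpha>vv:
  assumes v: "v \<in> deg 1" and hi: "h \<prec>\<^sub>P i" and ij: "i \<prec>\<^sub>P j"
  shows "\<delta> v (\<alpha>vv_path h i j) = v (\<alpha>v_path h j) - v (\<alpha>v_path i j)"
proof -
  have ne: "h \<noteq> i"
    using hi by auto
  have "v p * \<delta>_path p (\<alpha>vv_path h i j) = (if p = \<alpha>v_path h j then v p else 0) - (if p = \<alpha>v_path i j then v p else 0)"
    if "v p \<noteq> 0" for p
    using support[OF degD(1)[OF v] that] degD(2)[OF v that]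
  proof (cases rule: degree_1_cases)
    case (1 i' j')
    then show ?thesis
      unfolding 1(2) \<delta>_path_values(2)[OF 1(1)] by (auto simp: \<delta>_arrow_def)
  next
    case (2 i' j')
    then show ?thesis
      unfolding 2(2) \<delta>_path_\<alpha>v[OF 2(1)] T_simps(2) mult_\<alpha>vv[OF hi ij]
      using hi ij ne by (auto simp: \<delta>_arrow_def path_elt_def)
  qed
  then have "\<delta> v (\<alpha>vv_path h i j) =
      (\<Sum>p | v p \<noteq> 0. (if p = \<alpha>v_path h j then v p else 0) - (if p = \<alpha>v_path i j then v p else 0))"
    unfolding \<delta>_def by (intro sum.cong) auto
  also have "\<dots> = v (\<alpha>v_path h j) - v (\<alpha>v_path i j)"
    using degD(1)[OF v] by (auto simp: T_simps sum_subtractf sum.delta')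
  finally show ?thesis .
qed

section \<open>The bocs and its comultiplication\<close>

declare One_nat_def [simp del]

abbreviation A :: "('k::field, 'k elt) module" where "A \<equiv> poset_A n P"
abbreviation U :: "('k::field elt, 'k elt \<times> 'k elt) bimodule" where "U \<equiv> poset_U n P"
abbreviation \<omega> :: "'k::field elt \<times> 'k elt" where "\<omega> \<equiv> (\<one>\<^sub>T, \<zero>\<^sub>T)"
abbreviation mult_UU (infixl \<open>\<otimes>\<^sub>U\<close> 70) where "x \<otimes>\<^sub>U y \<equiv> x \<otimes>\<^bsub>poset_UU n P\<^esub> y"
abbreviation R :: "('k::field, 'k elt \<times> 'k elt \<Rightarrow> 'k elt) module" where "R \<equiv> poset_R n P"

lemma A_eq: "A = T\<lparr>carrier := deg 0\<rparr>"
  by (simp add: poset_A_def poset_T_eq)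

lemma A_simps [simp]:
  "carrier A = deg 0" "x \<oplus>\<^bsub>A\<^esub> y = x \<oplus>\<^sub>T y" "x \<otimes>\<^bsub>A\<^esub> y = x \<otimes>\<^sub>T y" "\<zero>\<^bsub>A\<^esub> = \<zero>\<^sub>T" "\<one>\<^bsub>A\<^esub> = \<one>\<^sub>T"
  "c \<odot>\<^bsub>A\<^esub> x = c \<odot>\<^sub>T x"
  by (simp_all add: A_eq)

lemma zero_deg [simp, intro]: "\<zero>\<^sub>T \<in> deg d"
  by (simp add: T_simps(3))

lemma deg_mult_0:
  "a \<in> deg 0 \<Longrightarrow> b \<in> deg 0 \<Longrightarrow> a \<otimes>\<^sub>T b \<in> deg 0"
  "a \<in> deg 0 \<Longrightarrow> v \<in> deg 1 \<Longrightarrow> a \<otimes>\<^sub>T v \<in> deg 1"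
  "v \<in> deg 1 \<Longrightarrow> a \<in> deg 0 \<Longrightarrow> v \<otimes>\<^sub>T a \<in> deg 1"
  using deg_mult[of a 0 b 0] deg_mult[of a 0 v 1] deg_mult[of v 1 a 0] by simp_all

lemma K_algebra_A: "K_algebra (A :: ('k::field, 'k elt) module)"
proof -
  have "K_subalgebra (deg 0) (T :: ('k, 'k elt) module)"
    by (rule K_subalgebraI[OF K_algebra_path_algebra])
      (auto intro: degD(1) one_deg deg_add deg_mult_0 deg_smult)
  then show ?thesis
    by (simp add: K_subalgebra_def A_eq)
qed

sublocale A: ring "A :: ('k::field, 'k elt) module"
  using K_algebra_A by (rule K_algebraD)

lemma U_simps [simp]:
  "carrier U = deg 0 \<times> deg 1"
  "(b, v) \<oplus>\<^bsub>U\<^esub> (b', v') = (b \<oplus>\<^sub>T b', v \<oplus>\<^sub>T v')"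
  "(b, v) \<odot>\<^sub>r\<^bsub>U\<^esub> a = (b \<otimes>\<^sub>T a, v \<otimes>\<^sub>T a)"
  by (simp_all add: poset_U_def Let_def poset_T_eq)

lemma U_act:
  "a \<in> deg 0 \<Longrightarrow> a \<odot>\<^bsub>U\<^esub> (b, v) = (a \<otimes>\<^sub>T b, (\<delta> a \<otimes>\<^sub>T b) \<oplus>\<^sub>T (a \<otimes>\<^sub>T v))"
  by (simp add: poset_U_def Let_def poset_T_eq poset_delta_eq degD)

lemma \<delta>_deg_0: "a \<in> deg 0 \<Longrightarrow> \<delta> a \<in> deg 1" and \<delta>_deg_1: "v \<in> deg 1 \<Longrightarrow> \<delta> v \<in> deg 2"
  using \<delta>_deg[of a 0] \<delta>_deg[of v 1] by (simp_all add: numeral_2_eq_2 One_nat_def)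

lemma mult_zero_T [simp]: "f \<otimes>\<^sub>T \<zero>\<^sub>T = \<zero>\<^sub>T" "\<zero>\<^sub>T \<otimes>\<^sub>T f = \<zero>\<^sub>T"
  by (auto simp: path_algebra_mult T_simps(3) fun_eq_iff)

lemma add_zero_T [simp]: "f \<oplus>\<^sub>T \<zero>\<^sub>T = f" "\<zero>\<^sub>T \<oplus>\<^sub>T f = f"
  by (auto simp: T_simps fun_eq_iff)

lemma U_act_V: "a \<in> deg 0 \<Longrightarrow> a \<odot>\<^bsub>U\<^esub> (\<zero>\<^sub>T, v) = (\<zero>\<^sub>T, a \<otimes>\<^sub>T v)"
  by (simp add: U_act)

lemma tensor_factors_U: "tensor_factors (A :: ('k::field, 'k elt) module) U U"
proof
  fix a :: "'k elt" and x :: "'k elt \<times> 'k elt"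
  assume a: "a \<in> carrier A" and x: "x \<in> carrier U"
  obtain b v where x': "x = (b, v)"
    by (cases x)
  show "a \<odot>\<^bsub>U\<^esub> x \<in> carrier U"
    using a x by (simp add: x' U_act deg_mult_0 deg_add \<delta>_deg_0)
qed (auto intro: deg_add deg_mult_0)

sublocale UU: tensor_factors "A :: ('k::field, 'k elt) module" U U
  by (rule tensor_factors_U)

definition V_paths :: "(nat, arrow) qpath set" where
  "V_paths = {p \<in> qpaths Q. path_degree p = 1}"

lemma V_paths_eq: "V_paths = (\<lambda>(i, j). v_path i j) ` strict P \<union> (\<lambda>(i, j). \<alpha>v_path i j) ` strict P"
proof
  show "V_paths \<subseteq> (\<lambda>(i, j). v_path i j) ` strict P \<union> (\<lambda>(i, j). \<alpha>v_path i j) ` strict P"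
  proof
    fix r
    assume "r \<in> V_paths"
    then have "r \<in> qpaths Q" "path_degree r = 1"
      by (auto simp: V_paths_def)
    then show "r \<in> (\<lambda>(i, j). v_path i j) ` strict P \<union> (\<lambda>(i, j). \<alpha>v_path i j) ` strict P"
      by (cases rule: degree_1_cases) force+
  qed
qed (auto simp: V_paths_def path_mem)

lemma finite_V_paths [simp]: "finite V_paths"
  unfolding V_paths_eq using finite_strict by auto

lemma V_pathsD: "p \<in> V_paths \<Longrightarrow> p \<in> qpaths Q" "p \<in> V_paths \<Longrightarrow> path_degree p = 1"
  by (auto simp: V_paths_def)

lemma path_elt_V: "p \<in> V_paths \<Longrightarrow> path_elt p \<in> deg 1"
  using path_elt_deg[of p] by (simp add: V_paths_def)

lemma V_off: "v \<in> deg 1 \<Longrightarrow> q \<notin> V_paths \<Longrightarrow> v q = 0"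
  unfolding V_paths_def by (blast dest: support degD)

lemma V_restrict: "v \<in> deg 1 \<Longrightarrow> (\<lambda>q. if q \<in> S then v q else 0) \<in> deg 1"
proof (rule degI)
  assume v: "v \<in> deg 1"
  then have "finite {q. v q \<noteq> 0}" "{q. v q \<noteq> 0} \<subseteq> qpaths Q"
    using degD(1)[OF v] by (auto simp: T_simps)
  then show "(\<lambda>q. if q \<in> S then v q else 0) \<in> carrier T"
    by (auto simp: T_simps elim!: rev_finite_subset)
qed (auto dest: degD(2) split: if_splits)

text \<open>The coefficient of \<open>p\<close> in \<open>x\<close> when an element of \<open>T\<^sub>2\<close> is written as a sum of products
  \<open>p \<cdot> w\<close> over the paths \<open>p\<close> of degree one.\<close>

definition left_coeff :: "(nat, arrow) qpath \<Rightarrow> 'k::field elt \<Rightarrow> 'k elt" where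
  "left_coeff p x = (\<lambda>q. if q \<in> V_paths \<and> composable p q then x (qcomp p q) else 0)"

lemma left_coeff_deg: "left_coeff p x \<in> deg 1"
proof (rule degI)
  have "{q. left_coeff p x q \<noteq> 0} \<subseteq> V_paths"
    by (auto simp: left_coeff_def)
  then show "left_coeff p x \<in> carrier T"
    using finite_subset[OF _ finite_V_paths] by (auto simp: T_simps V_paths_def)
qed (auto simp: left_coeff_def V_paths_def split: if_splits)

lemma left_coeff_add: "left_coeff p (x \<oplus>\<^sub>T y) = left_coeff p x \<oplus>\<^sub>T left_coeff p y"
  by (auto simp: left_coeff_def T_simps)

lemma left_coeff_zero: "left_coeff p \<zero>\<^sub>T = \<zero>\<^sub>T"
  by (auto simp: left_coeff_def T_simps)

text \<open>If \<open>p\<close> and \<open>q\<close> have degree one, then \<open>pq\<close> has no other factorization into paths of degree one: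
  an arrow \<open>\<alpha>\<^sub>i\<close> can only stand at the left end.\<close>

lemma left_coeff_mult:
  assumes p: "p \<in> V_paths" and v: "v \<in> deg 1" and w: "w \<in> deg 1"
  shows "left_coeff p (v \<otimes>\<^sub>T w) = (v p \<odot>\<^sub>T idem (fst p)) \<otimes>\<^sub>T w"
proof -
  obtain i k where ik: "i \<prec>\<^sub>P k" and p': "p = v_path i k \<or> p = \<alpha>v_path i k"
    using p by (auto simp: V_paths_eq)
  have k: "k \<in> {1..n}" "fst p = k"
    using strictD[OF ik] p' by auto
  have idem: "v p \<odot>\<^sub>T idem k \<in> deg 0"
    using path_elt_deg[of "e_path k"] k by (auto intro!: deg_smult simp: idem_def path_mem)
  show ?thesis
    unfolding k
  proof (rule deg_1_eqI)
    show "(v p \<odot>\<^sub>T idem k) \<otimes>\<^sub>T w \<in> deg 1"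
      using idem w by (rule deg_mult_0)
    fix k' j
    assume kj: "k' \<prec>\<^sub>P j"
    have "v_path k' j \<in> V_paths" "\<alpha>v_path k' j \<in> V_paths"
      using kj by (auto simp: V_paths_def path_mem)
    moreover have "(v \<otimes>\<^sub>T w) (vv_path i k j) = v (v_path i k) * w (v_path k j)"
      and "(v \<otimes>\<^sub>T w) (\<alpha>vv_path i k j) = v (\<alpha>v_path i k) * w (v_path k j)" if "k' = k"
      using ik kj v w that by (auto simp: mult_vv mult_\<alpha>vv off_degree)
    ultimately show "left_coeff p (v \<otimes>\<^sub>T w) (v_path k' j) = ((v p \<odot>\<^sub>T idem k) \<otimes>\<^sub>T w) (v_path k' j)"
      using p' by (auto simp: left_coeff_def mult_v[OF kj] composable_def qcomp_def T_simps(4) idem_def path_elt_def)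
    show "left_coeff p (v \<otimes>\<^sub>T w) (\<alpha>v_path k' j) = ((v p \<odot>\<^sub>T idem k) \<otimes>\<^sub>T w) (\<alpha>v_path k' j)"
      using p' k by (auto simp: left_coeff_def mult_\<alpha>v[OF kj] composable_def T_simps(4) idem_def path_elt_def)
  qed (rule left_coeff_deg)
qed

lemma deg_2_eqI:
  assumes "f \<in> deg 2" and "g \<in> deg 2"
    and "\<And>i k j. i \<prec>\<^sub>P k \<Longrightarrow> k \<prec>\<^sub>P j \<Longrightarrow> f (vv_path i k j) = g (vv_path i k j)"
    and "\<And>i k j. i \<prec>\<^sub>P k \<Longrightarrow> k \<prec>\<^sub>P j \<Longrightarrow> f (\<alpha>vv_path i k j) = g (\<alpha>vv_path i k j)"
  shows "f = g"
proof
  fix r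
  show "f r = g r"
  proof (cases "r \<in> qpaths Q \<and> path_degree r = 2")
    case True
    then have "r \<in> qpaths Q" "path_degree r = 2"
      by auto
    then show ?thesis
      by (cases rule: degree_2_cases) (use assms in auto)
  qed (use assms(1,2) in \<open>metis degD(1) off_degree off_support\<close>)
qed

lemma finsum_T_deg:
  fixes F :: "'s \<Rightarrow> 'k::field elt"
  assumes "finite S" and "\<And>s. s \<in> S \<Longrightarrow> F s \<in> deg d"
  shows "finsum T F S \<in> deg d"
  using assms
proof (induction S rule: finite_induct)
  case (insert s S)
  then have "finsum T F (insert s S) = F s \<oplus>\<^sub>T finsum T F S"
    by (intro T.finsum_insert) (auto dest: degD(1))
  then show ?case
    using insert by (auto intro: deg_add)
qed auto

lemma V_paths_mem: "i \<prec>\<^sub>P j \<Longrightarrow> v_path i j \<in> V_paths" "i \<prec>\<^sub>P j \<Longrightarrow> \<alpha>v_path i j \<in> V_paths"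
  by (auto simp: V_paths_def path_mem)

lemma left_coeff_decomposition:
  fixes x :: "'k::field elt"
  assumes x: "x \<in> deg 2"
  shows "x = finsum T (\<lambda>p. path_elt p \<otimes>\<^sub>T left_coeff p x) V_paths"
proof (rule deg_2_eqI)
  have d: "path_elt p \<otimes>\<^sub>T left_coeff p x \<in> deg 2" if "p \<in> V_paths" for p
    using deg_mult[OF path_elt_V[OF that] left_coeff_deg] by (simp add: numeral_2_eq_2)
  then show "finsum T (\<lambda>p. path_elt p \<otimes>\<^sub>T left_coeff p x) V_paths \<in> deg 2"
    by (intro finsum_T_deg) auto
  have coord: "finsum T (\<lambda>p. path_elt p \<otimes>\<^sub>T left_coeff p x) V_paths r =
      (\<Sum>p\<in>V_paths. (path_elt p \<otimes>\<^sub>T left_coeff p x) r)" for r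
    using d by (intro finsum_T_apply) (auto dest: degD(1))
  fix i k j
  assume ik: "i \<prec>\<^sub>P k" and kj: "k \<prec>\<^sub>P j"
  note mem = V_paths_mem[OF ik] V_paths_mem[OF kj]
  have lc: "left_coeff (v_path i k) x (v_path k j) = x (vv_path i k j)"
      "left_coeff (\<alpha>v_path i k) x (v_path k j) = x (\<alpha>vv_path i k j)"
    using mem by (auto simp: left_coeff_def composable_def qcomp_def)
  have "(\<Sum>p\<in>V_paths. (path_elt p \<otimes>\<^sub>T left_coeff p x) (vv_path i k j)) =
      (\<Sum>p\<in>V_paths. if p = v_path i k then x (vv_path i k j) else 0)"
    using lc by (intro sum.cong refl) (auto simp: mult_vv[OF ik kj] path_elt_def off_degree[OF left_coeff_deg] V_paths_def)
  then show "x (vv_path i k j) = finsum T (\<lambda>p. path_elt p \<otimes>\<^sub>T left_coeff p x) V_paths (vv_path i k j)"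
    using mem by (simp add: coord)
  have "(\<Sum>p\<in>V_paths. (path_elt p \<otimes>\<^sub>T left_coeff p x) (\<alpha>vv_path i k j)) =
      (\<Sum>p\<in>V_paths. if p = \<alpha>v_path i k then x (\<alpha>vv_path i k j) else 0)"
    using lc by (intro sum.cong refl) (auto simp: mult_\<alpha>vv[OF ik kj] path_elt_def off_degree[OF left_coeff_deg] V_paths_def)
  then show "x (\<alpha>vv_path i k j) = finsum T (\<lambda>p. path_elt p \<otimes>\<^sub>T left_coeff p x) V_paths (\<alpha>vv_path i k j)"
    using mem by (simp add: coord)
qed (rule x)

abbreviation V_tensor ::
    "'k::field elt \<Rightarrow> 'k elt \<Rightarrow> (('k elt \<times> 'k elt) \<times> ('k elt \<times> 'k elt) \<Rightarrow>\<^sub>0 int) set" where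
  "V_tensor v w \<equiv> poset_tensor n P (\<zero>\<^sub>T, v) (\<zero>\<^sub>T, w)"

text \<open>A formula for the map from \<open>T\<^sub>2\<close> to \<open>U \<otimes> U\<close> that depends on the element \<open>x\<close> only, not on a way to
  write it as a sum of products.\<close>

definition VV :: "'k::field elt \<Rightarrow> (('k elt \<times> 'k elt) \<times> ('k elt \<times> 'k elt) \<Rightarrow>\<^sub>0 int) set" where
  "VV x = finprod (poset_UU n P) (\<lambda>p. V_tensor (path_elt p) (left_coeff p x)) V_paths"

lemma V_tensor_closed: "v \<in> deg 1 \<Longrightarrow> w \<in> deg 1 \<Longrightarrow>
    V_tensor v w \<in> carrier (poset_UU n P)"
  by (rule UU.pure_closed) auto

lemma VV_closed: "VV x \<in> carrier (poset_UU n P)"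
  unfolding VV_def by (auto intro!: UU.TP.finprod_closed V_tensor_closed path_elt_V left_coeff_deg)

lemma VV_add: "VV (x \<oplus>\<^sub>T y) = VV x \<otimes>\<^sub>U VV y"
proof -
  have "VV (x \<oplus>\<^sub>T y) = finprod (poset_UU n P) (\<lambda>p.
      V_tensor (path_elt p) (left_coeff p x) \<otimes>\<^sub>U
      V_tensor (path_elt p) (left_coeff p y)) V_paths"
    unfolding VV_def
  proof (intro UU.TP.finprod_cong' refl)
    fix p
    assume "p \<in> V_paths"
    then show "V_tensor (path_elt p) (left_coeff p (x \<oplus>\<^sub>T y)) =
        V_tensor (path_elt p) (left_coeff p x) \<otimes>\<^sub>U
        V_tensor (path_elt p) (left_coeff p y)"
      using UU.pure_add_right[of "(\<zero>\<^sub>T, path_elt p)" "(\<zero>\<^sub>T, left_coeff p x)" "(\<zero>\<^sub>T, left_coeff p y)"]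
      by (simp add: path_elt_V left_coeff_deg left_coeff_add)
  qed (auto intro!: UU.TP.m_closed V_tensor_closed path_elt_V left_coeff_deg)
  also have "\<dots> = VV x \<otimes>\<^sub>U VV y"
    unfolding VV_def by (intro UU.TP.finprod_multf) (auto intro!: V_tensor_closed path_elt_V left_coeff_deg)
  finally show ?thesis .
qed

lemma VV_zero: "VV \<zero>\<^sub>T = \<one>\<^bsub>poset_UU n P\<^esub>"
  unfolding VV_def left_coeff_zero
  by (intro UU.TP.finprod_one_eqI UU.pure_idem_right) (auto intro: path_elt_V)

text \<open>Expand \<open>v\<close> in the basis of paths. A summand \<open>v\<^sub>p p = p (v\<^sub>p e)\<close>, with \<open>e\<close> the trivial path at the
  start of \<open>p\<close>, gives the tensor \<open>p (v\<^sub>p e) \<otimes> w = p \<otimes> (v\<^sub>p e) w\<close>, and \<open>(v\<^sub>p e) w\<close> is the left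
  coefficient of \<open>p\<close> in \<open>vw\<close>.\<close>

lemma V_tensor_eq_VV:
  fixes v w :: "'k::field elt"
  assumes v: "v \<in> deg 1" and w: "w \<in> deg 1"
  shows "V_tensor v w = VV (v \<otimes>\<^sub>T w)"
proof -
  let ?r = "\<lambda>S q. if q \<in> S then v q else 0"
  have "V_tensor (?r S) w = finprod (poset_UU n P)
      (\<lambda>p. V_tensor (path_elt p) (left_coeff p (v \<otimes>\<^sub>T w))) S"
    if "finite S" "S \<subseteq> V_paths" for S
    using that
  proof (induction S rule: finite_induct)
    case empty
    have "V_tensor \<zero>\<^sub>T w = \<one>\<^bsub>poset_UU n P\<^esub>"
      using w by (intro UU.pure_idem_left) auto
    then show ?case
      by (simp add: T_simps(3))
  next
    case (insert p S)
    have p: "p \<in> V_paths"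
      using insert by auto
    let ?a = "v p \<odot>\<^sub>T idem (fst p) :: 'k elt"
    have "fst p \<in> {0..n}"
      using V_pathsD(1)[OF p] by (cases p) (auto simp: mem_qpaths awalk_def)
    then have a: "?a \<in> deg 0"
      using path_elt_deg[of "e_path (fst p)"] by (auto intro!: deg_smult simp: idem_def path_mem)
    have pe: "(path_elt p :: 'k elt) \<in> between (fst p) (snd (snd p))"
      using between_path_elt[of "fst p" "fst (snd p)" "snd (snd p)"] V_pathsD(1)[OF p] by simp
    have "path_elt p \<otimes>\<^sub>T ?a = v p \<odot>\<^sub>T path_elt p"
      using between_mult_idem(1)[OF pe] path_elt_carrier[of "e_path (fst p)"] \<open>fst p \<in> {0..n}\<close> V_pathsD(1)[OF p]
      by (simp add: T_smult idem_def path_mem path_elt_carrier)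
    then have split: "?r (insert p S) = path_elt p \<otimes>\<^sub>T ?a \<oplus>\<^sub>T ?r S"
      using insert(2) by (auto simp: T_simps path_elt_def)
    have "V_tensor (?r (insert p S)) w =
        poset_tensor n P ((\<zero>\<^sub>T, path_elt p) \<odot>\<^sub>r\<^bsub>U\<^esub> ?a) (\<zero>\<^sub>T, w) \<otimes>\<^sub>U
        V_tensor (?r S) w"
      unfolding split
      using UU.pure_add_left[of "(\<zero>\<^sub>T, path_elt p \<otimes>\<^sub>T ?a)" "(\<zero>\<^sub>T, ?r S)" "(\<zero>\<^sub>T, w)"]
        deg_mult_0(3)[OF path_elt_V[OF p] a] V_restrict[OF v] w by simp
    also have "poset_tensor n P ((\<zero>\<^sub>T, path_elt p) \<odot>\<^sub>r\<^bsub>U\<^esub> ?a) (\<zero>\<^sub>T, w) =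
        poset_tensor n P (\<zero>\<^sub>T, path_elt p) (?a \<odot>\<^bsub>U\<^esub> (\<zero>\<^sub>T, w))"
      using a w path_elt_V[OF p] by (intro UU.pure_balanced) auto
    also have "?a \<odot>\<^bsub>U\<^esub> (\<zero>\<^sub>T, w) = (\<zero>\<^sub>T, left_coeff p (v \<otimes>\<^sub>T w))"
      using a by (simp add: U_act_V left_coeff_mult[OF p v w])
    finally show ?case
      using insert w by (subst UU.TP.finprod_insert)
        (auto intro!: V_tensor_closed path_elt_V left_coeff_deg)
  qed
  from this[of V_paths] have "V_tensor (?r V_paths) w = VV (v \<otimes>\<^sub>T w)"
    by (simp add: VV_def)
  moreover have "?r V_paths = v"
    using V_off[OF v] by auto
  ultimately show ?thesis
    by simp
qed

lemma finprod_V_tensors: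
  fixes v w :: "'s \<Rightarrow> 'k::field elt"
  assumes "finite S" and "v \<in> S \<rightarrow> deg 1" and "w \<in> S \<rightarrow> deg 1"
  shows "finprod (poset_UU n P) (\<lambda>t. V_tensor (v t) (w t)) S = VV (finsum T (\<lambda>t. v t \<otimes>\<^sub>T w t) S)"
  using assms
proof (induction S rule: finite_induct)
  case empty
  then show ?case
    by (simp add: VV_zero)
next
  case (insert s S)
  have "finprod (poset_UU n P) (\<lambda>t. V_tensor (v t) (w t)) (insert s S) =
      VV (v s \<otimes>\<^sub>T w s) \<otimes>\<^sub>U VV (finsum T (\<lambda>t. v t \<otimes>\<^sub>T w t) S)"
    using insert by (subst UU.TP.finprod_insert) (auto simp: V_tensor_eq_VV Pi_iff VV_closed)
  also have "\<dots> = VV (finsum T (\<lambda>t. v t \<otimes>\<^sub>T w t) (insert s S))"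
    using insert unfolding VV_add[symmetric]
    by (subst T.finsum_insert) (auto intro!: T.m_closed dest: degD(1) simp: Pi_iff)
  finally show ?case .
qed

text \<open>Existence in the description of \<^const>\<open>T2_to_UU\<close> comes from the decomposition by left
  coefficients, uniqueness from \<open>finprod_V_tensors\<close>.\<close>

lemma T2_to_UU_eq:
  fixes x :: "'k::field elt"
  assumes x: "x \<in> deg 2"
  shows "T2_to_UU n P x = VV x"
  unfolding T2_to_UU_def Let_def poset_T_eq
proof (rule the_equality, goal_cases)
  case 1
  obtain h where h: "bij_betw h {0..<card V_paths} V_paths"
    using ex_bij_betw_nat_finite[OF finite_V_paths] by blast
  then have h': "bij_betw h {..<card V_paths} V_paths"
    by (simp add: lessThan_atLeast0)
  have img: "h ` {..<card V_paths} = V_paths" and inj: "inj_on h {..<card V_paths}"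
    using h' by (auto simp: bij_betw_def)
  have hV: "h t \<in> V_paths" if "t < card V_paths" for t
    using img that by auto
  have "x = finsum T (\<lambda>p. path_elt p \<otimes>\<^sub>T left_coeff p x) (h ` {..<card V_paths})"
    unfolding img by (rule left_coeff_decomposition[OF x])
  also have "\<dots> = finsum T (\<lambda>t. path_elt (h t) \<otimes>\<^sub>T left_coeff (h t) x) {..<card V_paths}"
    using hV by (intro T.finsum_reindex inj) (auto intro!: T.m_closed degD(1)[OF left_coeff_deg] degD(1)[OF path_elt_V])
  finally have eq: "x = finsum T (\<lambda>t. path_elt (h t) \<otimes>\<^sub>T left_coeff (h t) x) {..<card V_paths}" .
  have "VV x = finprod (poset_UU n P) (\<lambda>p. V_tensor (path_elt p) (left_coeff p x)) (h ` {..<card V_paths})"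
    unfolding img VV_def ..
  also have "\<dots> = finprod (poset_UU n P) (\<lambda>t. V_tensor (path_elt (h t)) (left_coeff (h t) x)) {..<card V_paths}"
    using hV by (intro UU.TP.finprod_reindex inj) (auto intro!: V_tensor_closed path_elt_V left_coeff_deg)
  finally show ?case
    using eq hV
    by (intro exI[of _ "card V_paths"] exI[of _ "\<lambda>t. path_elt (h t)"] exI[of _ "\<lambda>t. left_coeff (h t) x"] conjI)
      (auto intro: path_elt_V left_coeff_deg)
next
  case (2 y)
  then obtain m :: nat and v w where "v \<in> {..<m} \<rightarrow> deg 1" "w \<in> {..<m} \<rightarrow> deg 1"
      "x = finsum T (\<lambda>t. v t \<otimes>\<^sub>T w t) {..<m}"
      "y = finprod (poset_UU n P) (\<lambda>t. V_tensor (v t) (w t)) {..<m}"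
    by blast
  then show ?case
    by (simp add: finprod_V_tensors)
qed

lemma comult_eq:
  assumes "v \<in> deg 1"
  shows "poset_comult n P (b, v) =
    poset_tensor n P \<omega> (b, \<zero>\<^sub>T) \<otimes>\<^sub>U VV (\<delta> v) \<otimes>\<^sub>U
    poset_tensor n P \<omega> (\<zero>\<^sub>T, v) \<otimes>\<^sub>U poset_tensor n P (\<zero>\<^sub>T, v) \<omega>"
  using assms by (simp add: poset_comult_def Let_def poset_T_eq poset_delta_eq degD(1) T2_to_UU_eq \<delta>_deg_1)

section \<open>The right Burt-Butler algebra of the bocs\<close>

lemma R_simps:
  "x \<otimes>\<^bsub>R\<^esub> y = burt_butler_mult A U (poset_comult n P) x y"
  "\<one>\<^bsub>R\<^esub> = restrict fst (deg 0 \<times> deg 1)"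
  "\<zero>\<^bsub>R\<^esub> = (\<lambda>u\<in>deg 0 \<times> deg 1. \<zero>\<^sub>T)"
  "f \<oplus>\<^bsub>R\<^esub> g = (\<lambda>u\<in>deg 0 \<times> deg 1. f u \<oplus>\<^sub>T g u)"
  "c \<odot>\<^bsub>R\<^esub> f = (\<lambda>u\<in>deg 0 \<times> deg 1. c \<odot>\<^sub>T f u)"
  by (simp_all add: poset_R_def right_burt_butler_def poset_counit_def)

lemma R_carrier_iff: "f \<in> carrier R \<longleftrightarrow> f \<in> (deg 0 \<times> deg 1) \<rightarrow>\<^sub>E deg 0 \<and>
    (\<forall>u\<in>deg 0 \<times> deg 1. \<forall>u'\<in>deg 0 \<times> deg 1. f (u \<oplus>\<^bsub>U\<^esub> u') = f u \<oplus>\<^sub>T f u') \<and>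
    (\<forall>a\<in>deg 0. \<forall>u\<in>deg 0 \<times> deg 1. f (a \<odot>\<^bsub>U\<^esub> u) = a \<otimes>\<^sub>T f u)"
  by (simp add: poset_R_def right_burt_butler_def)

lemma R_D:
  assumes "f \<in> carrier R"
  shows "b \<in> deg 0 \<Longrightarrow> v \<in> deg 1 \<Longrightarrow> f (b, v) \<in> deg 0"
    and "b \<in> deg 0 \<Longrightarrow> v \<in> deg 1 \<Longrightarrow> b' \<in> deg 0 \<Longrightarrow> v' \<in> deg 1 \<Longrightarrow>
      f (b \<oplus>\<^sub>T b', v \<oplus>\<^sub>T v') = f (b, v) \<oplus>\<^sub>T f (b', v')"
    and "a \<in> deg 0 \<Longrightarrow> b \<in> deg 0 \<Longrightarrow> v \<in> deg 1 \<Longrightarrow> f (a \<odot>\<^bsub>U\<^esub> (b, v)) = a \<otimes>\<^sub>T f (b, v)"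
  using assms[unfolded R_carrier_iff] by (auto simp flip: U_simps(2) dest: PiE_mem)

text \<open>The definition of the product, evaluated on the four summands of \<open>\<mu>(\<omega>b + v)\<close>.\<close>

lemma R_mult_apply:
  fixes f g :: "'k::field elt \<times> 'k elt \<Rightarrow> 'k elt"
  assumes f: "f \<in> carrier R" and g: "g \<in> carrier R" and b: "b \<in> deg 0" and v: "v \<in> deg 1"
  shows "(f \<otimes>\<^bsub>R\<^esub> g) (b, v) = g (f (b, \<zero>\<^sub>T), \<zero>\<^sub>T) \<oplus>\<^sub>T
    finsum A (\<lambda>p. g (\<zero>\<^sub>T, path_elt p \<otimes>\<^sub>T f (\<zero>\<^sub>T, left_coeff p (\<delta> v)))) V_paths \<oplus>\<^sub>T
    g (f (\<zero>\<^sub>T, v), \<zero>\<^sub>T) \<oplus>\<^sub>T g (\<zero>\<^sub>T, v \<otimes>\<^sub>T f \<omega>)"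
proof -
  have comm: "comm_group (add_monoid (A :: ('k, 'k elt) module))"
    by (rule A.a_comm_group)
  let ?\<beta> = "\<lambda>x y. g (x \<odot>\<^sub>r\<^bsub>U\<^esub> f y)"
  have fy: "f y \<in> deg 0" if "y \<in> carrier U" for y
    using that R_D(1)[OF f] by auto
  have act: "x \<odot>\<^sub>r\<^bsub>U\<^esub> a \<in> carrier U" if "x \<in> carrier U" "a \<in> deg 0" for x a
    using UU.act_closed_left[of x a] that by simp
  obtain h where h: "h \<in> hom (poset_UU n P) (add_monoid (A :: ('k, 'k elt) module))"
    and h_pure: "\<And>x y. x \<in> carrier U \<Longrightarrow> y \<in> carrier U \<Longrightarrow> h (poset_tensor n P x y) = ?\<beta> x y"
  proof (rule UU.tensor_product_universal[OF comm, of ?\<beta>])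
    show "?\<beta> x y \<in> carrier (add_monoid A)" if "x \<in> carrier U" "y \<in> carrier U" for x y
      using act[OF that(1) fy[OF that(2)]] R_D(1)[OF g] by auto
    show "?\<beta> (x \<oplus>\<^bsub>U\<^esub> x') y = ?\<beta> x y \<otimes>\<^bsub>add_monoid A\<^esub> ?\<beta> x' y"
      if x: "x \<in> carrier U" "x' \<in> carrier U" "y \<in> carrier U" for x x' y
    proof -
      obtain b v b' v' where x': "x = (b, v)" "x' = (b', v')"
        by (cases x; cases x')
      show ?thesis
        using x fy[OF x(3)]
        by (simp add: x' T.l_distr degD(1)[of _ 0] degD(1)[of _ 1] deg_mult_0 R_D(2)[OF g])
    qed
    show "?\<beta> x (y \<oplus>\<^bsub>U\<^esub> y') = ?\<beta> x y \<otimes>\<^bsub>add_monoid A\<^esub> ?\<beta> x y'"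
      if x: "x \<in> carrier U" "y \<in> carrier U" "y' \<in> carrier U" for x y y'
    proof -
      obtain b v b1 v1 b2 v2 where x': "x = (b, v)" "y = (b1, v1)" "y' = (b2, v2)"
        by (cases x; cases y; cases y')
      show ?thesis
        using x by (simp add: x' T.r_distr degD(1)[of _ 0] degD(1)[of _ 1] deg_mult_0 R_D(1,2)[OF f] R_D(2)[OF g])
    qed
    show "?\<beta> (x \<odot>\<^sub>r\<^bsub>U\<^esub> a) y = ?\<beta> x (a \<odot>\<^bsub>U\<^esub> y)"
      if x: "x \<in> carrier U" "a \<in> carrier A" "y \<in> carrier U" for x a y
    proof -
      obtain b v b1 v1 where x': "x = (b, v)" "y = (b1, v1)"
        by (cases x; cases y)
      show ?thesis
        using x by (simp add: x' R_D(3)[OF f] R_D(1)[OF f] T.m_assoc degD(1)[of _ 0] degD(1)[of _ 1])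
    qed
  qed blast
  note d = b v \<delta>_deg_1[OF v] one_deg[where 'a = 'k]
  have mem: "\<omega> \<in> carrier (U :: ('k elt, 'k elt \<times> 'k elt) bimodule)" "(b, \<zero>\<^sub>T) \<in> carrier U" "(\<zero>\<^sub>T, v) \<in> carrier U" "(b, v) \<in> carrier U"
    using d by auto
  have pV: "(\<zero>\<^sub>T, path_elt p) \<in> carrier (U :: ('k elt, 'k elt \<times> 'k elt) bimodule)" "(\<zero>\<^sub>T, left_coeff p (\<delta> v)) \<in> carrier U" if "p \<in> V_paths" for p
    using that by (auto intro: path_elt_V left_coeff_deg)
  have "\<one>\<^bsub>poset_UU n P\<^esub> \<otimes>\<^sub>U poset_tensor n P \<omega> (b, \<zero>\<^sub>T) \<in> UU.pure_sums"
    by (rule UU.pure_sums_mult_pure[OF UU.pure_sums_one mem(1,2)])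
  then have "poset_tensor n P \<omega> (b, \<zero>\<^sub>T) \<in> UU.pure_sums"
    using UU.pure_closed[OF mem(1,2)] by simp
  then have "poset_tensor n P \<omega> (b, \<zero>\<^sub>T) \<otimes>\<^sub>U VV (\<delta> v) \<in> UU.pure_sums"
    unfolding VV_def using pV by (intro UU.pure_sums_mult_finprod) auto
  then have sums: "poset_comult n P (b, v) \<in> UU.pure_sums"
    unfolding comult_eq[OF v] by (intro UU.pure_sums_mult_pure mem)
  have "(f \<otimes>\<^bsub>R\<^esub> g) (b, v) = h (poset_comult n P (b, v))"
    unfolding R_simps
    by (rule burt_butler_mult_eq[where g = g and f = f and u = "(b, v)" and \<mu> = "poset_comult n P",
          OF tensor_factors_U A.abelian_group_axioms h h_pure mem(4) sums])
  also have "\<dots> = h (poset_tensor n P \<omega> (b, \<zero>\<^sub>T)) \<oplus>\<^sub>T h (VV (\<delta> v)) \<oplus>\<^sub>T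
      h (poset_tensor n P \<omega> (\<zero>\<^sub>T, v)) \<oplus>\<^sub>T h (poset_tensor n P (\<zero>\<^sub>T, v) \<omega>)"
    unfolding comult_eq[OF v] using mem
    by (simp add: hom_mult[OF h] VV_closed UU.pure_closed UU.TP.m_closed del: U_simps)
  also have "h (poset_tensor n P \<omega> (b, \<zero>\<^sub>T)) = g (f (b, \<zero>\<^sub>T), \<zero>\<^sub>T)"
    unfolding h_pure[OF mem(1,2)] using fy[OF mem(2)] by (simp add: degD(1))
  also have "h (poset_tensor n P \<omega> (\<zero>\<^sub>T, v)) = g (f (\<zero>\<^sub>T, v), \<zero>\<^sub>T)"
    unfolding h_pure[OF mem(1,3)] using fy[OF mem(3)] by (simp add: degD(1))
  also have "h (poset_tensor n P (\<zero>\<^sub>T, v) \<omega>) = g (\<zero>\<^sub>T, v \<otimes>\<^sub>T f \<omega>)"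
    unfolding h_pure[OF mem(3,1)] by simp
  also have "h (VV (\<delta> v)) = finsum A (\<lambda>p. h (V_tensor (path_elt p) (left_coeff p (\<delta> v)))) V_paths"
    unfolding VV_def using pV
    by (intro hom_finprod_finsum[OF UU.comm_group_tensor_product A.abelian_group_axioms h]) auto
  also have "\<dots> = finsum A (\<lambda>p. g (\<zero>\<^sub>T, path_elt p \<otimes>\<^sub>T f (\<zero>\<^sub>T, left_coeff p (\<delta> v)))) V_paths"
  proof (intro A.finsum_cong' refl)
    show "(\<lambda>p. g (\<zero>\<^sub>T, path_elt p \<otimes>\<^sub>T f (\<zero>\<^sub>T, left_coeff p (\<delta> v)))) \<in> V_paths \<rightarrow> carrier A"
      by (intro Pi_I) (simp add: R_D(1)[OF f] R_D(1)[OF g] deg_mult_0 path_elt_V left_coeff_deg)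
    show "h (V_tensor (path_elt p) (left_coeff p (\<delta> v))) =
        g (\<zero>\<^sub>T, path_elt p \<otimes>\<^sub>T f (\<zero>\<^sub>T, left_coeff p (\<delta> v)))" if "p \<in> V_paths" for p
      unfolding h_pure[OF pV[OF that]] by simp
  qed
  finally show ?thesis .
qed

section \<open>The isomorphisms with matrix algebras\<close>

text \<open>The element \<open>\<Sum> c i \<cdot> e\<^sub>i + \<Sum> a i \<cdot> \<alpha>\<^sub>i\<close> of \<open>A\<close>.\<close>

definition A_elt :: "(nat \<Rightarrow> 'k) \<Rightarrow> (nat \<Rightarrow> 'k) \<Rightarrow> 'k::field elt" where
  "A_elt c a = (\<lambda>(u, L, w). if L = [] \<and> u = w \<and> u \<in> {0..n} then c u
     else if L = [Alpha u] \<and> w = 0 \<and> u \<in> {1..n} then a u else 0)"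

lemma A_elt_deg: "A_elt c a \<in> deg 0"
proof (rule degI)
  have sub: "{r. A_elt c a r \<noteq> 0} \<subseteq> e_path ` {0..n} \<union> \<alpha>_path ` {1..n}"
    by (auto simp: A_elt_def split: if_splits)
  have "e_path ` {0..n} \<union> \<alpha>_path ` {1..n} \<subseteq> qpaths Q"
    by (auto simp: path_mem)
  then show "A_elt c a \<in> carrier T"
    unfolding T_simps(1) using finite_subset[OF sub] subset_trans[OF sub] by simp
  show "path_degree r = 0" if "A_elt c a r \<noteq> 0" for r
    using sub that by auto
qed

lemma A_elt_simps [simp]:
  "i \<in> {0..n} \<Longrightarrow> A_elt c a (e_path i) = c i"
  "i \<in> {1..n} \<Longrightarrow> A_elt c a (\<alpha>_path i) = a i"
  by (auto simp: A_elt_def)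

lemma one_coords [simp]: "i \<in> {0..n} \<Longrightarrow> \<one>\<^sub>T (e_path i) = 1" "\<one>\<^sub>T (\<alpha>_path i) = 0"
  by (auto simp: T_simps(5))

lemma zero_coords [simp]: "\<zero>\<^sub>T (u, L, w) = 0"
  by (simp add: T_simps(3))

lemma V_coord_zero [simp]:
  assumes "v \<in> deg d" and "(i, j) \<notin> strict P"
  shows "v (v_path i j) = 0" and "v (\<alpha>v_path i j) = 0"
  using off_support[OF degD(1)[OF assms(1)]] assms(2) by (simp_all add: path_mem del: Diff_iff)

lemma sum_from_zero: "(\<Sum>k\<in>{0..n}. \<phi> k) = \<phi> 0 + (\<Sum>k\<in>{1..n}. \<phi> k :: 'k::field)"
  using sum.atLeast_Suc_atMost[of 0 n \<phi>] by (simp add: One_nat_def)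

subsection \<open>Matrices with diagonal upper left block\<close>

abbreviation diagonal_block_algebra :: "('k::field, 'k mat) module" where
  "diagonal_block_algebra \<equiv> (full_mat_algebra (n + 1))\<lparr>carrier := lower_block n (diagonal_mats n)\<rparr>"

definition A_mat :: "'k::field elt \<Rightarrow> 'k mat" where
  "A_mat a = mat_of_entries n (\<lambda>j i. if j = i then a (e_path i) else if j = 0 then a (\<alpha>_path i) else 0)"

lemma A_mat_entry:
  "i \<in> {0..n} \<Longrightarrow> j \<in> {0..n} \<Longrightarrow>
    entry n (A_mat a) j i = (if j = i then a (e_path i) else if j = 0 then a (\<alpha>_path i) else 0)"
  by (simp add: A_mat_def)

lemma A_mat_carrier: "A_mat a \<in> carrier_mat (n + 1) (n + 1)"
  by (simp add: A_mat_def)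

lemma diagonal_block_iff:
  "M \<in> lower_block n (diagonal_mats n) \<longleftrightarrow> M \<in> carrier_mat (n + 1) (n + 1) \<and>
    (\<forall>i\<in>{0..n}. \<forall>j\<in>{0..n}. entry n M j i \<noteq> 0 \<longrightarrow> j = 0 \<or> (i, j) \<in> Id_on {1..n})"
  unfolding diagonal_mats_eq_incidence by (rule lower_block_incidence_iff) auto

lemma A_mat_bij: "bij_betw A_mat (deg 0) (lower_block n (diagonal_mats n) :: 'k::field mat set)"
proof (rule bij_betwI')
  fix a b :: "'k elt"
  assume a: "a \<in> deg 0" and b: "b \<in> deg 0"
  show "A_mat a = A_mat b \<longleftrightarrow> a = b"
  proof
    assume eq: "A_mat a = A_mat b"
    show "a = b"
    proof (rule deg_0_eqI[OF a b])
      show "a (e_path i) = b (e_path i)" if "i \<in> {0..n}" for i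
        using A_mat_entry[of i i a] A_mat_entry[of i i b] that by (simp add: eq)
      show "a (\<alpha>_path i) = b (\<alpha>_path i)" if "i \<in> {1..n}" for i
        using A_mat_entry[of i 0 a] A_mat_entry[of i 0 b] that by (simp add: eq)
    qed
  qed simp
next
  fix a :: "'k elt"
  show "A_mat a \<in> lower_block n (diagonal_mats n)"
    unfolding diagonal_block_iff
  proof (intro conjI ballI impI A_mat_carrier)
    fix i j
    assume "i \<in> {0..n}" "j \<in> {0..n}" "entry n (A_mat a) j i \<noteq> 0"
    then show "j = 0 \<or> (i, j) \<in> Id_on {1..n}"
      by (auto simp: A_mat_entry Id_on_def split: if_splits)
  qed
next
  fix M :: "'k mat"
  assume M: "M \<in> lower_block n (diagonal_mats n)"
  let ?a = "A_elt (\<lambda>i. entry n M i i) (\<lambda>i. entry n M 0 i)"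
  have "M = A_mat ?a"
  proof (rule mat_eqI_entry[OF _ A_mat_carrier])
    show "M \<in> carrier_mat (n + 1) (n + 1)"
      using M unfolding diagonal_block_iff by blast
    fix i j
    assume ij: "i \<in> {0..n}" "j \<in> {0..n}"
    have "entry n M j i = 0" if "j \<noteq> 0" "j \<noteq> i"
    proof -
      have "(i, j) \<notin> Id_on {1..n}"
        using that by auto
      then show ?thesis
        using M that ij unfolding diagonal_block_iff by blast
    qed
    then show "entry n M j i = entry n (A_mat ?a) j i"
      using ij by (auto simp: A_mat_entry)
  qed
  then show "\<exists>a\<in>deg 0. M = A_mat a"
    using A_elt_deg by blast
qed

theorem A_isomorphic:
  "K_algebra_isomorphic (A :: ('k::field, 'k elt) module)
     (diagonal_block_algebra)"
proof (rule K_algebra_transport[OF K_algebra_A, of A_mat])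
  note simps = full_mat_algebra_def module_mat_simps
  fix a b :: "'k elt"
  assume "a \<in> carrier A" and "b \<in> carrier A"
  then have a: "a \<in> deg 0" and b: "b \<in> deg 0"
    by auto
  have "A_mat (a \<oplus>\<^sub>T b) = A_mat a + A_mat b"
    by (rule mat_eqI_entry[OF A_mat_carrier])
      (auto simp: A_mat_carrier entry_add[OF A_mat_carrier] A_mat_entry T_simps(2) intro: A_mat_carrier)
  then show "A_mat (a \<oplus>\<^bsub>A\<^esub> b) =
      A_mat a \<oplus>\<^bsub>diagonal_block_algebra\<^esub> A_mat b"
    by (simp add: simps)
  have "A_mat (a \<otimes>\<^sub>T b) = A_mat a * A_mat b"
  proof (rule mat_eqI_entry[OF A_mat_carrier mult_carrier_mat[OF A_mat_carrier A_mat_carrier]])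
    fix i j
    assume ij: "i \<in> {0..n}" "j \<in> {0..n}"
    have "entry n (A_mat a * A_mat b) j i =
        (\<Sum>k\<in>{0..n}. (if k = j then entry n (A_mat a) j j * entry n (A_mat b) j i else 0) +
          (if k = i then if i = j then 0 else entry n (A_mat a) j i * entry n (A_mat b) i i else 0))"
      unfolding entry_mult[OF A_mat_carrier A_mat_carrier ij]
      using ij by (intro sum.cong refl) (auto simp: A_mat_entry)
    also have "\<dots> = entry n (A_mat a) j j * entry n (A_mat b) j i +
        (if i = j then 0 else entry n (A_mat a) j i * entry n (A_mat b) i i)"
      using ij by (simp add: sum.distrib)
    also have "\<dots> = entry n (A_mat (a \<otimes>\<^sub>T b)) j i"
      using ij by (auto simp: A_mat_entry mult_e mult_\<alpha>)
    finally show "entry n (A_mat (a \<otimes>\<^sub>T b)) j i = entry n (A_mat a * A_mat b) j i" ..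
  qed
  then show "A_mat (a \<otimes>\<^bsub>A\<^esub> b) =
      A_mat a \<otimes>\<^bsub>diagonal_block_algebra\<^esub> A_mat b"
    by (simp add: simps)
  have "A_mat (c \<odot>\<^sub>T a) = c \<cdot>\<^sub>m A_mat a" for c
    by (rule mat_eqI_entry[OF A_mat_carrier smult_carrier_mat[OF A_mat_carrier]])
      (auto simp: entry_smult[OF A_mat_carrier] A_mat_entry T_simps(4))
  then show "A_mat (c \<odot>\<^bsub>A\<^esub> a) = c \<odot>\<^bsub>diagonal_block_algebra\<^esub> A_mat a" for c
    by (simp add: simps)
next
  note simps = full_mat_algebra_def module_mat_simps
  have "A_mat (\<zero>\<^sub>T :: 'k elt) = 0\<^sub>m (n + 1) (n + 1)"
    by (rule mat_eqI_entry[OF A_mat_carrier zero_carrier_mat]) (auto simp: A_mat_entry entry_zero)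
  then show "A_mat \<zero>\<^bsub>A :: ('k, 'k elt) module\<^esub> = \<zero>\<^bsub>diagonal_block_algebra\<^esub>"
    by (simp add: simps)
  have "A_mat (\<one>\<^sub>T :: 'k elt) = 1\<^sub>m (n + 1)"
    by (rule mat_eqI_entry[OF A_mat_carrier one_carrier_mat]) (auto simp: A_mat_entry entry_one)
  then show "A_mat \<one>\<^bsub>A :: ('k, 'k elt) module\<^esub> = \<one>\<^bsub>diagonal_block_algebra\<^esub>"
    by (simp add: simps)
qed (use A_mat_bij in simp)

subsection \<open>Matrices with upper left block in the incidence algebra\<close>

abbreviation incidence_block_algebra :: "('k::field, 'k mat) module" where
  "incidence_block_algebra \<equiv> (full_mat_algebra (n + 1))\<lparr>carrier := lower_block n (incidence_algebra n P)\<rparr>"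

text \<open>The condition on the entries of a matrix, indexed by vertices, that describes the block algebra over
  the incidence algebra.\<close>

definition supported :: "(nat \<Rightarrow> nat \<Rightarrow> 'k::field) \<Rightarrow> bool" where
  "supported e \<longleftrightarrow> (\<forall>i\<in>{0..n}. \<forall>j\<in>{0..n}. e j i \<noteq> 0 \<longrightarrow> j = 0 \<or> (i, j) \<in> P)"

lemma supportedD:
  "supported e \<Longrightarrow> i \<in> {0..n} \<Longrightarrow> j \<in> {0..n} \<Longrightarrow> e j i \<noteq> 0 \<Longrightarrow> j = 0 \<or> (i, j) \<in> P"
  by (simp add: supported_def)

text \<open>The left \<open>A\<close>-linear map with \<open>f(\<omega>) = \<Sum> e i i \<cdot> e\<^sub>i + \<Sum> e 0 i \<cdot> \<alpha>\<^sub>i\<close> and \<open>f(v\<^sub>i\<^sub>j) = e j i \<cdot> e\<^sub>i\<close>.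
  Linearity forces the other values: \<open>f(\<alpha>\<^sub>h v\<^sub>h\<^sub>j) = e j h \<cdot> \<alpha>\<^sub>h\<close>, and
  \<open>\<omega>\<alpha>\<^sub>j = \<alpha>\<^sub>j\<omega> + \<Sum> \<alpha>\<^sub>h v\<^sub>h\<^sub>j\<close>, the sum over \<open>h \<prec> j\<close>, gives \<open>f(\<omega>\<alpha>\<^sub>j) = \<Sum> e j h \<cdot> \<alpha>\<^sub>h\<close> over \<open>h \<preceq> j\<close>. The sums
  may run over \<open>{1..n}\<close>, since coefficients at missing paths vanish and, for the matrices of interest,
  \<open>e j h = 0\<close> unless \<open>h \<preceq> j\<close>.\<close>

definition bb_map :: "(nat \<Rightarrow> nat \<Rightarrow> 'k) \<Rightarrow> 'k elt \<times> 'k elt \<Rightarrow> 'k::field elt" where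
  "bb_map e = (\<lambda>(b, v)\<in>deg 0 \<times> deg 1. A_elt
     (\<lambda>i. b (e_path i) * e i i + (\<Sum>j\<in>{1..n}. v (v_path i j) * e j i))
     (\<lambda>h. b (e_path 0) * e 0 h + (\<Sum>j\<in>{1..n}. (b (\<alpha>_path j) + v (\<alpha>v_path h j)) * e j h)))"

lemma bb_map_deg: "b \<in> deg 0 \<Longrightarrow> v \<in> deg 1 \<Longrightarrow> bb_map e (b, v) \<in> deg 0"
  by (simp add: bb_map_def A_elt_deg)

lemma bb_map_coords:
  assumes "b \<in> deg 0" and "v \<in> deg 1"
  shows "i \<in> {0..n} \<Longrightarrow> bb_map e (b, v) (e_path i) = b (e_path i) * e i i + (\<Sum>j\<in>{1..n}. v (v_path i j) * e j i)"
    and "h \<in> {1..n} \<Longrightarrow> bb_map e (b, v) (\<alpha>_path h) =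
      b (e_path 0) * e 0 h + (\<Sum>j\<in>{1..n}. (b (\<alpha>_path j) + v (\<alpha>v_path h j)) * e j h)"
  using assms by (simp_all add: bb_map_def)

text \<open>The component in \<open>V\<close> of \<open>a(\<omega>b + v)\<close>.\<close>

lemma act_coord_v:
  assumes "a \<in> deg 0" and "b \<in> deg 0" and "v \<in> deg 1"
  shows "((\<delta> a \<otimes>\<^sub>T b) \<oplus>\<^sub>T (a \<otimes>\<^sub>T v)) (v_path i j) = a (e_path i) * v (v_path i j)"
proof (cases "i \<prec>\<^sub>P j")
  case True
  then show ?thesis
    using assms \<delta>_deg_0[OF assms(1)] by (simp add: T_simps(2) mult_v \<delta>_at_v off_degree)
next
  case False
  then show ?thesis
    using assms V_coord_zero[of "(\<delta> a \<otimes>\<^sub>T b) \<oplus>\<^sub>T (a \<otimes>\<^sub>T v)" 1] V_coord_zero[of v 1]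
    by (simp add: deg_add deg_mult_0 \<delta>_deg_0 del: Diff_iff)
qed

lemma act_coord_\<alpha>v:
  assumes "a \<in> deg 0" and "b \<in> deg 0" and "v \<in> deg 1"
  shows "((\<delta> a \<otimes>\<^sub>T b) \<oplus>\<^sub>T (a \<otimes>\<^sub>T v)) (\<alpha>v_path h j) = (if h \<prec>\<^sub>P j then
     a (e_path 0) * v (\<alpha>v_path h j) + a (\<alpha>_path h) * v (v_path h j) - a (\<alpha>_path j) * b (e_path j) else 0)"
proof (cases "h \<prec>\<^sub>P j")
  case True
  then show ?thesis
    using assms \<delta>_deg_0[OF assms(1)] by (simp add: T_simps(2) mult_\<alpha>v \<delta>_at_\<alpha>v off_degree)
next
  case False
  then show ?thesis
    using assms V_coord_zero[of "(\<delta> a \<otimes>\<^sub>T b) \<oplus>\<^sub>T (a \<otimes>\<^sub>T v)" 1] V_coord_zero[of v 1]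
    by (simp add: deg_add deg_mult_0 \<delta>_deg_0 del: Diff_iff)
qed

text \<open>Left linearity at \<open>\<alpha>\<^sub>h\<close> is the delicate point. For \<open>h \<prec> j\<close> the unwanted summand
  \<open>a(\<alpha>\<^sub>j) b(e\<^sub>j)\<close> of \<open>(ab)(\<alpha>\<^sub>j)\<close> cancels against the coefficient of \<open>\<alpha>\<^sub>h v\<^sub>h\<^sub>j\<close> in \<open>\<delta>(a)b\<close>; it
  survives for \<open>j = h\<close>, where it is needed.\<close>

lemma bb_map_carrier:
  fixes e :: "nat \<Rightarrow> nat \<Rightarrow> 'k::field"
  assumes e: "supported e"
  shows "bb_map e \<in> carrier R"
  unfolding R_carrier_iff
proof (intro conjI ballI)
  show "bb_map e \<in> deg 0 \<times> deg 1 \<rightarrow>\<^sub>E deg 0"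
  proof (rule PiE_I)
    fix u :: "'k elt \<times> 'k elt"
    show "u \<in> deg 0 \<times> deg 1 \<Longrightarrow> bb_map e u \<in> deg 0"
      by (cases u) (simp add: bb_map_deg)
    show "u \<notin> deg 0 \<times> deg 1 \<Longrightarrow> bb_map e u = undefined"
      unfolding bb_map_def by (rule restrict_apply[THEN trans]) simp
  qed
next
  fix u u' :: "'k elt \<times> 'k elt"
  assume u: "u \<in> deg 0 \<times> deg 1" "u' \<in> deg 0 \<times> deg 1"
  obtain b v b' v' where uv: "u = (b, v)" "u' = (b', v')"
    by (cases u; cases u')
  have d: "b \<in> deg 0" "v \<in> deg 1" "b' \<in> deg 0" "v' \<in> deg 1" "b \<oplus>\<^sub>T b' \<in> deg 0" "v \<oplus>\<^sub>T v' \<in> deg 1"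
    using u by (auto simp: uv intro: deg_add)
  define c where "c = b \<oplus>\<^sub>T b'"
  define w where "w = v \<oplus>\<^sub>T v'"
  have cw: "c \<in> deg 0" "w \<in> deg 1" "\<And>r. c r = b r + b' r" "\<And>r. w r = v r + v' r"
    using d(5,6) by (auto simp: c_def w_def T_simps(2))
  have "bb_map e (c, w) = bb_map e (b, v) \<oplus>\<^sub>T bb_map e (b', v')"
  proof (rule deg_0_eqI)
    show "bb_map e (b, v) \<oplus>\<^sub>T bb_map e (b', v') \<in> deg 0"
      using d by (intro deg_add bb_map_deg)
  qed (auto simp: bb_map_deg d bb_map_coords cw T_simps(2) distrib_right sum.distrib)
  then show "bb_map e (u \<oplus>\<^bsub>U\<^esub> u') = bb_map e u \<oplus>\<^sub>T bb_map e u'"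
    by (simp add: uv c_def w_def)
next
  fix a :: "'k elt" and u :: "'k elt \<times> 'k elt"
  assume a: "a \<in> deg 0" and u: "u \<in> deg 0 \<times> deg 1"
  obtain b v where uv: "u = (b, v)"
    by (cases u)
  let ?w = "(\<delta> a \<otimes>\<^sub>T b) \<oplus>\<^sub>T (a \<otimes>\<^sub>T v)"
  have b: "b \<in> deg 0" and v: "v \<in> deg 1" and ab: "a \<otimes>\<^sub>T b \<in> deg 0" and w: "?w \<in> deg 1"
    using u a by (simp_all add: uv deg_add deg_mult_0 \<delta>_deg_0)
  have "bb_map e (a \<otimes>\<^sub>T b, ?w) = a \<otimes>\<^sub>T bb_map e (b, v)"
  proof (rule deg_0_eqI)
    fix i
    assume i: "i \<in> {0..n}"
    show "bb_map e (a \<otimes>\<^sub>T b, ?w) (e_path i) = (a \<otimes>\<^sub>T bb_map e (b, v)) (e_path i)"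
      unfolding bb_map_coords(1)[OF ab w i] mult_e[OF i] bb_map_coords(1)[OF b v i] act_coord_v[OF a b v]
      by (simp add: algebra_simps sum_distrib_left)
  next
    fix h
    assume h: "h \<in> {1..n}"
    then have h0: "h \<in> {0..n}" "0 \<in> {0..n}"
      by auto
    have "((a \<otimes>\<^sub>T b) (\<alpha>_path j) + ?w (\<alpha>v_path h j)) * e j h =
        a (e_path 0) * ((b (\<alpha>_path j) + v (\<alpha>v_path h j)) * e j h) + a (\<alpha>_path h) * (v (v_path h j) * e j h)
        + (if j = h then a (\<alpha>_path h) * b (e_path h) * e h h else 0)" if j: "j \<in> {1..n}" for j
    proof (cases "h \<prec>\<^sub>P j")
      case True
      then show ?thesis
        unfolding act_coord_\<alpha>v[OF a b v] mult_\<alpha>[OF j] by (auto simp: algebra_simps)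
    next
      case False
      then have "j = h \<or> e j h = 0"
        using supportedD[OF e, of h j] h j by auto
      then show ?thesis
        using False v unfolding act_coord_\<alpha>v[OF a b v] mult_\<alpha>[OF j] by (auto simp: algebra_simps)
    qed
    then have "bb_map e (a \<otimes>\<^sub>T b, ?w) (\<alpha>_path h) = (a \<otimes>\<^sub>T b) (e_path 0) * e 0 h +
        (\<Sum>j\<in>{1..n}. a (e_path 0) * ((b (\<alpha>_path j) + v (\<alpha>v_path h j)) * e j h) + a (\<alpha>_path h) * (v (v_path h j) * e j h)
        + (if j = h then a (\<alpha>_path h) * b (e_path h) * e h h else 0))"
      unfolding bb_map_coords(2)[OF ab w h] by simp
    also have "\<dots> = (a \<otimes>\<^sub>T bb_map e (b, v)) (\<alpha>_path h)"
      unfolding mult_\<alpha>[OF h] bb_map_coords(2)[OF b v h] bb_map_coords(1)[OF b v h0(1)] mult_e[OF h0(2)]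
      using h by (simp add: sum.distrib sum_distrib_left algebra_simps)
    finally show "bb_map e (a \<otimes>\<^sub>T b, ?w) (\<alpha>_path h) = (a \<otimes>\<^sub>T bb_map e (b, v)) (\<alpha>_path h)" .
  qed (auto intro: bb_map_deg deg_mult_0 a b v ab w)
  then show "bb_map e (a \<odot>\<^bsub>U\<^esub> u) = a \<otimes>\<^sub>T bb_map e u"
    using a by (simp add: uv U_act)
qed

text \<open>As a left \<open>A\<close>-module, \<open>U\<close> is generated by \<open>\<omega>\<close> and the \<open>v\<^sub>i\<^sub>j\<close>: one has
  \<open>\<omega>b = b\<omega> - \<delta>(b)\<close> for \<open>b\<close> in \<open>A\<close>.\<close>

lemma R_eqI:
  fixes f g :: "'k::field elt \<times> 'k elt \<Rightarrow> 'k elt"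
  assumes f: "f \<in> carrier R" and g: "g \<in> carrier R"
    and \<omega>: "f \<omega> = g \<omega>"
    and vee: "\<And>i j. i \<prec>\<^sub>P j \<Longrightarrow> f (\<zero>\<^sub>T, vee i j) = g (\<zero>\<^sub>T, vee i j)"
  shows "f = g"
proof -
  have path: "f (\<zero>\<^sub>T, path_elt p) = g (\<zero>\<^sub>T, path_elt p)" if p: "p \<in> V_paths" for p
  proof -
    obtain i j where ij: "i \<prec>\<^sub>P j" and p': "p = v_path i j \<or> p = \<alpha>v_path i j"
      using p by (auto simp: V_paths_eq)
    have i: "i \<in> {1..n}"
      using strictD[OF ij] by simp
    have vd: "(vee i j :: 'k elt) \<in> deg 1"
      unfolding vee_def using ij by (intro path_elt_V V_paths_mem)
    have ad: "(alpha i :: 'k elt) \<in> deg 0"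
      using path_elt_deg[of "\<alpha>_path i"] i by (simp add: alpha_def path_mem)
    have "path_elt (\<alpha>v_path i j) = (alpha i \<otimes>\<^sub>T vee i j :: 'k elt)"
      unfolding alpha_def vee_def using ij i
      by (subst path_elt_mult) (auto simp: path_mem composable_def qcomp_def)
    then have "(\<zero>\<^sub>T, path_elt (\<alpha>v_path i j)) = alpha i \<odot>\<^bsub>U\<^esub> (\<zero>\<^sub>T, vee i j :: 'k elt)"
      using ad by (simp add: U_act_V)
    then show ?thesis
      using p' vee[OF ij] R_D(3)[OF f ad zero_deg vd] R_D(3)[OF g ad zero_deg vd] by (auto simp: vee_def)
  qed
  have V: "f (\<zero>\<^sub>T, v) = g (\<zero>\<^sub>T, v)" if "v \<in> deg 1" for v
  proof -
    have at_zero: "f (\<zero>\<^sub>T, \<zero>\<^sub>T) = g (\<zero>\<^sub>T, \<zero>\<^sub>T)"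
      using R_D(3)[OF f zero_deg zero_deg zero_deg] R_D(3)[OF g zero_deg zero_deg zero_deg] by (simp add: U_act_V)
    have smult: "f (\<zero>\<^sub>T, c \<odot>\<^sub>T path_elt p) = g (\<zero>\<^sub>T, c \<odot>\<^sub>T path_elt p)" if p: "p \<in> V_paths" for c p
    proof -
      have c: "c \<odot>\<^sub>T \<one>\<^sub>T \<in> deg 0"
        by (intro deg_smult one_deg)
      have "(path_elt p :: 'k elt) \<in> carrier T"
        using path_elt_carrier[OF V_pathsD(1)[OF p]] .
      then have "(\<zero>\<^sub>T, c \<odot>\<^sub>T path_elt p) = (c \<odot>\<^sub>T \<one>\<^sub>T) \<odot>\<^bsub>U\<^esub> (\<zero>\<^sub>T, path_elt p)"
        using c by (simp add: U_act_V T_smult)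
      then show ?thesis
        using R_D(3)[OF f c zero_deg path_elt_V[OF p]] R_D(3)[OF g c zero_deg path_elt_V[OF p]] path[OF p] by simp
    qed
    have "v \<in> deg 1 \<and> f (\<zero>\<^sub>T, v) = g (\<zero>\<^sub>T, v)"
      using degD(1)[OF that]
    proof (induction rule: path_algebra_induct)
      case zero
      then show ?case
        using zero_deg at_zero by (rule conjI)
    next
      case (path c p)
      then have "p \<in> V_paths"
        using degD(2)[OF that] by (auto simp: V_paths_def)
      then show ?case
        using smult by (auto intro: deg_smult path_elt_V)
    next
      case (add v w)
      then show ?case
        using R_D(2)[OF f zero_deg _ zero_deg, of v w] R_D(2)[OF g zero_deg _ zero_deg, of v w]
        by (simp add: deg_add)
    qed
    then show ?thesis
      by simp
  qed
  have "f (b, v) = g (b, v)" if b: "b \<in> deg 0" and v: "v \<in> deg 1" for b v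
  proof -
    \<comment> \<open>This is \<open>\<omega>b + v = b\<omega> + (v - \<delta>(b))\<close>.\<close>
    let ?w = "v \<oplus>\<^sub>T (- 1) \<odot>\<^sub>T \<delta> b"
    have w: "?w \<in> deg 1"
      using b v by (intro deg_add deg_smult \<delta>_deg_0)
    have b\<omega>: "b \<odot>\<^bsub>U\<^esub> \<omega> = (b, \<delta> b)"
      using b by (simp add: U_act degD(1)[of _ 0] degD(1)[OF \<delta>_deg_0])
    have bv: "(b, v) = (b \<oplus>\<^sub>T \<zero>\<^sub>T, \<delta> b \<oplus>\<^sub>T ?w)"
      by (auto simp: T_simps)
    have "f (b, v) = b \<otimes>\<^sub>T f \<omega> \<oplus>\<^sub>T f (\<zero>\<^sub>T, ?w)"
      unfolding bv R_D(2)[OF f b \<delta>_deg_0[OF b] zero_deg w] b\<omega>[symmetric] R_D(3)[OF f b one_deg zero_deg] ..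
    moreover have "g (b, v) = b \<otimes>\<^sub>T g \<omega> \<oplus>\<^sub>T g (\<zero>\<^sub>T, ?w)"
      unfolding bv R_D(2)[OF g b \<delta>_deg_0[OF b] zero_deg w] b\<omega>[symmetric] R_D(3)[OF g b one_deg zero_deg] ..
    ultimately show ?thesis
      using \<omega> V[OF w] by simp
  qed
  moreover have "f u = g u" if "u \<notin> deg 0 \<times> deg 1" for u
    using PiE_arb[OF conjunct1[OF f[unfolded R_carrier_iff]] that]
      PiE_arb[OF conjunct1[OF g[unfolded R_carrier_iff]] that] by simp
  ultimately show ?thesis
    by (intro ext) (metis mem_Sigma_iff prod.collapse)
qed

lemma vee_deg: "i \<prec>\<^sub>P j \<Longrightarrow> vee i j \<in> deg 1"
  unfolding vee_def by (intro path_elt_V V_paths_mem)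

lemma bb_map_generators:
  shows "i \<in> {0..n} \<Longrightarrow> bb_map e \<omega> (e_path i) = e i i"
    and "h \<in> {1..n} \<Longrightarrow> bb_map e \<omega> (\<alpha>_path h) = e 0 h"
    and "i \<prec>\<^sub>P j \<Longrightarrow> k \<in> {0..n} \<Longrightarrow> bb_map e (\<zero>\<^sub>T, vee i j) (e_path k) = (if k = i then e j i else 0)"
    and "i \<prec>\<^sub>P j \<Longrightarrow> h \<in> {1..n} \<Longrightarrow> bb_map e (\<zero>\<^sub>T, vee i j) (\<alpha>_path h) = 0"
proof -
  show "i \<in> {0..n} \<Longrightarrow> bb_map e \<omega> (e_path i) = e i i"
    and "h \<in> {1..n} \<Longrightarrow> bb_map e \<omega> (\<alpha>_path h) = e 0 h"
    by (simp_all add: bb_map_coords[OF one_deg zero_deg])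
  show "bb_map e (\<zero>\<^sub>T, vee i j) (e_path k) = (if k = i then e j i else 0)"
    if ij: "i \<prec>\<^sub>P j" and k: "k \<in> {0..n}"
  proof -
    have "vee i j (v_path k l) * e l k = (if l = j then (if k = i then e j i else 0) else 0)" for l
      by (auto simp: vee_def path_elt_def)
    then have "bb_map e (\<zero>\<^sub>T, vee i j) (e_path k) = (\<Sum>l\<in>{1..n}. if l = j then (if k = i then e j i else 0) else 0)"
      unfolding bb_map_coords(1)[OF zero_deg vee_deg[OF ij] k] by simp
    then show ?thesis
      using strictD[OF ij] by simp
  qed
  show "bb_map e (\<zero>\<^sub>T, vee i j) (\<alpha>_path h) = 0" if ij: "i \<prec>\<^sub>P j" and h: "h \<in> {1..n}"
    unfolding bb_map_coords(2)[OF zero_deg vee_deg[OF ij] h] by (simp add: vee_def path_elt_def)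
qed

lemma incidence_block_iff:
  "M \<in> lower_block n (incidence_algebra n P) \<longleftrightarrow> M \<in> carrier_mat (n + 1) (n + 1) \<and> supported (entry n M)"
  unfolding supported_def by (rule lower_block_incidence_iff[OF poset_subset])

text \<open>A map is recovered from its values on the generators \<open>\<omega>\<close> and \<open>v\<^sub>i\<^sub>j\<close>. For surjectivity,
  \<open>v\<^sub>i\<^sub>j = e\<^sub>i v\<^sub>i\<^sub>j\<close> shows that the value at \<open>v\<^sub>i\<^sub>j\<close> is a multiple of \<open>e\<^sub>i\<close>, so that the matrix loses no
  information.\<close>

lemma bb_map_bij:
  "bij_betw (\<lambda>M. bb_map (entry n M)) (lower_block n (incidence_algebra n P) :: 'k::field mat set) (carrier R)"
proof (rule bij_betwI')
  fix M N :: "'k mat"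
  assume M: "M \<in> lower_block n (incidence_algebra n P)" and N: "N \<in> lower_block n (incidence_algebra n P)"
  show "bb_map (entry n M) = bb_map (entry n N) \<longleftrightarrow> M = N"
  proof
    assume eq: "bb_map (entry n M) = bb_map (entry n N)"
    show "M = N"
    proof (rule mat_eqI_entry)
      fix i j
      assume ij: "i \<in> {0..n}" "j \<in> {0..n}"
      consider "i = j" | "j = 0" "i \<noteq> 0" | "i \<prec>\<^sub>P j" | "j \<noteq> 0" "(i, j) \<notin> P"
        by (metis Diff_iff pair_in_Id_conv)
      then show "entry n M j i = entry n N j i"
      proof cases
        case 1
        then show ?thesis
          using bb_map_generators(1)[OF ij(1), of "entry n M"] bb_map_generators(1)[OF ij(1), of "entry n N"] eq by simp
      next
        case 2
        then have "i \<in> {1..n}"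
          using ij by auto
        then show ?thesis
          using bb_map_generators(2)[of i "entry n M"] bb_map_generators(2)[of i "entry n N"] eq 2 by simp
      next
        case 3
        then show ?thesis
          using bb_map_generators(3)[OF 3 ij(1), of "entry n M"] bb_map_generators(3)[OF 3 ij(1), of "entry n N"] eq by simp
      next
        case 4
        then show ?thesis
          using M N ij unfolding incidence_block_iff supported_def by metis
      qed
    qed (use M N in \<open>auto simp: incidence_block_iff\<close>)
  qed simp
next
  fix M :: "'k mat"
  assume "M \<in> lower_block n (incidence_algebra n P)"
  then show "bb_map (entry n M) \<in> carrier R"
    by (intro bb_map_carrier) (simp add: incidence_block_iff)
next
  fix f :: "'k elt \<times> 'k elt \<Rightarrow> 'k elt"
  assume f: "f \<in> carrier R"
  \<comment> \<open>The matrix entries are read off from the values of \<open>f\<close> on the generators.\<close>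
  define e where "e = (\<lambda>j i. if i = j then f \<omega> (e_path i) else if j = 0 then f \<omega> (\<alpha>_path i)
      else if (i, j) \<in> P then f (\<zero>\<^sub>T, vee i j) (e_path i) else 0)"
  let ?M = "mat_of_entries n e"
  have "(i, i) \<in> P" if "i \<in> {0..n}" "i \<noteq> 0" for i
    using partial_order_onD(1)[OF partial_order] that by (auto simp: refl_on_def)
  then have supp: "supported (entry n ?M)"
    unfolding supported_def by (auto simp: e_def split: if_splits)
  have "f = bb_map (entry n ?M)"
  proof (rule R_eqI[OF f bb_map_carrier[OF supp]])
    show "f \<omega> = bb_map (entry n ?M) \<omega>"
    proof (rule deg_0_eqI[OF R_D(1)[OF f one_deg zero_deg] bb_map_deg[OF one_deg zero_deg]])
      show "f \<omega> (e_path i) = bb_map (entry n ?M) \<omega> (e_path i)" if "i \<in> {0..n}" for i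
        using that by (simp add: bb_map_generators) (simp add: e_def)
      show "f \<omega> (\<alpha>_path i) = bb_map (entry n ?M) \<omega> (\<alpha>_path i)" if "i \<in> {1..n}" for i
        using that by (simp add: bb_map_generators) (simp add: e_def)
    qed
    fix i j
    assume ij: "i \<prec>\<^sub>P j"
    then have ij': "i \<in> {1..n}" "i \<in> {0..n}" "j \<in> {0..n}" "i \<noteq> j" "j \<noteq> 0" "(i, j) \<in> P"
      using strictD[OF ij] by auto
    have id: "(idem i :: 'k elt) \<in> deg 0"
      using path_elt_deg[of "e_path i"] ij' by (simp add: idem_def path_mem)
    have "idem i \<otimes>\<^sub>T vee i j = (vee i j :: 'k elt)"
      unfolding idem_def vee_def using ij ij'
      by (subst path_elt_mult) (auto simp: path_mem composable_def qcomp_def)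
    then have fe: "f (\<zero>\<^sub>T, vee i j) = idem i \<otimes>\<^sub>T f (\<zero>\<^sub>T, vee i j)"
      using R_D(3)[OF f id zero_deg vee_deg[OF ij]] id by (simp add: U_act_V)
    show "f (\<zero>\<^sub>T, vee i j) = bb_map (entry n ?M) (\<zero>\<^sub>T, vee i j)"
    proof (rule deg_0_eqI[OF R_D(1)[OF f zero_deg vee_deg[OF ij]] bb_map_deg[OF zero_deg vee_deg[OF ij]]])
      fix k
      assume k: "k \<in> {0..n}"
      have "f (\<zero>\<^sub>T, vee i j) (e_path k) = (if k = i then f (\<zero>\<^sub>T, vee i j) (e_path i) else 0)"
        by (subst fe) (auto simp: mult_e[OF k] idem_def path_elt_def)
      then show "f (\<zero>\<^sub>T, vee i j) (e_path k) = bb_map (entry n ?M) (\<zero>\<^sub>T, vee i j) (e_path k)"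
        unfolding bb_map_generators(3)[OF ij k] using ij' by (simp add: e_def)
    next
      fix h
      assume h: "h \<in> {1..n}"
      have "f (\<zero>\<^sub>T, vee i j) (\<alpha>_path h) = 0"
        using ij' by (subst fe) (auto simp: mult_\<alpha>[OF h] idem_def path_elt_def)
      then show "f (\<zero>\<^sub>T, vee i j) (\<alpha>_path h) = bb_map (entry n ?M) (\<zero>\<^sub>T, vee i j) (\<alpha>_path h)"
        unfolding bb_map_generators(4)[OF ij h] .
    qed
  qed
  moreover have "?M \<in> lower_block n (incidence_algebra n P)"
    using supp by (simp add: incidence_block_iff)
  ultimately show "\<exists>M\<in>lower_block n (incidence_algebra n P). f = bb_map (entry n M)"
    by blast
qed

lemma sum_V_paths_mult:
  fixes a :: "(nat, arrow) qpath \<Rightarrow> 'k::field elt"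
  assumes a: "\<And>p. p \<in> V_paths \<Longrightarrow> a p \<in> deg 0"
  shows "(\<Sum>p\<in>V_paths. (path_elt p \<otimes>\<^sub>T a p) (v_path i j)) =
      (if i \<prec>\<^sub>P j then a (v_path i j) (e_path j) else 0)"
    and "(\<Sum>p\<in>V_paths. (path_elt p \<otimes>\<^sub>T a p) (\<alpha>v_path i j)) =
      (if i \<prec>\<^sub>P j then a (\<alpha>v_path i j) (e_path j) else 0)"
proof -
  have d: "path_elt p \<otimes>\<^sub>T a p \<in> deg 1" if "p \<in> V_paths" for p
    using that by (intro deg_mult_0 path_elt_V a)
  have "(\<Sum>p\<in>V_paths. (path_elt p \<otimes>\<^sub>T a p) (v_path i j)) =
      (\<Sum>p\<in>V_paths. if p = v_path i j then a p (e_path j) else 0)" if ij: "i \<prec>\<^sub>P j"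
    using off_degree[OF a] by (intro sum.cong refl) (auto simp: mult_v[OF ij] path_elt_def V_paths_def)
  then show "(\<Sum>p\<in>V_paths. (path_elt p \<otimes>\<^sub>T a p) (v_path i j)) =
      (if i \<prec>\<^sub>P j then a (v_path i j) (e_path j) else 0)"
    using V_paths_mem(1)[of i j] V_coord_zero(1)[OF d, of _ i j] by (simp del: Diff_iff)
  have "(\<Sum>p\<in>V_paths. (path_elt p \<otimes>\<^sub>T a p) (\<alpha>v_path i j)) =
      (\<Sum>p\<in>V_paths. if p = \<alpha>v_path i j then a p (e_path j) else 0)" if ij: "i \<prec>\<^sub>P j"
    using off_degree[OF a] by (intro sum.cong refl) (auto simp: mult_\<alpha>v[OF ij] path_elt_def V_paths_def)
  then show "(\<Sum>p\<in>V_paths. (path_elt p \<otimes>\<^sub>T a p) (\<alpha>v_path i j)) =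
      (if i \<prec>\<^sub>P j then a (\<alpha>v_path i j) (e_path j) else 0)"
    using V_paths_mem(2)[of i j] V_coord_zero(2)[OF d, of _ i j] by (simp del: Diff_iff)
qed

lemma left_coeff_\<delta>:
  assumes v: "v \<in> deg 1" and ij: "i \<prec>\<^sub>P j"
  shows "left_coeff (v_path i j) (\<delta> v) (v_path j l) = (if j \<prec>\<^sub>P l then v (v_path i l) else 0)"
    and "left_coeff (\<alpha>v_path i j) (\<delta> v) (v_path j l) =
      (if j \<prec>\<^sub>P l then v (\<alpha>v_path i l) - v (\<alpha>v_path j l) else 0)"
  using \<delta>_at_vv[OF v ij, of l] \<delta>_at_\<alpha>vv[OF v ij, of l]
  by (auto simp: left_coeff_def V_paths_def path_mem composable_def qcomp_def simp del: Diff_iff)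

text \<open>Antisymmetry forces \<open>k = i\<close> in every nonzero summand.\<close>

lemma supported_mult_diag:
  assumes e: "supported e" and e': "supported e'" and i: "i \<in> {0..n}"
  shows "(\<Sum>k\<in>{0..n}. e i k * e' k i) = e i i * e' i i"
proof -
  have "e i k * e' k i = (if k = i then e i i * e' i i else 0)" if k: "k \<in> {0..n}" for k
  proof (cases "e i k = 0 \<or> e' k i = 0")
    case False
    then have "i = 0 \<or> (k, i) \<in> P" "k = 0 \<or> (i, k) \<in> P"
      using supportedD[OF e k i] supportedD[OF e' i k] by auto
    then have "k = i"
      using poset_subset partial_order_onD(3)[OF partial_order] by (auto dest: antisymD)
    then show ?thesis
      by simp
  qed auto
  then have "(\<Sum>k\<in>{0..n}. e i k * e' k i) = (\<Sum>k\<in>{0..n}. if k = i then e i i * e' i i else 0)"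
    by (intro sum.cong) auto
  then show ?thesis
    using i by simp
qed

text \<open>A nonzero summand has \<open>i \<preceq> k \<preceq> j\<close>; the two ends of this interval are separated from its interior
  because they come from different summands of the comultiplication.\<close>

lemma supported_mult_strict:
  assumes e: "supported e" and e': "supported e'" and ij: "i \<prec>\<^sub>P j"
  shows "(\<Sum>k\<in>{0..n}. e j k * e' k i) = e j i * e' i i + e j j * e' j i +
    (\<Sum>k\<in>{1..n}. if i \<prec>\<^sub>P k \<and> k \<prec>\<^sub>P j then e j k * e' k i else 0)"
proof -
  have i: "i \<in> {1..n}" "j \<in> {1..n}" "i \<noteq> j" "i \<in> {0..n}" "j \<in> {0..n}"
    using strictD[OF ij] by auto
  have "(0, j) \<notin> P"
    using poset_subset by auto
  then have e0: "e j 0 = 0"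
    using supportedD[OF e, of 0 j] i by auto
  have "e j k * e' k i = (if k = i then e j i * e' i i else 0) + (if k = j then e j j * e' j i else 0) +
      (if i \<prec>\<^sub>P k \<and> k \<prec>\<^sub>P j then e j k * e' k i else 0)" if k: "k \<in> {1..n}" for k
  proof (cases "e j k = 0 \<or> e' k i = 0")
    case False
    then have "(k, j) \<in> P" "(i, k) \<in> P"
      using supportedD[OF e, of k j] supportedD[OF e', of i k] i k by auto
    then show ?thesis
      using i by auto
  qed auto
  then have "(\<Sum>k\<in>{1..n}. e j k * e' k i) = (\<Sum>k\<in>{1..n}. (if k = i then e j i * e' i i else 0) +
      (if k = j then e j j * e' j i else 0) +
      (if i \<prec>\<^sub>P k \<and> k \<prec>\<^sub>P j then e j k * e' k i else 0))"
    by (intro sum.cong) auto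
  then show ?thesis
    using i by (simp add: sum_from_zero e0 sum.distrib del: Diff_iff)
qed

lemma finsum_A_apply:
  fixes F :: "'s \<Rightarrow> 'k::field elt"
  assumes "finite S" and "\<And>s. s \<in> S \<Longrightarrow> F s \<in> deg 0"
  shows "finsum A F S r = (\<Sum>s\<in>S. F s r)"
  using assms
proof (induction S rule: finite_induct)
  case empty
  then show ?case
    by (simp add: T_simps(3))
next
  case (insert s S)
  then have "finsum A F (insert s S) = F s \<oplus>\<^bsub>A\<^esub> finsum A F S"
    by (intro A.finsum_insert) auto
  then show ?case
    using insert by (simp add: T_simps(2))
qed

text \<open>At \<open>e\<^sub>i\<close> the three summands of \<open>\<mu>(v\<^sub>i\<^sub>l)\<close> contribute the indices strictly between \<open>i\<close> and \<open>l\<close>, the index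
  \<open>i\<close>, and the index \<open>l\<close> to the sum for a matrix product. At \<open>\<alpha>\<^sub>h\<close> the same happens, up to additional
  terms: those coming from the summand \<open>- \<alpha>\<^sub>h v\<^sub>h\<^sub>j v\<^sub>j\<^sub>l\<close> of \<open>\<delta>(\<alpha>\<^sub>j v\<^sub>j\<^sub>l)\<close> cancel against the terms of
  \<open>\<omega> \<otimes> v\<close> with \<open>j \<noteq> h\<close>.\<close>

lemma bb_map_mult:
  fixes e e' :: "nat \<Rightarrow> nat \<Rightarrow> 'k::field"
  assumes e: "supported e" and e': "supported e'" and b: "b \<in> deg 0" and v: "v \<in> deg 1"
  shows "(bb_map e \<otimes>\<^bsub>R\<^esub> bb_map e') (b, v) = bb_map (\<lambda>j i. \<Sum>k\<in>{0..n}. e j k * e' k i) (b, v)"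
proof -
  let ?f = "bb_map e" and ?g = "bb_map e'" and ?I = "{1..n}"
  define a where "a p = ?f (\<zero>\<^sub>T, left_coeff p (\<delta> v))" for p
  define G where "G p = ?g (\<zero>\<^sub>T, path_elt p \<otimes>\<^sub>T a p)" for p
  have a: "a p \<in> deg 0" for p
    unfolding a_def by (intro bb_map_deg zero_deg left_coeff_deg)
  have pa: "path_elt p \<otimes>\<^sub>T a p \<in> deg 1" if "p \<in> V_paths" for p
    using that by (intro deg_mult_0 path_elt_V a)
  have G: "G p \<in> deg 0" if "p \<in> V_paths" for p
    unfolding G_def using that by (intro bb_map_deg zero_deg pa)
  have fb: "?f (b, \<zero>\<^sub>T) \<in> deg 0" and fv: "?f (\<zero>\<^sub>T, v) \<in> deg 0" and f\<omega>: "?f \<omega> \<in> deg 0"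
    by (intro bb_map_deg zero_deg one_deg b v)+
  have vf: "v \<otimes>\<^sub>T ?f \<omega> \<in> deg 1"
    by (intro deg_mult_0 v f\<omega>)
  have prod: "(?f \<otimes>\<^bsub>R\<^esub> ?g) (b, v) r = ?g (?f (b, \<zero>\<^sub>T), \<zero>\<^sub>T) r + (\<Sum>p\<in>V_paths. G p r) +
      ?g (?f (\<zero>\<^sub>T, v), \<zero>\<^sub>T) r + ?g (\<zero>\<^sub>T, v \<otimes>\<^sub>T ?f \<omega>) r" for r
    unfolding R_mult_apply[OF bb_map_carrier[OF e] bb_map_carrier[OF e'] b v] T_simps(2)
      a_def[symmetric] G_def[symmetric] by (simp add: finsum_A_apply G)
  have a_v: "a (v_path i j) (e_path j) = (\<Sum>l\<in>?I. (if j \<prec>\<^sub>P l then v (v_path i l) else 0) * e l j)"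
    and a_\<alpha>v: "a (\<alpha>v_path i j) (e_path j) =
      (\<Sum>l\<in>?I. (if j \<prec>\<^sub>P l then v (\<alpha>v_path i l) - v (\<alpha>v_path j l) else 0) * e l j)"
    if ij: "i \<prec>\<^sub>P j" for i j
  proof -
    have j: "j \<in> {0..n}"
      using strictD[OF ij] by auto
    show "a (v_path i j) (e_path j) = (\<Sum>l\<in>?I. (if j \<prec>\<^sub>P l then v (v_path i l) else 0) * e l j)"
      and "a (\<alpha>v_path i j) (e_path j) =
        (\<Sum>l\<in>?I. (if j \<prec>\<^sub>P l then v (\<alpha>v_path i l) - v (\<alpha>v_path j l) else 0) * e l j)"
      unfolding a_def bb_map_coords(1)[OF zero_deg left_coeff_deg j] left_coeff_\<delta>[OF v ij] by simp_all
  qed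
  have v_f\<omega>: "(v \<otimes>\<^sub>T ?f \<omega>) (v_path i j) = v (v_path i j) * e j j"
    and \<alpha>v_f\<omega>: "(v \<otimes>\<^sub>T ?f \<omega>) (\<alpha>v_path i j) = v (\<alpha>v_path i j) * e j j" for i j
  proof -
    have "(v \<otimes>\<^sub>T ?f \<omega>) (v_path i j) = v (v_path i j) * e j j \<and>
      (v \<otimes>\<^sub>T ?f \<omega>) (\<alpha>v_path i j) = v (\<alpha>v_path i j) * e j j"
    proof (cases "i \<prec>\<^sub>P j")
      case True
      then have "j \<in> {0..n}"
        using strictD[OF True] by auto
      then show ?thesis
        using v by (simp add: mult_v[OF True] mult_\<alpha>v[OF True] off_degree[OF f\<omega>] off_degree[OF v] bb_map_generators)
    next
      case False
      then show ?thesis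
        using V_coord_zero[OF vf False] V_coord_zero[OF v False] by simp
    qed
    then show "(v \<otimes>\<^sub>T ?f \<omega>) (v_path i j) = v (v_path i j) * e j j"
      and "(v \<otimes>\<^sub>T ?f \<omega>) (\<alpha>v_path i j) = v (\<alpha>v_path i j) * e j j"
      by auto
  qed
  show ?thesis
  proof (rule deg_0_eqI)
    have "(?f \<otimes>\<^bsub>R\<^esub> ?g) (b, v) = ?g (?f (b, \<zero>\<^sub>T), \<zero>\<^sub>T) \<oplus>\<^sub>T finsum A G V_paths \<oplus>\<^sub>T
        ?g (?f (\<zero>\<^sub>T, v), \<zero>\<^sub>T) \<oplus>\<^sub>T ?g (\<zero>\<^sub>T, v \<otimes>\<^sub>T ?f \<omega>)"
      unfolding R_mult_apply[OF bb_map_carrier[OF e] bb_map_carrier[OF e'] b v] a_def[symmetric] G_def[symmetric] ..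
    moreover have "finsum A G V_paths \<in> deg 0"
      using A.finsum_closed[of G V_paths] G by auto
    ultimately show "(?f \<otimes>\<^bsub>R\<^esub> ?g) (b, v) \<in> deg 0"
      using fb fv vf by (simp add: deg_add bb_map_deg)
    show "bb_map (\<lambda>j i. \<Sum>k\<in>{0..n}. e j k * e' k i) (b, v) \<in> deg 0"
      by (intro bb_map_deg b v)
  next
    fix i
    assume i: "i \<in> {0..n}"
    have mid: "(\<Sum>p\<in>V_paths. G p (e_path i)) =
        (\<Sum>l\<in>?I. \<Sum>j\<in>?I. if i \<prec>\<^sub>P j \<and> j \<prec>\<^sub>P l then v (v_path i l) * (e l j * e' j i) else 0)"
    proof -
      have "(\<Sum>p\<in>V_paths. G p (e_path i)) =
          (\<Sum>p\<in>V_paths. \<Sum>j\<in>?I. (path_elt p \<otimes>\<^sub>T a p) (v_path i j) * e' j i)"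
        unfolding G_def by (intro sum.cong refl) (simp add: bb_map_coords(1)[OF zero_deg pa i])
      also have "\<dots> = (\<Sum>j\<in>?I. (\<Sum>p\<in>V_paths. (path_elt p \<otimes>\<^sub>T a p) (v_path i j)) * e' j i)"
        unfolding sum_distrib_right by (rule sum.swap)
      also have "\<dots> = (\<Sum>j\<in>?I. \<Sum>l\<in>?I. if i \<prec>\<^sub>P j \<and> j \<prec>\<^sub>P l then v (v_path i l) * (e l j * e' j i) else 0)"
        unfolding sum_V_paths_mult(1)[OF a]
        by (intro sum.cong refl) (auto simp: a_v sum_distrib_right intro!: sum.cong simp del: Diff_iff)
      also have "\<dots> = (\<Sum>l\<in>?I. \<Sum>j\<in>?I. if i \<prec>\<^sub>P j \<and> j \<prec>\<^sub>P l then v (v_path i l) * (e l j * e' j i) else 0)"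
        by (rule sum.swap)
      finally show ?thesis .
    qed
    have term_eq: "v (v_path i l) * (\<Sum>k\<in>{0..n}. e l k * e' k i) =
        (\<Sum>j\<in>?I. if i \<prec>\<^sub>P j \<and> j \<prec>\<^sub>P l then v (v_path i l) * (e l j * e' j i) else 0) +
        v (v_path i l) * e l i * e' i i + v (v_path i l) * e l l * e' l i" for l
    proof (cases "i \<prec>\<^sub>P l")
      case True
      show ?thesis
        unfolding supported_mult_strict[OF e e' True]
        by (simp add: algebra_simps sum_distrib_left if_distrib[of "\<lambda>x. v (v_path i l) * x"] del: Diff_iff cong: if_cong)
    next
      case False
      then show ?thesis
        using V_coord_zero(1)[OF v False] by simp
    qed
    have "bb_map (\<lambda>j i. \<Sum>k\<in>{0..n}. e j k * e' k i) (b, v) (e_path i) =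
        b (e_path i) * (e i i * e' i i) + (\<Sum>l\<in>?I.
          (\<Sum>j\<in>?I. if i \<prec>\<^sub>P j \<and> j \<prec>\<^sub>P l then v (v_path i l) * (e l j * e' j i) else 0) +
          v (v_path i l) * e l i * e' i i + v (v_path i l) * e l l * e' l i)"
      unfolding bb_map_coords(1)[OF b v i] supported_mult_diag[OF e e' i] term_eq ..
    also have "\<dots> = (?f \<otimes>\<^bsub>R\<^esub> ?g) (b, v) (e_path i)"
      unfolding prod mid bb_map_coords(1)[OF fb zero_deg i] bb_map_coords(1)[OF fv zero_deg i]
        bb_map_coords(1)[OF zero_deg vf i] bb_map_coords(1)[OF b zero_deg i] bb_map_coords(1)[OF zero_deg v i] v_f\<omega>
      by (simp add: sum.distrib sum_distrib_right mult.assoc)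
    finally show "(?f \<otimes>\<^bsub>R\<^esub> ?g) (b, v) (e_path i) = bb_map (\<lambda>j i. \<Sum>k\<in>{0..n}. e j k * e' k i) (b, v) (e_path i)" ..
  next
    fix h
    assume h: "h \<in> {1..n}"
    then have h0: "h \<in> {0..n}" "0 \<in> {0..n}"
      by auto
    have mid: "(\<Sum>p\<in>V_paths. G p (\<alpha>_path h)) = (\<Sum>l\<in>?I. \<Sum>j\<in>?I.
        if h \<prec>\<^sub>P j \<and> j \<prec>\<^sub>P l then (v (\<alpha>v_path h l) - v (\<alpha>v_path j l)) * (e l j * e' j h) else 0)"
    proof -
      have "(\<Sum>p\<in>V_paths. G p (\<alpha>_path h)) =
          (\<Sum>p\<in>V_paths. \<Sum>j\<in>?I. (path_elt p \<otimes>\<^sub>T a p) (\<alpha>v_path h j) * e' j h)"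
        unfolding G_def by (intro sum.cong refl) (simp add: bb_map_coords(2)[OF zero_deg pa h])
      also have "\<dots> = (\<Sum>j\<in>?I. (\<Sum>p\<in>V_paths. (path_elt p \<otimes>\<^sub>T a p) (\<alpha>v_path h j)) * e' j h)"
        unfolding sum_distrib_right by (rule sum.swap)
      also have "\<dots> = (\<Sum>j\<in>?I. \<Sum>l\<in>?I. if h \<prec>\<^sub>P j \<and> j \<prec>\<^sub>P l
          then (v (\<alpha>v_path h l) - v (\<alpha>v_path j l)) * (e l j * e' j h) else 0)"
        unfolding sum_V_paths_mult(2)[OF a]
        by (intro sum.cong refl) (auto simp: a_\<alpha>v sum_distrib_right intro!: sum.cong simp del: Diff_iff)
      also have "\<dots> = (\<Sum>l\<in>?I. \<Sum>j\<in>?I. if h \<prec>\<^sub>P j \<and> j \<prec>\<^sub>P l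
          then (v (\<alpha>v_path h l) - v (\<alpha>v_path j l)) * (e l j * e' j h) else 0)"
        by (rule sum.swap)
      finally show ?thesis .
    qed
    \<comment> \<open>The correction terms of the differential cancel every term of \<open>\<omega> \<otimes> v\<close> except those with \<open>j = h\<close>.\<close>
    have cancel: "(if h \<prec>\<^sub>P j \<and> j \<prec>\<^sub>P l then (v (\<alpha>v_path h l) - v (\<alpha>v_path j l)) * (e l j * e' j h) else 0) +
        v (\<alpha>v_path j l) * (e l j * e' j h) =
        (if h \<prec>\<^sub>P j \<and> j \<prec>\<^sub>P l then v (\<alpha>v_path h l) * (e l j * e' j h) else 0) +
        (if j = h then v (\<alpha>v_path h l) * (e l h * e' h h) else 0)" if j: "j \<in> ?I" for j l
    proof (cases "j \<prec>\<^sub>P l \<and> e' j h \<noteq> 0")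
      case True
      then have "j = h \<or> h \<prec>\<^sub>P j"
        using supportedD[OF e', of h j] h j by auto
      then show ?thesis
        using True by (auto simp: algebra_simps)
    next
      case False
      then show ?thesis
        using V_coord_zero(2)[OF v, of j l] by auto
    qed
    have term_eq: "v (\<alpha>v_path h l) * (\<Sum>k\<in>{0..n}. e l k * e' k h) =
        (\<Sum>j\<in>?I. if h \<prec>\<^sub>P j \<and> j \<prec>\<^sub>P l then v (\<alpha>v_path h l) * (e l j * e' j h) else 0) +
        v (\<alpha>v_path h l) * (e l h * e' h h) + v (\<alpha>v_path h l) * e l l * e' l h" for l
    proof (cases "h \<prec>\<^sub>P l")
      case True
      show ?thesis
        unfolding supported_mult_strict[OF e e' True]
        by (simp add: algebra_simps sum_distrib_left if_distrib[of "\<lambda>x. v (\<alpha>v_path h l) * x"] del: Diff_iff cong: if_cong)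
    next
      case False
      then show ?thesis
        using V_coord_zero(2)[OF v False] by simp
    qed
    have v_part: "(\<Sum>l\<in>?I. v (\<alpha>v_path h l) * (\<Sum>k\<in>{0..n}. e l k * e' k h)) = (\<Sum>p\<in>V_paths. G p (\<alpha>_path h)) +
        (\<Sum>l\<in>?I. \<Sum>j\<in>?I. v (\<alpha>v_path j l) * (e l j * e' j h)) + (\<Sum>l\<in>?I. v (\<alpha>v_path h l) * e l l * e' l h)"
    proof -
      have "(\<Sum>p\<in>V_paths. G p (\<alpha>_path h)) + (\<Sum>l\<in>?I. \<Sum>j\<in>?I. v (\<alpha>v_path j l) * (e l j * e' j h)) =
          (\<Sum>l\<in>?I. \<Sum>j\<in>?I. (if h \<prec>\<^sub>P j \<and> j \<prec>\<^sub>P l then v (\<alpha>v_path h l) * (e l j * e' j h) else 0) +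
            (if j = h then v (\<alpha>v_path h l) * (e l h * e' h h) else 0))"
        unfolding mid sum.distrib[symmetric] by (intro sum.cong refl cancel)
      then show ?thesis
        unfolding term_eq using h by (simp add: sum.distrib del: Diff_iff)
    qed
    have b_part: "(\<Sum>l\<in>?I. b (\<alpha>_path l) * (\<Sum>k\<in>{0..n}. e l k * e' k h)) =
        (\<Sum>j\<in>?I. (\<Sum>l\<in>?I. b (\<alpha>_path l) * e l j) * e' j h)"
    proof -
      have "e l 0 = 0" if "l \<in> ?I" for l
      proof -
        have "(0, l) \<notin> P"
          using poset_subset by auto
        then show ?thesis
          using supportedD[OF e, of 0 l] that by auto
      qed
      then have "(\<Sum>l\<in>?I. b (\<alpha>_path l) * (\<Sum>k\<in>{0..n}. e l k * e' k h)) =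
          (\<Sum>l\<in>?I. \<Sum>j\<in>?I. b (\<alpha>_path l) * e l j * e' j h)"
        by (intro sum.cong refl) (simp add: sum_from_zero sum_distrib_left mult.assoc)
      also have "\<dots> = (\<Sum>j\<in>?I. (\<Sum>l\<in>?I. b (\<alpha>_path l) * e l j) * e' j h)"
        unfolding sum_distrib_right by (rule sum.swap)
      finally show ?thesis .
    qed
    have swap: "(\<Sum>j\<in>?I. (\<Sum>l\<in>?I. v (\<alpha>v_path j l) * e l j) * e' j h) =
        (\<Sum>l\<in>?I. \<Sum>j\<in>?I. v (\<alpha>v_path j l) * (e l j * e' j h))"
      unfolding sum_distrib_right mult.assoc by (rule sum.swap)
    have v0: "v (v_path 0 j) = 0" for j
    proof -
      have "(0, j) \<notin> strict P"
        using poset_subset by auto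
      then show ?thesis
        by (rule V_coord_zero(1)[OF v])
    qed
    have f1: "?g (?f (b, \<zero>\<^sub>T), \<zero>\<^sub>T) (\<alpha>_path h) = b (e_path 0) * (\<Sum>k\<in>{0..n}. e 0 k * e' k h) +
        (\<Sum>j\<in>?I. (\<Sum>l\<in>?I. b (\<alpha>_path l) * e l j) * e' j h)"
    proof -
      have "(\<Sum>j\<in>?I. ?f (b, \<zero>\<^sub>T) (\<alpha>_path j) * e' j h) =
          (\<Sum>j\<in>?I. b (e_path 0) * (e 0 j * e' j h) + (\<Sum>l\<in>?I. b (\<alpha>_path l) * e l j) * e' j h)"
        by (intro sum.cong refl) (simp add: bb_map_coords(2)[OF b zero_deg] algebra_simps)
      then show ?thesis
        unfolding bb_map_coords(2)[OF fb zero_deg h] bb_map_coords(1)[OF b zero_deg h0(2)]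
        by (simp add: sum_from_zero sum.distrib sum_distrib_left algebra_simps)
    qed
    have f3: "?g (?f (\<zero>\<^sub>T, v), \<zero>\<^sub>T) (\<alpha>_path h) = (\<Sum>j\<in>?I. (\<Sum>l\<in>?I. v (\<alpha>v_path j l) * e l j) * e' j h)"
      unfolding bb_map_coords(2)[OF fv zero_deg h] bb_map_coords(1)[OF zero_deg v h0(2)]
      by (simp add: v0 bb_map_coords(2)[OF zero_deg v])
    have f4: "?g (\<zero>\<^sub>T, v \<otimes>\<^sub>T ?f \<omega>) (\<alpha>_path h) = (\<Sum>l\<in>?I. v (\<alpha>v_path h l) * e l l * e' l h)"
      unfolding bb_map_coords(2)[OF zero_deg vf h] by (simp add: \<alpha>v_f\<omega>)
    have "bb_map (\<lambda>j i. \<Sum>k\<in>{0..n}. e j k * e' k i) (b, v) (\<alpha>_path h) =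
        b (e_path 0) * (\<Sum>k\<in>{0..n}. e 0 k * e' k h) +
        ((\<Sum>l\<in>?I. b (\<alpha>_path l) * (\<Sum>k\<in>{0..n}. e l k * e' k h)) +
         (\<Sum>l\<in>?I. v (\<alpha>v_path h l) * (\<Sum>k\<in>{0..n}. e l k * e' k h)))"
      unfolding bb_map_coords(2)[OF b v h] distrib_right sum.distrib ..
    then show "(?f \<otimes>\<^bsub>R\<^esub> ?g) (b, v) (\<alpha>_path h) = bb_map (\<lambda>j i. \<Sum>k\<in>{0..n}. e j k * e' k i) (b, v) (\<alpha>_path h)"
      unfolding b_part v_part prod f1 f3 f4 swap by simp
  qed
qed

lemma R_ext:
  assumes "f \<in> extensional (deg 0 \<times> deg 1)" and "g \<in> extensional (deg 0 \<times> deg 1)"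
    and "\<And>b v. b \<in> deg 0 \<Longrightarrow> v \<in> deg 1 \<Longrightarrow> f (b, v) = g (b, v)"
  shows "f = g"
  using assms(1,2) by (rule extensionalityI) (use assms(3) in auto)

lemma bb_map_extensional: "bb_map e \<in> extensional (deg 0 \<times> deg 1)"
  unfolding bb_map_def by simp

lemma R_mult_extensional: "f \<otimes>\<^bsub>R\<^esub> g \<in> extensional (deg 0 \<times> deg 1)"
  by (simp add: R_simps burt_butler_mult_def)

theorem R_isomorphic:
  "K_algebra_isomorphic (incidence_block_algebra)
     (R :: ('k::field, 'k elt \<times> 'k elt \<Rightarrow> 'k elt) module)"
proof (rule K_algebra_transport[of _ "\<lambda>M. bb_map (entry n M)"])
  note simps = full_mat_algebra_def module_mat_simps
  have "K_subalgebra (lower_block n (incidence_algebra n P)) (full_mat_algebra (n + 1) :: ('k, 'k mat) module)"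
    using partial_order_onD(1,2)[OF partial_order]
    by (intro K_subalgebra_lower_block poset_subset) (auto simp: refl_on_def)
  then show "K_algebra (incidence_block_algebra :: ('k, 'k mat) module)"
    by (simp add: K_subalgebra_def)
  fix M N :: "'k mat"
  assume "M \<in> carrier (incidence_block_algebra)"
    and "N \<in> carrier (incidence_block_algebra)"
  then have M: "M \<in> carrier_mat (n + 1) (n + 1)" "supported (entry n M)"
    and N: "N \<in> carrier_mat (n + 1) (n + 1)" "supported (entry n N)"
    by (simp_all add: incidence_block_iff)
  have "bb_map (entry n (M + N)) = bb_map (entry n M) \<oplus>\<^bsub>R\<^esub> bb_map (entry n N)"
  proof (rule R_ext)
    fix b v :: "'k elt"
    assume b: "b \<in> deg 0" and v: "v \<in> deg 1"
    have "bb_map (entry n (M + N)) (b, v) = bb_map (entry n M) (b, v) \<oplus>\<^sub>T bb_map (entry n N) (b, v)"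
    proof (rule deg_0_eqI)
      show "bb_map (entry n M) (b, v) \<oplus>\<^sub>T bb_map (entry n N) (b, v) \<in> deg 0"
        by (intro deg_add bb_map_deg b v)
    qed (auto simp: bb_map_deg b v bb_map_coords entry_add[OF N(1)] T_simps(2) distrib_left sum.distrib)
    then show "bb_map (entry n (M + N)) (b, v) = (bb_map (entry n M) \<oplus>\<^bsub>R\<^esub> bb_map (entry n N)) (b, v)"
      using b v by (simp add: R_simps)
  qed (simp_all add: bb_map_extensional R_simps)
  then show "bb_map (entry n (M \<oplus>\<^bsub>incidence_block_algebra\<^esub> N)) =
      bb_map (entry n M) \<oplus>\<^bsub>R\<^esub> bb_map (entry n N)"
    by (simp add: simps)
  have "bb_map (entry n (M * N)) = bb_map (entry n M) \<otimes>\<^bsub>R\<^esub> bb_map (entry n N)"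
  proof (rule R_ext)
    fix b v :: "'k elt"
    assume b: "b \<in> deg 0" and v: "v \<in> deg 1"
    have "bb_map (entry n (M * N)) (b, v) = bb_map (\<lambda>j i. \<Sum>k\<in>{0..n}. entry n M j k * entry n N k i) (b, v)"
      by (rule deg_0_eqI) (auto simp: bb_map_deg b v bb_map_coords entry_mult[OF M(1) N(1)])
    then show "bb_map (entry n (M * N)) (b, v) = (bb_map (entry n M) \<otimes>\<^bsub>R\<^esub> bb_map (entry n N)) (b, v)"
      unfolding bb_map_mult[OF M(2) N(2) b v] .
  qed (simp_all add: bb_map_extensional R_mult_extensional)
  then show "bb_map (entry n (M \<otimes>\<^bsub>incidence_block_algebra\<^esub> N)) =
      bb_map (entry n M) \<otimes>\<^bsub>R\<^esub> bb_map (entry n N)"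
    by (simp add: simps)
  have "bb_map (entry n (c \<cdot>\<^sub>m M)) = c \<odot>\<^bsub>R\<^esub> bb_map (entry n M)" for c
  proof (rule R_ext)
    fix b v :: "'k elt"
    assume b: "b \<in> deg 0" and v: "v \<in> deg 1"
    have "bb_map (entry n (c \<cdot>\<^sub>m M)) (b, v) = c \<odot>\<^sub>T bb_map (entry n M) (b, v)"
    proof (rule deg_0_eqI)
      show "c \<odot>\<^sub>T bb_map (entry n M) (b, v) \<in> deg 0"
        by (intro deg_smult bb_map_deg b v)
    qed (auto simp: bb_map_deg b v bb_map_coords entry_smult[OF M(1)] T_simps(4) algebra_simps sum_distrib_left)
    then show "bb_map (entry n (c \<cdot>\<^sub>m M)) (b, v) = (c \<odot>\<^bsub>R\<^esub> bb_map (entry n M)) (b, v)"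
      using b v by (simp add: R_simps)
  qed (simp_all add: bb_map_extensional R_simps)
  then show "bb_map (entry n (c \<odot>\<^bsub>incidence_block_algebra\<^esub> M)) =
      c \<odot>\<^bsub>R\<^esub> bb_map (entry n M)" for c
    by (simp add: simps)
next
  note simps = full_mat_algebra_def module_mat_simps
  have "bb_map (entry n (0\<^sub>m (n + 1) (n + 1))) = (\<zero>\<^bsub>R\<^esub> :: 'k elt \<times> 'k elt \<Rightarrow> 'k elt)"
  proof (rule R_ext)
    fix b v :: "'k elt"
    assume b: "b \<in> deg 0" and v: "v \<in> deg 1"
    have "bb_map (entry n (0\<^sub>m (n + 1) (n + 1))) (b, v) = \<zero>\<^sub>T"
      by (rule deg_0_eqI) (auto simp: bb_map_deg b v bb_map_coords entry_zero)
    then show "bb_map (entry n (0\<^sub>m (n + 1) (n + 1))) (b, v) = \<zero>\<^bsub>R\<^esub> (b, v)"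
      using b v by (simp add: R_simps)
  qed (simp_all add: bb_map_extensional R_simps)
  then show "bb_map (entry n \<zero>\<^bsub>incidence_block_algebra\<^esub>) =
      (\<zero>\<^bsub>R\<^esub> :: 'k elt \<times> 'k elt \<Rightarrow> 'k elt)"
    by (simp add: simps)
  have "bb_map (entry n (1\<^sub>m (n + 1))) = (\<one>\<^bsub>R\<^esub> :: 'k elt \<times> 'k elt \<Rightarrow> 'k elt)"
  proof (rule R_ext)
    fix b v :: "'k elt"
    assume b: "b \<in> deg 0" and v: "v \<in> deg 1"
    have "bb_map (entry n (1\<^sub>m (n + 1))) (b, v) = b"
    proof (rule deg_0_eqI)
      fix i
      assume i: "i \<in> {0..n}"
      have "v (v_path i j) * entry n (1\<^sub>m (n + 1)) j i = 0" if "j \<in> {1..n}" for j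
        using i that V_coord_zero(1)[OF v, of i i] by (simp add: entry_one)
      then have "(\<Sum>j\<in>{1..n}. v (v_path i j) * entry n (1\<^sub>m (n + 1)) j i) = 0"
        by (rule sum.neutral[rule_format])
      then show "bb_map (entry n (1\<^sub>m (n + 1))) (b, v) (e_path i) = b (e_path i)"
        unfolding bb_map_coords(1)[OF b v i] using i by (simp only: entry_one) simp
    next
      fix h
      assume h: "h \<in> {1..n}"
      have "(b (\<alpha>_path j) + v (\<alpha>v_path h j)) * entry n (1\<^sub>m (n + 1)) j h = (if j = h then b (\<alpha>_path h) else 0)"
        if "j \<in> {1..n}" for j
        using h that V_coord_zero(2)[OF v, of h h] by (simp add: entry_one)
      then show "bb_map (entry n (1\<^sub>m (n + 1))) (b, v) (\<alpha>_path h) = b (\<alpha>_path h)"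
        unfolding bb_map_coords(2)[OF b v h] using h by (simp add: entry_one)
    qed (auto simp: b v bb_map_deg)
    then show "bb_map (entry n (1\<^sub>m (n + 1))) (b, v) = \<one>\<^bsub>R\<^esub> (b, v)"
      using b v by (simp add: R_simps)
  qed (simp_all add: bb_map_extensional R_simps)
  then show "bb_map (entry n \<one>\<^bsub>incidence_block_algebra\<^esub>) =
      (\<one>\<^bsub>R\<^esub> :: 'k elt \<times> 'k elt \<Rightarrow> 'k elt)"
    by (simp add: simps)
qed (use bb_map_bij in simp)

end

theorem theorem2p2:
  fixes n :: nat and P :: "nat rel"
  assumes "n \<ge> 1"
    and "partial_order_on {1..n} P"
    and "\<forall>(i, j)\<in>P. i \<le> j"
  shows
    "let M = full_mat_algebra (n + 1) :: ('k::field, 'k mat) module;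
         B = lower_block n (diagonal_mats n);
         C = lower_block n (incidence_algebra n P)
     in K_algebra_isomorphic (poset_A n P) (M\<lparr>carrier := B\<rparr>) \<and>
        K_subalgebra B M \<and> K_subalgebra C M \<and> B \<subseteq> C \<and>
        K_algebra_isomorphic (M\<lparr>carrier := C\<rparr>) (poset_R n P)"
proof -
  interpret quiver_poset n P
    using assms(2) by unfold_locales
  have refl: "(i, i) \<in> P" if "i \<in> {1..n}" for i
    using partial_order_onD(1)[OF assms(2)] that by (auto simp: refl_on_def)
  have "K_subalgebra (lower_block n (diagonal_mats n)) (full_mat_algebra (n + 1) :: ('k, 'k mat) module)"
    unfolding diagonal_mats_eq_incidence by (rule K_subalgebra_lower_block) (auto intro: transI)
  moreover have "K_subalgebra (lower_block n (incidence_algebra n P)) (full_mat_algebra (n + 1) :: ('k, 'k mat) module)"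
    using refl partial_order_onD(2)[OF assms(2)] by (intro K_subalgebra_lower_block poset_subset)
  moreover have "Id_on {1..n} \<subseteq> P"
    using refl by auto
  then have "(diagonal_mats n :: 'k mat set) \<subseteq> incidence_algebra n P"
    unfolding diagonal_mats_eq_incidence incidence_algebra_def by blast
  then have "(lower_block n (diagonal_mats n) :: 'k mat set) \<subseteq> lower_block n (incidence_algebra n P)"
    unfolding lower_block_def by blast
  ultimately show ?thesis
    unfolding Let_def using A_isomorphic R_isomorphic by blast
qed

end
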